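(* Consider the Constrained-degree percolation process on $\mathbb{L}^2$ with degree restriction $k_v=3$ for all $v\in\mathbb{Z}^2$, and let $t\in[0,1]$. If $P\{0\leftrightarrow\infty\text{ at }t\}>0$, then $P$-almost surely the configuration $\omega_t$ has exactly one infinite open cluster.
   Context: $\mathbb{L}^2$ denotes the square lattice: the graph with vertex set $\mathbb{Z}^2$ and edges between nearest neighbours (points at $\ell_1$-distance 1). Constrained-degree percolation model. Let $G=(\mathbb{V},\mathbb{E})$ be an infinite connected graph of bounded degree with a distinguished vertex $0$ (the origin), and let $\kappa=(k_v)_{v\in\mathbb{V}}$ be integers (the degree restrictions). Let $U=(U_e)_{e\in\mathbb{E}}$ be i.i.d. random variables uniform on $[0,1]$, i.e. the coordinates on $[0,1]^{\mathbb{E}}$ with the cylinder $\sigma$-algebra and the product $P$ of Lebesgue measures. At time $0$ all edges are closed. Each edge $e=\langle u_1,u_2\rangle$ tries to open at time $U_e$; it succeeds, and then remains open forever, if and only if just before that time each endpoint $u_i$ ($i=1,2$) has strictly fewer than $k_{u_i}$ open incident edges; otherwise it stays closed forever. Formally, the configuration $\omega_t=\omega_t^{G,\kappa}(U)\in\{0,1\}^{\mathbb{E}}$ at time $t\in[0,1]$ is the ($P$-a.s. well-defined) one such that for $e=\langle u_1,u_2\rangle$, $$\omega_{t,e}=\mathbf 1\{U_e<t\}\prod_{i=1}^{2}\mathbf 1\bigl\{\#\{v\in\mathbb{V}\setminus\{u_{3-i}\}: \langle u_i,v\rangle\in\mathbb{E},\ \omega_{U_e,\langle u_i,v\rangle}=1\}<k_{u_i}\bigr\}.$$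 An edge $e$ is open at time $t$ if $\omega_{t,e}=1$ and closed otherwise. Open clusters of $\omega_t$ are the connected components of the graph with vertex set $\mathbb{V}$ and edge set the open edges at time $t$. The event $\{0\leftrightarrow\infty\text{ at }t\}$ is that infinitely many vertices are connected to the origin by paths of edges open in $\omega_t$. *)

theory Defs
  imports "HOL-Probability.Probability"
begin

(* A simple graph is given by its vertex type 'v (every element is a vertex) and a set
   E of two-element sets.  A configuration assigns to a time and an edge whether
   that edge is open at that time. *)

definition square_lattice :: "(int \<times> int) set set" where
  "square_lattice = {{u, v} | u v. \<bar>fst u - fst v\<bar> + \<bar>snd u - snd v\<bar> = 1}"

definition clock_measure :: "'v set set \<Rightarrow> ('v set \<Rightarrow> real) measure" where
  "clock_measure E = Pi\<^sub>M E (\<lambda>_. restrict_space lborel {0..1})"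

(* Just before the attempt of the edge {u, w} at time s, the endpoint u has
   strictly fewer than k u open incident edges. *)
definition has_free_degree ::
  "'v set set \<Rightarrow> ('v \<Rightarrow> int) \<Rightarrow> (real \<Rightarrow> 'v set \<Rightarrow> bool) \<Rightarrow> real \<Rightarrow> 'v \<Rightarrow> 'v \<Rightarrow> bool" where
  "has_free_degree E k \<omega> s u w \<longleftrightarrow>
     int (card {v. v \<noteq> w \<and> {u, v} \<in> E \<and> \<omega> s {u, v}}) < k u"

(* The first conjunct only fixes the irrelevant values outside [0,1] and E, so that
   solutions can be compared as total functions. *)
definition is_cdp_configuration ::
  "'v set set \<Rightarrow> ('v \<Rightarrow> int) \<Rightarrow> ('v set \<Rightarrow> real) \<Rightarrow> (real \<Rightarrow> 'v set \<Rightarrow> bool) \<Rightarrow> bool" where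
  "is_cdp_configuration E k U \<omega> \<longleftrightarrow>
     (\<forall>t e. \<omega> t e \<longrightarrow> t \<in> {0..1} \<and> e \<in> E) \<and>
     (\<forall>t\<in>{0..1}. \<forall>u\<^sub>1 u\<^sub>2. {u\<^sub>1, u\<^sub>2} \<in> E \<longrightarrow>
        (\<omega> t {u\<^sub>1, u\<^sub>2} \<longleftrightarrow>
           U {u\<^sub>1, u\<^sub>2} < t \<and>
           has_free_degree E k \<omega> (U {u\<^sub>1, u\<^sub>2}) u\<^sub>1 u\<^sub>2 \<and>
           has_free_degree E k \<omega> (U {u\<^sub>1, u\<^sub>2}) u\<^sub>2 u\<^sub>1))"

(* For bounded degree the equations have exactly one solution for almost every U.
   On the exceptional null set all edges are declared closed; The without a unique
   witness could depend on U in a non-measurable way. *)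
definition cdp_configuration ::
  "'v set set \<Rightarrow> ('v \<Rightarrow> int) \<Rightarrow> ('v set \<Rightarrow> real) \<Rightarrow> real \<Rightarrow> 'v set \<Rightarrow> bool" where
  "cdp_configuration E k U =
     (if \<exists>!\<omega>. is_cdp_configuration E k U \<omega>
      then THE \<omega>. is_cdp_configuration E k U \<omega>
      else (\<lambda>_ _. False))"

definition open_cluster :: "('v set \<Rightarrow> bool) \<Rightarrow> 'v \<Rightarrow> 'v set" where
  "open_cluster \<eta> x = {y. (\<lambda>u v. \<eta> {u, v})\<^sup>*\<^sup>* x y}"

definition open_clusters :: "('v set \<Rightarrow> bool) \<Rightarrow> 'v set set" where
  "open_clusters \<eta> = range (open_cluster \<eta>)"

end

theory Submission
  imports Defs
begin

text \<open>This is the argument of Burton and Keane. Influence in the dynamics travels along chains of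
  adjacent edges with decreasing clocks, which are almost surely finite, so the configuration is given
  by a well-founded recursion.

  Finite energy: choose \<tau> < t such that a given finite region does not attempt any edge in [\<tau>, t).
  Raising the clocks of its closed edges beyond \<tau> changes nothing before \<tau>. After that, an open edge
  can be closed by raising its clock and a closed edge with free endpoints can be opened by a clock
  just below \<tau>, without side effects before \<tau>; between \<tau> and t the region can only gain edges. This
  works for t = 1 as well, where closed edges cannot be postponed beyond t.

  Clusters with three ends are excluded by counting trifurcations against the boundary of a large
  square. Consequently, at each vertex of degree 3 some edge can be closed at the price of a finite
  piece of its cluster only, so that neighbouring clusters can be joined with positive probability. If
  infinite clusters were not unique, repeated joining would lead from two of them to exactly one,
  against ergodicity, or from three of them to a cluster with three ends.\<close>

section \<open>Clusters and their ends\<close>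

text \<open>The model is not insertion tolerant: a saturated vertex accepts no further edge, and a
  change of one clock may spread to later times. Forcing an edge between two clusters can therefore
  require closing edges first, which may break the clusters, and the surgery controls the new
  configuration only from below. The notions are built to survive this: \<open>joins\<close> allows
  finite losses and arbitrary finite gains, and merging is followed through infinite ends
  (\<open>escapes\<close>) instead of fixed vertices, because finitely many changes destroy no end.
  No measurable selection is made. If redrawing one clock leads into a null event with positive
  probability, the starting clocks form a null event as well (\<open>resample\<close>), so the
  induction on separated ends only carries almost sure statements from modified configurations back
  to the original one. Only two kinds of end systems have to be followed, three ends or two ends
  meeting every infinite cluster, since their complete merging contradicts the absence of
  trifurcations or the assumed non-uniqueness.\<close>

definition linked :: "('v set \<Rightarrow> bool) \<Rightarrow> 'v set \<Rightarrow> 'v \<Rightarrow> 'v \<Rightarrow> bool" where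
  "linked \<eta> D = (\<lambda>u v. \<eta> {u, v} \<and> u \<notin> D \<and> v \<notin> D)\<^sup>*\<^sup>*"

definition escapes :: "('v set \<Rightarrow> bool) \<Rightarrow> 'v set \<Rightarrow> 'v \<Rightarrow> bool" where
  "escapes \<eta> D x \<longleftrightarrow> infinite {y. linked \<eta> D x y}"

text \<open>\<open>D\<close> need neither be connected nor lie in the cluster, so that the vertices
  of any finite perturbation may be added to it; \<open>splits_cluster\<close> below is the
  connected form needed for counting.\<close>

definition trifurcates :: "('v set \<Rightarrow> bool) \<Rightarrow> bool" where
  "trifurcates \<eta> \<longleftrightarrow> (\<exists>D x y z. finite D \<and> escapes \<eta> D x \<and> escapes \<eta> D y \<and> escapes \<eta> D z \<and>
     \<not> linked \<eta> D x y \<and> \<not> linked \<eta> D x z \<and> \<not> linked \<eta> D y z \<and>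
     linked \<eta> {} x y \<and> linked \<eta> {} x z)"

lemma linked_refl [simp]: "linked \<eta> D x x"
  by (simp add: linked_def)

lemma linked_step: "\<eta> {x, y} \<Longrightarrow> x \<notin> D \<Longrightarrow> y \<notin> D \<Longrightarrow> linked \<eta> D x y"
  unfolding linked_def by (rule r_into_rtranclp) simp

lemma linked_trans: "linked \<eta> D x y \<Longrightarrow> linked \<eta> D y z \<Longrightarrow> linked \<eta> D x z"
  unfolding linked_def by (rule rtranclp_trans)

lemma linked_sym: "linked \<eta> D x y \<Longrightarrow> linked \<eta> D y x"
  unfolding linked_def
proof (induction rule: rtranclp_induct)
  case (step y z)
  then show ?case
    by (auto simp: insert_commute[of y z] intro: converse_rtranclp_into_rtranclp)
qed simp

lemma linked_commute: "linked \<eta> D x y \<longleftrightarrow> linked \<eta> D y x"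
  by (blast intro: linked_sym)

lemma linked_induct [consumes 1, case_names refl step]:
  assumes "linked \<eta> D x y" "P x"
    and "\<And>y z. linked \<eta> D x y \<Longrightarrow> \<eta> {y, z} \<Longrightarrow> y \<notin> D \<Longrightarrow> z \<notin> D \<Longrightarrow> P y \<Longrightarrow> P z"
  shows "P y"
  using assms(1) unfolding linked_def
proof (induction rule: rtranclp_induct)
  case base
  then show ?case by (rule assms(2))
next
  case (step y z)
  then show ?case using assms(3)[of y z] by (simp add: linked_def)
qed

lemma linked_mono:
  assumes "linked \<eta> D x y" "D' \<subseteq> D" "\<And>e. \<eta> e \<Longrightarrow> \<eta>' e"
  shows "linked \<eta>' D' x y"
  using assms(1)
proof (induction rule: linked_induct)
  case (step y z)
  then show ?case using assms(2,3) by (meson linked_step linked_trans subsetD)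
qed simp

lemma linked_avoids: "linked \<eta> D x y \<Longrightarrow> x \<noteq> y \<Longrightarrow> x \<notin> D \<and> y \<notin> D"
  by (induction rule: linked_induct) auto

text \<open>\<open>linked\<close> is reflexive even at deleted points, so a deleted point is linked
  to itself alone.\<close>

lemma escapes_notin: "escapes \<eta> D x \<Longrightarrow> x \<notin> D"
proof
  assume "escapes \<eta> D x" "x \<in> D"
  then have "{y. linked \<eta> D x y} \<subseteq> {x}" using linked_avoids by fastforce
  then show False using \<open>escapes \<eta> D x\<close> by (auto simp: escapes_def dest: finite_subset)
qed

lemma escapes_mono:
  assumes "escapes \<eta> D x" "D' \<subseteq> D" "\<And>e. \<eta> e \<Longrightarrow> \<eta>' e"
  shows "escapes \<eta>' D' x"
proof -
  have "{y. linked \<eta> D x y} \<subseteq> {y. linked \<eta>' D' x y}"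
    using linked_mono[OF _ assms(2,3)] by auto
  then show ?thesis using assms(1) by (auto simp: escapes_def dest: finite_subset)
qed

text \<open>By local finiteness a finite deletion cuts a component into finitely many pieces, so an
  infinite component keeps an infinite piece.\<close>

lemma escapes_remove:
  assumes lf: "\<And>x. finite {y. \<eta> {x, y}}" and "finite D'" and "D \<subseteq> D'" and esc: "escapes \<eta> D x"
  shows "\<exists>y. linked \<eta> D x y \<and> escapes \<eta> D' y"
proof (rule ccontr)
  assume neg: "\<not> ?thesis"
  \<comment> \<open>Every piece contains a point of \<open>N\<close>: follow a path from
    \<open>x\<close> and restart at each exit from \<open>D'\<close>.\<close>
  define N where "N = {n. linked \<eta> D x n \<and> (n = x \<or> (\<exists>d\<in>D'. \<eta> {d, n}))}"
  have "N \<subseteq> insert x (\<Union>d\<in>D'. {n. \<eta> {d, n}})" by (auto simp: N_def)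
  moreover have "finite (insert x (\<Union>d\<in>D'. {n. \<eta> {d, n}}))" using lf assms(2) by auto
  ultimately have "finite N" by (rule finite_subset)
  have "y \<in> D' \<or> (\<exists>n\<in>N. linked \<eta> D' n y)" if "linked \<eta> D x y" for y
    using that
  proof (induction rule: linked_induct)
    case refl
    have "x \<in> N" by (simp add: N_def)
    then show ?case by (metis linked_refl)
  next
    case (step y z)
    show ?case
    proof (cases "z \<in> D'")
      case False
      show ?thesis
      proof (cases "y \<in> D'")
        case True
        then have "z \<in> N" using step linked_trans[OF step(1) linked_step[of \<eta> y z D, OF step(2,3,4)]]
          by (auto simp: N_def)
        then show ?thesis by (metis linked_refl)
      next
        case y: False
        then obtain n where "n \<in> N" "linked \<eta> D' n y" using step by auto
        then show ?thesis using linked_trans[OF _ linked_step[of \<eta> y z D']] y False step by blast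
      qed
    qed simp
  qed
  then have "{y. linked \<eta> D x y} \<subseteq> D' \<union> (\<Union>n\<in>N. {y. linked \<eta> D' n y})" by auto
  moreover have "finite (D' \<union> (\<Union>n\<in>N. {y. linked \<eta> D' n y}))"
    using neg \<open>finite N\<close> assms(2) by (auto simp: N_def escapes_def)
  ultimately show False using esc by (auto simp: escapes_def dest: finite_subset)
qed

lemma linked_change:
  assumes "linked \<eta> D x y" "\<And>e. e \<inter> D = {} \<Longrightarrow> \<eta> e \<Longrightarrow> \<eta>' e"
  shows "linked \<eta>' D x y"
  using assms(1)
proof (induction rule: linked_induct)
  case (step y z)
  then show ?case using assms(2)[of "{y, z}"] linked_step[of \<eta>' y z D] linked_trans by fastforce
qed simp

lemma linked_last_exit:
  assumes "linked \<eta> {} x y"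
  shows "y = x \<or> (\<exists>n. \<eta> {x, n} \<and> linked \<eta> {x} n y)"
  using assms
proof (induction rule: linked_induct)
  case (step y z)
  show ?case
  proof (cases "z = x \<or> y = x")
    case True
    then show ?thesis using step by auto
  next
    case False
    then show ?thesis using step linked_step[of \<eta> y z "{x}"] linked_trans by fastforce
  qed
qed simp

text \<open>If the three neighbours of a vertex of degree 3 lay in three distinct infinite
  components after its removal, it would be a trifurcation. So some neighbour \<open>n\<close>
  either is linked to another one around \<open>x\<close>, and dropping \<open>{x, n}\<close>
  disconnects nothing, or hangs on a finite piece, which is all that is lost. \<open>Q\<close> is
  empty for smaller degree and this single edge otherwise.\<close>

lemma droppable_edge:
  fixes \<eta> :: "'v set \<Rightarrow> bool"
  assumes lf: "\<And>x. finite {y. \<eta> {x, y}}" and loop: "\<not> \<eta> {x}"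
    and nt: "\<not> trifurcates \<eta>" and deg: "card {y. \<eta> {x, y}} \<le> 3"
  shows "\<exists>Q. finite Q \<and> (\<forall>e\<in>Q. \<eta> e \<and> (\<exists>n. e = {x, n})) \<and> card {y. \<eta> {x, y} \<and> {x, y} \<notin> Q} \<le> 2 \<and>
    finite ({y. linked \<eta> {} x y} - {y. linked (\<lambda>e. \<eta> e \<and> e \<notin> Q) {} x y})"
proof (cases "card {y. \<eta> {x, y}} \<le> 2")
  case True
  then show ?thesis by (intro exI[of _ "{}"]) simp
next
  case False
  define N where "N = {y. \<eta> {x, y}}"
  have N3: "card N = 3" using False deg by (simp add: N_def)
  have xN: "x \<notin> N" using loop by (auto simp: N_def)
  have "\<exists>n\<in>N. (\<exists>m\<in>N - {n}. linked \<eta> {x} n m) \<or> \<not> escapes \<eta> {x} n"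
  proof (rule ccontr)
    assume neg: "\<not> ?thesis"
    obtain a b c where N: "N = {a, b, c}" "a \<noteq> b" "a \<noteq> c" "b \<noteq> c"
      using N3 by (auto simp: card_3_iff)
    have "\<eta> {a, x}" "\<eta> {x, b}" "\<eta> {x, c}" using N by (auto simp: N_def insert_commute)
    then have "linked \<eta> {} a x" "linked \<eta> {} x b" "linked \<eta> {} x c"
      by (auto intro: linked_step)
    then have "linked \<eta> {} a b" "linked \<eta> {} a c"
      by (metis linked_trans)+
    moreover have "escapes \<eta> {x} n" if "n \<in> N" for n using neg that by blast
    then have "escapes \<eta> {x} a" "escapes \<eta> {x} b" "escapes \<eta> {x} c" using N(1) by blast+
    moreover have "\<not> linked \<eta> {x} n m" if "n \<in> N" "m \<in> N" "n \<noteq> m" for n m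
      using neg that by blast
    then have "\<not> linked \<eta> {x} a b" "\<not> linked \<eta> {x} a c" "\<not> linked \<eta> {x} b c"
      using N by blast+
    ultimately have "trifurcates \<eta>" unfolding trifurcates_def
      by (meson finite.emptyI finite.insertI)
    then show False using nt by simp
  qed
  then obtain n where n: "n \<in> N"
    and alt: "(\<exists>m\<in>N - {n}. linked \<eta> {x} n m) \<or> \<not> escapes \<eta> {x} n" by blast
  define \<eta>' where "\<eta>' = (\<lambda>e. \<eta> e \<and> e \<notin> {{x, n}})"
  have keep: "linked \<eta>' {} a b" if "linked \<eta> {x} a b" for a b
  proof -
    have "linked \<eta>' {x} a b" using that
      by (rule linked_change) (auto simp: \<eta>'_def)
    then show ?thesis by (rule linked_mono) auto
  qed
  have nb: "linked \<eta>' {} x m" if "m \<in> N" "m \<noteq> n" for m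
    using that by (intro linked_step) (auto simp: \<eta>'_def N_def doubleton_eq_iff)
  \<comment> \<open>Whatever is lost hangs on \<open>n\<close>: after its last visit to
    \<open>x\<close> a path continues through some neighbour, and every neighbour other than
    \<open>n\<close> is still attached to \<open>x\<close>.\<close>
  have sub: "{y. linked \<eta> {} x y} - {y. linked \<eta>' {} x y} \<subseteq> {y. linked \<eta> {x} n y}"
  proof (clarify, rule ccontr)
    fix y assume y: "linked \<eta> {} x y" "\<not> linked \<eta>' {} x y" "\<not> linked \<eta> {x} n y"
    then obtain m where "m \<in> N" "linked \<eta> {x} m y"
      using linked_last_exit[OF y(1)] by (auto simp: N_def)
    then show False using y nb[of m] keep[of m y] linked_trans by metis
  qed
  have "finite ({y. linked \<eta> {} x y} - {y. linked \<eta>' {} x y})"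
  proof (cases "escapes \<eta> {x} n")
    case True
    then obtain m where m: "m \<in> N" "m \<noteq> n" "linked \<eta> {x} n m" using alt by auto
    have "linked \<eta>' {} x n"
      using linked_trans[OF nb[OF m(1,2)]] keep[OF linked_sym[OF m(3)]] by blast
    then have "{y. linked \<eta> {} x y} - {y. linked \<eta>' {} x y} = {}"
      using sub keep[of n] linked_trans by fast
    then show ?thesis by (simp only: finite.emptyI)
  next
    case False
    then show ?thesis using sub by (auto simp: escapes_def dest: finite_subset)
  qed
  moreover have "{y. \<eta> {x, y} \<and> {x, y} \<notin> {{x, n}}} = N - {n}"
    by (auto simp: N_def doubleton_eq_iff)
  then have "card {y. \<eta> {x, y} \<and> {x, y} \<notin> {{x, n}}} \<le> 2"
    using n N3 by (simp add: card_Diff_singleton)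
  ultimately show ?thesis using n
    by (intro exI[of _ "{{x, n}}"]) (auto simp: N_def \<eta>'_def)
qed

text \<open>One-sided on purpose: edges may be gained anywhere, while the two clusters that are
  joined may lose finite pieces and every other cluster keeps all its connections. Both losses are
  measured against the new cluster of \<open>v\<close>, which is also that of
  \<open>w\<close>.\<close>

definition joins :: "('v set \<Rightarrow> bool) \<Rightarrow> 'v \<Rightarrow> 'v \<Rightarrow> ('v set \<Rightarrow> bool) \<Rightarrow> bool" where
  "joins \<eta> v w \<eta>' \<longleftrightarrow> finite {e. \<eta> e \<noteq> \<eta>' e} \<and> linked \<eta>' {} v w \<and>
     finite ({y. linked \<eta> {} v y} - {y. linked \<eta>' {} v y}) \<and>
     finite ({y. linked \<eta> {} w y} - {y. linked \<eta>' {} v y}) \<and>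
     (\<forall>x y. \<not> linked \<eta> {} v x \<longrightarrow> \<not> linked \<eta> {} w x \<longrightarrow> linked \<eta> {} x y \<longrightarrow> linked \<eta>' {} x y)"

text \<open>An edge of \<open>Q'\<close> is open and has \<open>w\<close> as an endpoint, hence
  belongs to the cluster of \<open>w\<close>; a path from \<open>v\<close>, in another cluster,
  never uses it. So the deletions at the two endpoints of the new edge do not interfere.\<close>

lemma linked_without_foreign:
  assumes "linked (\<lambda>e. \<eta> e \<and> e \<notin> Q) {} v y" and nl: "\<not> linked \<eta> {} w v"
    and Q: "\<forall>e\<in>Q'. \<eta> e \<and> (\<exists>n. e = {w, n})" and up: "\<And>e. \<eta> e \<Longrightarrow> e \<notin> Q \<Longrightarrow> e \<notin> Q' \<Longrightarrow> \<eta>' e"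
  shows "linked \<eta>' {} v y"
proof -
  have "linked \<eta> {} v y \<and> linked \<eta>' {} v y"
    using assms(1)
  proof (induction rule: linked_induct)
    case (step y z)
    have "{y, z} \<notin> Q'"
    proof
      assume "{y, z} \<in> Q'"
      then obtain n where n: "{y, z} = {w, n}" using Q by auto
      then have "linked \<eta> {} w y"
        using step linked_step[of \<eta> z y "{}"] by (auto simp: doubleton_eq_iff insert_commute)
      then show False using nl step linked_trans linked_sym by metis
    qed
    then show ?case
      using step up[of "{y, z}"] linked_step[of \<eta> y z "{}"] linked_step[of \<eta>' y z "{}"] linked_trans
      by (metis empty_iff)
  qed simp
  then show ?thesis by simp
qed

lemma joins_intro:
  assumes nl: "\<not> linked \<eta> {} v w"
    and Qv: "\<forall>e\<in>Qv. \<eta> e \<and> (\<exists>n. e = {v, n})" and Qw: "\<forall>e\<in>Qw. \<eta> e \<and> (\<exists>n. e = {w, n})"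
    and fv: "finite ({y. linked \<eta> {} v y} - {y. linked (\<lambda>e. \<eta> e \<and> e \<notin> Qv) {} v y})"
    and fw: "finite ({y. linked \<eta> {} w y} - {y. linked (\<lambda>e. \<eta> e \<and> e \<notin> Qw) {} w y})"
    and up: "\<And>e. \<eta> e \<Longrightarrow> e \<notin> Qv \<Longrightarrow> e \<notin> Qw \<Longrightarrow> \<eta>' e" and vw: "\<eta>' {v, w}"
    and fin: "finite {e. \<eta> e \<noteq> \<eta>' e}"
  shows "joins \<eta> v w \<eta>'"
proof -
  have l: "linked \<eta>' {} v w" using vw by (intro linked_step) auto
  have a: "linked \<eta>' {} v y" if "linked (\<lambda>e. \<eta> e \<and> e \<notin> Qv) {} v y" for y
    using linked_without_foreign[OF that _ Qw, of \<eta>'] nl up linked_sym by metis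
  have b: "linked \<eta>' {} w y" if "linked (\<lambda>e. \<eta> e \<and> e \<notin> Qw) {} w y" for y
    using linked_without_foreign[OF that _ Qv, of \<eta>'] nl up by metis
  have c: "linked \<eta>' {} x y"
    if "\<not> linked \<eta> {} v x" "\<not> linked \<eta> {} w x" "linked \<eta> {} x y" for x y
    using that(3,1,2)
  proof (induction rule: linked_induct)
    case (step y z)
    have "{y, z} \<notin> Qv \<union> Qw"
    proof
      assume "{y, z} \<in> Qv \<union> Qw"
      then obtain n u where n: "{y, z} = {u, n}" "u = v \<or> u = w" using Qv Qw by blast
      then have "linked \<eta> {} u y"
        using step linked_step[of \<eta> z y "{}"] by (auto simp: doubleton_eq_iff insert_commute)
      then show False using step n linked_trans linked_sym by metis
    qed
    then show ?case using step up[of "{y, z}"] linked_step[of \<eta>' y z "{}"] linked_trans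
      by (metis UnI1 UnI2 empty_iff)
  qed simp
  have "finite ({y. linked \<eta> {} v y} - {y. linked \<eta>' {} v y})"
    using a by (intro finite_subset[OF _ fv]) auto
  moreover have "finite ({y. linked \<eta> {} w y} - {y. linked \<eta>' {} v y})"
    using b linked_trans[OF l] by (intro finite_subset[OF _ fw]) auto
  ultimately show ?thesis using fin l c unfolding joins_def by blast
qed

section \<open>Counting disjoint trifurcations\<close>

lemma linked_within:
  assumes "linked \<eta> D x y" "linked \<eta> D' x a" "\<And>z. linked \<eta> D x z \<Longrightarrow> z \<notin> D'"
  shows "linked \<eta> D' a y"
  using assms(1)
proof (induction rule: linked_induct)
  case refl
  then show ?case using assms(2) by (rule linked_sym)
next
  case (step y z)
  have "linked \<eta> D y z" using step linked_step[of \<eta> y z D] by blast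
  then have "z \<notin> D'" "y \<notin> D'" using assms(3) step(1) linked_trans[OF step(1)] by blast+
  then show ?case using step linked_step[of \<eta> y z D'] linked_trans by metis
qed

lemma linked_first_hit:
  assumes "linked \<eta> {} b d" "d \<in> D" "b \<notin> D"
  shows "\<exists>u v. linked \<eta> D b u \<and> u \<notin> D \<and> v \<in> D \<and> \<eta> {u, v}"
proof -
  have "linked \<eta> D b y \<and> y \<notin> D \<or> (\<exists>u v. linked \<eta> D b u \<and> u \<notin> D \<and> v \<in> D \<and> \<eta> {u, v})"
    if "linked \<eta> {} b y" for y
    using that
  proof (induction rule: linked_induct)
    case (step y z)
    then show ?case using linked_step[of \<eta> y z D] linked_trans by metis
  qed (use assms in simp)
  then show ?thesis using assms by blast
qed

text \<open>Among the components cut out by some D i, one that meets the fewest other sets D j meets none of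
  them. Then i can be removed together with a point b of that component: if b was needed for D j,
  a point of another component of D i that avoids D j takes its place.\<close>
lemma trifurcation_count:
  fixes D :: "'i \<Rightarrow> 'v set"
  assumes "finite I" "finite B" "disjoint_family_on D I"
    and conn: "\<And>i x y. i \<in> I \<Longrightarrow> x \<in> D i \<Longrightarrow> y \<in> D i \<Longrightarrow> linked \<eta> (- D i) x y"
    and tri: "\<And>i. i \<in> I \<Longrightarrow> \<exists>a b c d. a \<in> B - D i \<and> b \<in> B - D i \<and> c \<in> B - D i \<and> d \<in> D i \<and>
        linked \<eta> {} a d \<and> linked \<eta> {} b d \<and> linked \<eta> {} c d \<and>
        \<not> linked \<eta> (D i) a b \<and> \<not> linked \<eta> (D i) a c \<and> \<not> linked \<eta> (D i) b c"
  shows "card I \<le> card B"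
  using assms
proof (induction "card I" arbitrary: I B)
  case 0
  then show ?case by simp
next
  case (Suc m)
  note fI = Suc.prems(1) and fB = Suc.prems(2) and disj = Suc.prems(3)
    and conn = Suc.prems(4) and tri = Suc.prems(5)
  define K where "K = (\<lambda>i b. {x. linked \<eta> (D i) b x})"
  define n where "n = (\<lambda>(i, b). card {j\<in>I - {i}. D j \<inter> K i b \<noteq> {}})"
  define ok where "ok = (\<lambda>(i, b). i \<in> I \<and> b \<in> B - D i \<and> (\<exists>d\<in>D i. linked \<eta> {} b d))"
  have dj: "x \<notin> D j" if "i \<in> I" "j \<in> I" "i \<noteq> j" "x \<in> D i" for i j x
    using disj that by (auto simp: disjoint_family_on_def)
  have KD: "K i b \<inter> D i = {}" if "b \<notin> D i" for i b
    using linked_avoids that by (fastforce simp: K_def)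
  have inner: "linked \<eta> (D j) x y" if "i \<in> I" "j \<in> I" "i \<noteq> j" "x \<in> D i" "y \<in> D i" for i j x y
    using linked_mono[OF conn[OF that(1,4,5)], of "D j" \<eta>] dj that by blast
  \<comment> \<open>A path from \<open>b\<close> stays in the component of \<open>b\<close> until it
    hits \<open>D i\<close>, hence misses \<open>D j\<close>; the rest runs inside
    \<open>D i\<close>.\<close>
  have reach: "linked \<eta> (D j) d b"
    if ok: "ok (i, b)" and j: "j \<in> I" "i \<noteq> j" "D j \<inter> K i b = {}" and d: "d \<in> D i" for i j b d
  proof -
    have i: "i \<in> I" "b \<notin> D i" using ok by (auto simp: ok_def)
    obtain e where e: "e \<in> D i" "linked \<eta> {} b e" using ok by (auto simp: ok_def)
    obtain u v where uv: "linked \<eta> (D i) b u" "u \<notin> D i" "v \<in> D i" "\<eta> {u, v}"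
      using linked_first_hit[OF e(2,1) i(2)] by blast
    have nj: "z \<notin> D j" if "linked \<eta> (D i) b z" for z
      using that j(3) by (auto simp: K_def)
    have "linked \<eta> (D j) b u" using linked_within[OF uv(1) linked_refl nj] .
    moreover have "linked \<eta> (D j) u v"
      using uv nj[OF uv(1)] dj[OF i(1) j(1,2) uv(3)] by (intro linked_step) auto
    moreover have "linked \<eta> (D j) v d" using inner[OF i(1) j(1,2) uv(3) d] .
    ultimately show ?thesis using linked_trans linked_sym by metis
  qed
  \<comment> \<open>\<open>D j\<close> is connected and disjoint from \<open>D i\<close>, so it lies
    in a single component of the complement of \<open>D i\<close>.\<close>
  have one: "linked \<eta> (D i) b b'"
    if h: "i \<in> I" "j \<in> I" "i \<noteq> j" "D j \<inter> K i b \<noteq> {}" "D j \<inter> K i b' \<noteq> {}" for i j b b'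
  proof -
    obtain x y where "x \<in> D j" "y \<in> D j" "linked \<eta> (D i) b x" "linked \<eta> (D i) b' y"
      using h(4,5) by (auto simp: K_def)
    then show ?thesis using inner[of j i x y] h linked_trans linked_sym by metis
  qed
  have "I \<noteq> {}" using Suc.hyps(2) by auto
  then obtain i0 where "i0 \<in> I" by blast
  then have "\<exists>p. ok p" using tri[of i0] by (auto simp: ok_def)
  then obtain i b where ok: "ok (i, b)" and min: "\<And>p. ok p \<Longrightarrow> n (i, b) \<le> n p"
    using ex_has_least_nat[of ok _ n] by (metis surj_pair)
  have iI: "i \<in> I" and b: "b \<in> B" "b \<notin> D i" using ok by (auto simp: ok_def)
  have empty: "D j \<inter> K i b = {}" if j: "j \<in> I" "j \<noteq> i" for j
  proof (rule ccontr)
    assume meet: "D j \<inter> K i b \<noteq> {}"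
    obtain a1 a2 a3 d where a: "a1 \<in> B - D j" "a2 \<in> B - D j" "a3 \<in> B - D j" "d \<in> D j"
        "linked \<eta> {} a1 d" "linked \<eta> {} a2 d" "linked \<eta> {} a3 d"
        "\<not> linked \<eta> (D j) a1 a2" "\<not> linked \<eta> (D j) a1 a3" "\<not> linked \<eta> (D j) a2 a3"
      using tri[OF j(1)] by blast
    have "D i \<inter> K j a1 = {} \<or> D i \<inter> K j a2 = {}"
      using one[of j i a1 a2] a(8) j iI by blast
    then obtain c where c: "ok (j, c)" "D i \<inter> K j c = {}"
      using a j by (auto simp: ok_def)
    have cB: "c \<notin> D j" using c by (auto simp: ok_def)
    obtain x where x: "x \<in> D j" "linked \<eta> (D i) b x" using meet by (auto simp: K_def)
    have xc: "linked \<eta> (D i) x c" using reach[OF c(1) iI j(2) c(2) x(1)] .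
    \<comment> \<open>The component of \<open>c\<close> behind \<open>D j\<close> avoids
      \<open>D i\<close> and is linked, outside \<open>D i\<close>, to a point of \<open>D j\<close>
      inside \<open>K i b\<close>; so it is nested in \<open>K i b\<close>.\<close>
    have sub: "K j c \<subseteq> K i b"
    proof
      fix z assume "z \<in> K j c"
      then have z: "linked \<eta> (D j) c z" by (simp add: K_def)
      have "linked \<eta> (D i) c z"
        using linked_within[OF z linked_refl[of \<eta> "D i" c]] c(2) by (auto simp: K_def)
      then show "z \<in> K i b" using linked_trans[OF linked_trans[OF x(2) xc]] by (simp add: K_def)
    qed
    \<comment> \<open>Strict, because \<open>j\<close> is counted on the right only.\<close>
    have "{l\<in>I - {j}. D l \<inter> K j c \<noteq> {}} \<subset> {l\<in>I - {i}. D l \<inter> K i b \<noteq> {}}"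
    proof
      show "{l\<in>I - {j}. D l \<inter> K j c \<noteq> {}} \<subseteq> {l\<in>I - {i}. D l \<inter> K i b \<noteq> {}}"
        using sub c(2) by auto
      show "{l\<in>I - {j}. D l \<inter> K j c \<noteq> {}} \<noteq> {l\<in>I - {i}. D l \<inter> K i b \<noteq> {}}"
        using j meet by blast
    qed
    then have "n (j, c) < n (i, b)"
      using fI by (auto simp: n_def intro!: psubset_card_mono)
    then show False using min[OF c(1)] by simp
  qed
  have "card (I - {i}) \<le> card (B - {b})"
  proof (rule Suc.hyps(1))
    show "m = card (I - {i})" using Suc.hyps(2) iI fI by simp
    show "finite (I - {i})" "finite (B - {b})" using fI fB by auto
    show "disjoint_family_on D (I - {i})" using disj by (auto simp: disjoint_family_on_def)
    show "linked \<eta> (- D j) x y" if "j \<in> I - {i}" "x \<in> D j" "y \<in> D j" for j x y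
      using conn[of j x y] that by blast
    fix j assume "j \<in> I - {i}"
    then have j: "j \<in> I" "j \<noteq> i" by auto
    obtain a1 a2 a3 d where a: "a1 \<in> B - D i" "a2 \<in> B - D i" "a3 \<in> B - D i" "d \<in> D i"
        "linked \<eta> {} a1 d" "linked \<eta> {} a2 d" "linked \<eta> {} a3 d"
        "\<not> linked \<eta> (D i) a1 a2" "\<not> linked \<eta> (D i) a1 a3" "\<not> linked \<eta> (D i) a2 a3"
      using tri[OF iI] by blast
    \<comment> \<open>At least two of the three points have a component that misses
      \<open>D j\<close>, and one of these two points differs from \<open>b\<close>.\<close>
    have "\<exists>a \<in> {a1, a2, a3}. D j \<inter> K i a = {} \<and> a \<noteq> b"
    proof -
      have "D j \<inter> K i a1 = {} \<or> D j \<inter> K i a2 = {}" "D j \<inter> K i a1 = {} \<or> D j \<inter> K i a3 = {}"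
        "D j \<inter> K i a2 = {} \<or> D j \<inter> K i a3 = {}"
        using one[of i j] a(8,9,10) j iI by blast+
      moreover have "a1 \<noteq> a2" "a1 \<noteq> a3" "a2 \<noteq> a3" using a(8,9,10) by auto
      ultimately show ?thesis by blast
    qed
    then obtain b' where b': "b' \<in> B - D i" "linked \<eta> {} b' d" "D j \<inter> K i b' = {}" "b' \<noteq> b"
      using a by blast
    have okb': "ok (i, b')" using b' iI a(4) by (auto simp: ok_def)
    have db: "linked \<eta> (D j) d b" using reach[OF ok j(1) j(2)[symmetric] empty[OF j] a(4)] .
    have db': "linked \<eta> (D j) d b'" using reach[OF okb' j(1) j(2)[symmetric] b'(3) a(4)] .
    have bb: "linked \<eta> (D j) b b'" using linked_trans[OF linked_sym[OF db] db'] .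
    have bb0: "linked \<eta> {} b b'" using linked_mono[OF bb, of "{}" \<eta>] by simp
    have "b' \<notin> D j" using linked_avoids[OF bb] b'(4) by auto
    \<comment> \<open>\<open>b\<close> is given up: wherever it witnesses the splitting by
      \<open>D j\<close>, the point \<open>b'\<close> replaces it, being in the same component of
      the complement of \<open>D j\<close>.\<close>
    define f where "f = (\<lambda>x. if x = b then b' else x)"
    have f1: "f x \<in> B - {b} - D j" if "x \<in> B - D j" for x
      using that b'(1,4) \<open>b' \<notin> D j\<close> by (auto simp: f_def)
    have f2: "linked \<eta> (D j) x (f x)" for x using bb by (simp add: f_def)
    have f3: "linked \<eta> {} (f x) d" if "linked \<eta> {} x d" for x d
      using that linked_trans[OF linked_sym[OF bb0], of d] by (auto simp: f_def)
    have f4: "\<not> linked \<eta> (D j) (f x) (f y)" if "\<not> linked \<eta> (D j) x y" for x y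
      using that linked_trans[OF f2] linked_trans[OF _ linked_sym[OF f2]] by blast
    obtain c1 c2 c3 d' where c: "c1 \<in> B - D j" "c2 \<in> B - D j" "c3 \<in> B - D j" "d' \<in> D j"
        "linked \<eta> {} c1 d'" "linked \<eta> {} c2 d'" "linked \<eta> {} c3 d'"
        "\<not> linked \<eta> (D j) c1 c2" "\<not> linked \<eta> (D j) c1 c3" "\<not> linked \<eta> (D j) c2 c3"
      using tri[OF j(1)] by blast
    show "\<exists>a b' c d. a \<in> B - {b} - D j \<and> b' \<in> B - {b} - D j \<and> c \<in> B - {b} - D j \<and> d \<in> D j \<and>
        linked \<eta> {} a d \<and> linked \<eta> {} b' d \<and> linked \<eta> {} c d \<and>
        \<not> linked \<eta> (D j) a b' \<and> \<not> linked \<eta> (D j) a c \<and> \<not> linked \<eta> (D j) b' c"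
      by (intro exI[of _ "f c1"] exI[of _ "f c2"] exI[of _ "f c3"] exI[of _ d'] conjI f1 f3 f4 c)
  qed
  then show ?case using iI b fI fB by (metis Suc_le_mono card_Suc_Diff1)
qed

section \<open>The dynamics on the square lattice\<close>

definition neighbours :: "int \<times> int \<Rightarrow> (int \<times> int) set" where
  "neighbours u = {(fst u + 1, snd u), (fst u - 1, snd u), (fst u, snd u + 1), (fst u, snd u - 1)}"

lemma doubleton_in_lattice: "{u, v} \<in> square_lattice \<longleftrightarrow> v \<in> neighbours u"
proof -
  have "{u, v} \<in> square_lattice \<longleftrightarrow> \<bar>fst u - fst v\<bar> + \<bar>snd u - snd v\<bar> = 1"
    unfolding square_lattice_def mem_Collect_eq
    by (metis abs_minus_commute doubleton_eq_iff)
  also have "\<dots> \<longleftrightarrow> v \<in> neighbours u"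
    by (cases u; cases v) (auto simp: neighbours_def)
  finally show ?thesis .
qed

lemma lattice_edgeE:
  assumes "e \<in> square_lattice"
  obtains u v where "e = {u, v}" "v \<in> neighbours u" "u \<noteq> v"
proof -
  obtain u v where e: "e = {u, v}" using assms by (auto simp: square_lattice_def)
  then have v: "v \<in> neighbours u" using assms doubleton_in_lattice by simp
  then have "u \<noteq> v" by (cases u) (auto simp: neighbours_def)
  then show ?thesis using that e v by blast
qed

lemma edge_at:
  assumes "e \<in> square_lattice" "u \<in> e"
  obtains v where "e = {u, v}" "v \<in> neighbours u" "u \<noteq> v"
proof -
  obtain x y where xy: "e = {x, y}" "x \<noteq> y" using assms(1) by (rule lattice_edgeE)
  then have "e = {u, if u = x then y else x}" using assms(2) by auto
  moreover from this have "(if u = x then y else x) \<in> neighbours u"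
    using assms(1) doubleton_in_lattice by metis
  ultimately show ?thesis using that xy assms(2) by auto
qed

lemma incident_eq: "{f \<in> square_lattice. u \<in> f} = (\<lambda>v. {u, v}) ` neighbours u"
proof (intro equalityI subsetI)
  show "f \<in> (\<lambda>v. {u, v}) ` neighbours u" if "f \<in> {f \<in> square_lattice. u \<in> f}" for f
    using that by (blast elim: edge_at)
  show "f \<in> {f \<in> square_lattice. u \<in> f}" if "f \<in> (\<lambda>v. {u, v}) ` neighbours u" for f
    using that by (auto simp: doubleton_in_lattice simp del: split_paired_All split_paired_Ex)
qed

lemma card_neighbours: "finite (neighbours u)" "card (neighbours u) = 4"
  by (auto simp: neighbours_def card_insert_if)

lemma finite_incident: "finite {f \<in> square_lattice. u \<in> f}"
  by (simp add: incident_eq card_neighbours)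

lemma card_incident: "card {f \<in> square_lattice. u \<in> f} \<le> 4"
  unfolding incident_eq using card_image_le[OF card_neighbours(1)[of u]] card_neighbours(2) by metis

lemma finite_touching:
  assumes "finite X"
  shows "finite {f \<in> square_lattice. f \<inter> X \<noteq> {}}"
proof -
  have "{f \<in> square_lattice. f \<inter> X \<noteq> {}} = (\<Union>u\<in>X. {f \<in> square_lattice. u \<in> f})" by auto
  then show ?thesis using assms finite_incident by simp
qed

lemma finite_edge: "e \<in> square_lattice \<Longrightarrow> finite e"
  by (erule lattice_edgeE) simp

section \<open>The configuration as a limit of iterates\<close>

type_synonym edge = "(int \<times> int) set"

text \<open>The model excludes the attempted edge from the count by \<open>v \<noteq> w\<close>;
  here the strict comparison of clocks does so, since no edge is earlier than itself.\<close>

definition feasible :: "(edge \<Rightarrow> real) \<Rightarrow> (edge \<Rightarrow> bool) \<Rightarrow> edge \<Rightarrow> bool" where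
  "feasible U A e \<longleftrightarrow> e \<in> square_lattice \<and>
     (\<forall>u\<in>e. card {f \<in> square_lattice. u \<in> f \<and> U f < U e \<and> A f} < 3)"

text \<open>Feasibility is antitone in the set of open edges, so the iterates from the closed
  configuration are not monotone in \<open>n\<close>. An edge is settled as soon as the iterations
  outnumber the edges of every chain of decreasing clocks that ends in it.\<close>

fun attempt :: "nat \<Rightarrow> (edge \<Rightarrow> real) \<Rightarrow> edge \<Rightarrow> bool" where
  "attempt 0 U e \<longleftrightarrow> False"
| "attempt (Suc n) U e \<longleftrightarrow> feasible U (attempt n U) e"

text \<open>Unlike the unique solution in the definition of the model, this limit is measurable and
  commutes with translations for all clocks; it solves the equations where the relation
  \<open>earlier\<close> below is well-founded.\<close>
definition accepted :: "(edge \<Rightarrow> real) \<Rightarrow> edge \<Rightarrow> bool" where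
  "accepted U e \<longleftrightarrow> (\<exists>N. \<forall>n\<ge>N. attempt n U e)"

definition open_at :: "real \<Rightarrow> (edge \<Rightarrow> real) \<Rightarrow> edge \<Rightarrow> bool" where
  "open_at t U e \<longleftrightarrow> U e < t \<and> accepted U e"

lemma attempt_in_lattice: "attempt n U e \<Longrightarrow> e \<in> square_lattice"
  by (cases n) (auto simp: feasible_def)

lemma accepted_in_lattice: "accepted U e \<Longrightarrow> e \<in> square_lattice"
  by (auto simp: accepted_def dest: attempt_in_lattice)

lemma open_at_in_lattice: "open_at t U e \<Longrightarrow> e \<in> square_lattice"
  by (auto simp: open_at_def intro: accepted_in_lattice)

definition earlier :: "(edge \<Rightarrow> real) \<Rightarrow> (edge \<times> edge) set" where
  "earlier U = {(f, e). f \<in> square_lattice \<and> e \<in> square_lattice \<and> f \<inter> e \<noteq> {} \<and> U f < U e}"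

lemma feasible_cong:
  assumes "\<And>f. f \<in> square_lattice \<Longrightarrow> f \<inter> e \<noteq> {} \<Longrightarrow> (U f < U e \<and> A f) \<longleftrightarrow> (U' f < U' e \<and> A' f)"
  shows "feasible U A e \<longleftrightarrow> feasible U' A' e"
proof -
  have "{f \<in> square_lattice. u \<in> f \<and> U f < U e \<and> A f} = {f \<in> square_lattice. u \<in> f \<and> U' f < U' e \<and> A' f}"
    if "u \<in> e" for u using assms that by blast
  then show ?thesis by (simp add: feasible_def)
qed

text \<open>By well-founded induction the finitely many earlier edges touching \<open>e\<close> are
  settled from a common index on, and one further iteration settles \<open>e\<close>.\<close>

lemma attempt_stable:
  assumes "wf (earlier U)"
  shows "\<exists>N. \<forall>n\<ge>N. attempt n U e \<longleftrightarrow> accepted U e"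
  using assms
proof (induction e rule: wf_induct_rule)
  case (less e)
  show ?case
  proof (cases "e \<in> square_lattice")
    case True
    define P where "P = {f \<in> square_lattice. f \<inter> e \<noteq> {}}"
    have fP: "finite P" unfolding P_def using True finite_edge finite_touching by blast
    have "\<forall>f\<in>P. \<exists>N. U f < U e \<longrightarrow> (\<forall>n\<ge>N. attempt n U f \<longleftrightarrow> accepted U f)"
      using less True by (auto simp: P_def earlier_def)
    then obtain N where N: "\<And>f n. f \<in> P \<Longrightarrow> U f < U e \<Longrightarrow> n \<ge> N f \<Longrightarrow> attempt n U f \<longleftrightarrow> accepted U f"
      by metis
    define M where "M = Suc (Max (insert 0 (N ` P)))"
    have st: "attempt n U e \<longleftrightarrow> feasible U (accepted U) e" if "n \<ge> M" for n
    proof -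
      obtain m where m: "n = Suc m" "m \<ge> Max (insert 0 (N ` P))"
        using \<open>n \<ge> M\<close> by (cases n) (auto simp: M_def)
      have "N f \<le> m" if "f \<in> P" for f
        using m(2) that fP by (meson Max_ge finite_imageI finite_insert image_eqI insertI2 order_trans)
      then have "feasible U (attempt m U) e \<longleftrightarrow> feasible U (accepted U) e"
        using N by (intro feasible_cong) (auto simp: P_def)
      then show ?thesis using m by simp
    qed
    have "accepted U e \<longleftrightarrow> feasible U (accepted U) e"
      unfolding accepted_def[of U e] using st by (meson nat_le_linear order_refl)
    then show ?thesis using st by blast
  next
    case False
    then show ?thesis using attempt_in_lattice accepted_in_lattice by blast
  qed
qed

lemma accepted_iff:
  assumes wf: "wf (earlier U)"
  shows "accepted U e \<longleftrightarrow> feasible U (accepted U) e"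
proof (cases "e \<in> square_lattice")
  case True
  define P where "P = {f \<in> square_lattice. f \<inter> e \<noteq> {}}"
  have fP: "finite P" unfolding P_def using True finite_edge finite_touching by blast
  obtain N where N: "\<And>f n. n \<ge> N f \<Longrightarrow> attempt n U f \<longleftrightarrow> accepted U f"
    using attempt_stable[OF wf] by metis
  define m where "m = Max (N ` insert e P)"
  have "N f \<le> m" if "f \<in> insert e P" for f
    unfolding m_def using that fP by (intro Max_ge) auto
  then have "attempt m U f \<longleftrightarrow> accepted U f" if "f \<in> P" for f using N that by blast
  then have "feasible U (attempt m U) e \<longleftrightarrow> feasible U (accepted U) e"
    by (intro feasible_cong) (auto simp: P_def)
  moreover have "attempt (Suc m) U e \<longleftrightarrow> accepted U e"
    using N[of e "Suc m"] \<open>\<And>f. f \<in> insert e P \<Longrightarrow> N f \<le> m\<close>[of e] by simp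
  ultimately show ?thesis by simp
next
  case False
  then show ?thesis using accepted_in_lattice by (auto simp: feasible_def)
qed

text \<open>Clocks strictly decrease along a chain, so \<open>e\<close> occurs in it at most once,
  and behind that place the chain is one for the old clocks.\<close>

lemma wf_earlier_update:
  assumes "wf (earlier U)"
  shows "wf (earlier (U(e := s)))"
proof (rule ccontr)
  assume "\<not> ?thesis"
  then obtain f where f: "\<And>i. (f (Suc i), f i) \<in> earlier (U(e := s))"
    by (auto simp: wf_iff_no_infinite_down_chain)
  define g where "g = (\<lambda>i. (U(e := s)) (f i))"
  have dec: "g (Suc i) < g i" for i using f[of i] by (auto simp: earlier_def g_def)
  have anti: "g j < g i" if "i < j" for i j
    using that by (induction rule: strict_inc_induct) (use dec in \<open>auto intro: less_trans\<close>)
  have "\<exists>N. \<forall>i\<ge>N. f i \<noteq> e"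
  proof (cases "\<exists>i. f i = e")
    case True
    then obtain i where "f i = e" ..
    then have "f j \<noteq> e" if "j \<ge> Suc i" for j using anti[of i j] that by (auto simp: g_def)
    then show ?thesis by blast
  qed auto
  then obtain N where N: "\<And>i. i \<ge> N \<Longrightarrow> f i \<noteq> e" by blast
  have "(f (N + Suc i), f (N + i)) \<in> earlier U" for i
    using f[of "N + i"] N[of "N + i"] N[of "N + Suc i"] by (auto simp: earlier_def)
  then have "\<exists>h. \<forall>i. (h (Suc i), h i) \<in> earlier U" by (intro exI[of _ "\<lambda>i. f (N + i)"]) simp
  then show False using assms by (simp add: wf_iff_no_infinite_down_chain)
qed

text \<open>The equations of the model read off the configuration at the time of each attempt; along
  \<open>earlier\<close> this is a recursion with exactly one solution.\<close>

lemma cdp_configuration_eq_open_at: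
  assumes wf: "wf (earlier U)" and U: "\<And>e. e \<in> square_lattice \<Longrightarrow> U e \<in> {0..1}" and t: "t \<in> {0..1}"
  shows "cdp_configuration square_lattice (\<lambda>_. 3) U t = open_at t U"
proof -
  \<comment> \<open>Solutions have to vanish at times outside the unit interval, hence the explicit
    cut-off.\<close>
  define \<omega>0 where "\<omega>0 = (\<lambda>s e. s \<in> {0..1} \<and> open_at s U e)"
  have free: "has_free_degree square_lattice (\<lambda>_. 3) \<omega> (U e) u w \<longleftrightarrow>
      card {f \<in> square_lattice. u \<in> f \<and> U f < U e \<and> A f} < 3"
    if e: "e = {u, w}" "e \<in> square_lattice"
      and \<omega>: "\<And>f. f \<in> square_lattice \<Longrightarrow> u \<in> f \<Longrightarrow> f \<noteq> e \<Longrightarrow> \<omega> (U e) f \<longleftrightarrow> U f < U e \<and> A f"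
    for \<omega> e u w A
  proof -
    have "bij_betw (\<lambda>v. {u, v}) {v. v \<noteq> w \<and> {u, v} \<in> square_lattice \<and> \<omega> (U e) {u, v}}
      {f \<in> square_lattice. u \<in> f \<and> U f < U e \<and> A f}"
    proof (rule bij_betwI')
      show "({u, x} = {u, y}) = (x = y)" for x y by (auto simp: doubleton_eq_iff)
      show "{u, v} \<in> {f \<in> square_lattice. u \<in> f \<and> U f < U e \<and> A f}"
        if "v \<in> {v. v \<noteq> w \<and> {u, v} \<in> square_lattice \<and> \<omega> (U e) {u, v}}" for v
        using \<omega>[of "{u, v}"] that e(1) by (auto simp: doubleton_eq_iff)
      show "\<exists>v\<in>{v. v \<noteq> w \<and> {u, v} \<in> square_lattice \<and> \<omega> (U e) {u, v}}. f = {u, v}"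
        if f: "f \<in> {f \<in> square_lattice. u \<in> f \<and> U f < U e \<and> A f}" for f
      proof -
        obtain v where "f = {u, v}" using f by (blast elim: edge_at)
        moreover have "f \<noteq> e" using f by auto
        moreover from calculation have "v \<noteq> w" using e(1) by blast
        ultimately show ?thesis using f \<omega>[of f] by blast
      qed
    qed
    then have "card {v. v \<noteq> w \<and> {u, v} \<in> square_lattice \<and> \<omega> (U e) {u, v}} =
        card {f \<in> square_lattice. u \<in> f \<and> U f < U e \<and> A f}" by (rule bij_betw_same_card)
    then show ?thesis by (simp add: has_free_degree_def)
  qed
  have sol: "is_cdp_configuration square_lattice (\<lambda>_. 3) U \<omega>0"
    unfolding is_cdp_configuration_def
  proof (intro conjI allI ballI impI)
    show "s \<in> {0..1}" if "\<omega>0 s e" for s e using that by (simp add: \<omega>0_def)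
    show "e \<in> square_lattice" if "\<omega>0 s e" for s e
      using that open_at_in_lattice by (auto simp: \<omega>0_def)
    fix s :: real and u w :: "int \<times> int"
    assume s: "s \<in> {0..1}" and e: "{u, w} \<in> square_lattice"
    have *: "\<omega>0 (U {u, w}) f \<longleftrightarrow> U f < U {u, w} \<and> accepted U f" for f
      using U[OF e] by (auto simp: \<omega>0_def open_at_def)
    have e': "{w, u} \<in> square_lattice" "{w, u} = {u, w}" using e by (auto simp: insert_commute)
    have "feasible U (accepted U) {u, w} \<longleftrightarrow>
        has_free_degree square_lattice (\<lambda>_. 3) \<omega>0 (U {u, w}) u w \<and>
        has_free_degree square_lattice (\<lambda>_. 3) \<omega>0 (U {u, w}) w u"
      using free[OF refl e, of \<omega>0 "accepted U"] free[OF refl e'(1), of \<omega>0 "accepted U"] * e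
      by (simp add: e'(2) feasible_def)
    then show "\<omega>0 s {u, w} = (U {u, w} < s \<and>
        has_free_degree square_lattice (\<lambda>_. 3) \<omega>0 (U {u, w}) u w \<and>
        has_free_degree square_lattice (\<lambda>_. 3) \<omega>0 (U {u, w}) w u)"
      using s accepted_iff[OF wf, of "{u, w}"] by (auto simp: \<omega>0_def open_at_def)
  qed
  have uniq: "\<omega> = \<omega>0" if \<omega>: "is_cdp_configuration square_lattice (\<lambda>_. 3) U \<omega>" for \<omega>
  proof -
    have sup: "s \<in> {0..1}" "e \<in> square_lattice" if "\<omega> s e" for s e
      using \<omega> that unfolding is_cdp_configuration_def by blast+
    have step: "\<omega> s {u, w} = (U {u, w} < s \<and>
        has_free_degree square_lattice (\<lambda>_. 3) \<omega> (U {u, w}) u w \<and>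
        has_free_degree square_lattice (\<lambda>_. 3) \<omega> (U {u, w}) w u)"
      if "s \<in> {0..1}" "{u, w} \<in> square_lattice" for s u w
      using \<omega> that unfolding is_cdp_configuration_def by blast
    have "\<forall>s\<in>{0..1}. \<omega> s e = open_at s U e" for e
      using wf
    proof (induction e rule: wf_induct_rule)
      case (less e)
      show ?case
      proof (cases "e \<in> square_lattice")
        case True
        then obtain u w where e: "e = {u, w}" by (blast elim: lattice_edgeE)
        \<comment> \<open>The clock of a lattice edge is itself an admissible time. At this time the
          induction hypothesis applies to earlier edges, and the equation alone shows that all
          others are still closed.\<close>
        have *: "\<omega> (U e) f \<longleftrightarrow> U f < U e \<and> accepted U f"
          if f: "f \<in> square_lattice" "f \<inter> e \<noteq> {}" for f
        proof (cases "U f < U e")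
          case True
          then have "(f, e) \<in> earlier U" using f \<open>e \<in> square_lattice\<close> by (simp add: earlier_def)
          then show ?thesis using less.IH[of f] U[OF \<open>e \<in> square_lattice\<close>] by (auto simp: open_at_def)
        next
          case False
          obtain x y where "f = {x, y}" using f(1) by (blast elim: lattice_edgeE)
          then show ?thesis using step[of "U e" x y] f(1) False U[OF \<open>e \<in> square_lattice\<close>] by auto
        qed
        have e': "{w, u} \<in> square_lattice" "{w, u} = e" using e True by (auto simp: insert_commute)
        have "has_free_degree square_lattice (\<lambda>_. 3) \<omega> (U e) u w \<longleftrightarrow>
            card {f \<in> square_lattice. u \<in> f \<and> U f < U e \<and> accepted U f} < 3"
          by (rule free[OF e True]) (use * e in blast)
        moreover have "has_free_degree square_lattice (\<lambda>_. 3) \<omega> (U e) w u \<longleftrightarrow>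
            card {f \<in> square_lattice. w \<in> f \<and> U f < U e \<and> accepted U f} < 3"
          by (rule free[OF e'(2)[symmetric] True]) (use * e in blast)
        ultimately have "feasible U (accepted U) e \<longleftrightarrow>
            has_free_degree square_lattice (\<lambda>_. 3) \<omega> (U e) u w \<and>
            has_free_degree square_lattice (\<lambda>_. 3) \<omega> (U e) w u"
          using True e by (simp add: feasible_def)
        then show ?thesis
          using step[of _ u w] True accepted_iff[OF wf, of e] unfolding e open_at_def by auto
      next
        case False
        then show ?thesis using sup open_at_in_lattice by blast
      qed
    qed
    then have "\<omega> s e \<longleftrightarrow> \<omega>0 s e" for s e using sup(1)[of s e] by (auto simp only: \<omega>0_def)
    then show ?thesis by (intro ext)
  qed
  have "cdp_configuration square_lattice (\<lambda>_. 3) U = \<omega>0"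
  proof -
    have "\<exists>!\<omega>. is_cdp_configuration square_lattice (\<lambda>_. 3) U \<omega>"
      using sol uniq by (rule ex1I)
    moreover have "(THE \<omega>. is_cdp_configuration square_lattice (\<lambda>_. 3) U \<omega>) = \<omega>0"
      using sol uniq by (rule the_equality)
    ultimately show ?thesis by (simp add: cdp_configuration_def)
  qed
  then show ?thesis using t by (auto simp: \<omega>0_def)
qed

text \<open>With four open edges at \<open>u\<close>, the one with the latest clock would have found
  three open edges at its attempt. Injectivity makes the other clocks strictly earlier.\<close>

lemma open_degree_le_3:
  assumes wf: "wf (earlier U)" and inj: "inj_on U square_lattice"
  shows "card {f \<in> square_lattice. u \<in> f \<and> open_at t U f} \<le> 3"
proof (rule ccontr)
  define S where "S = {f \<in> square_lattice. u \<in> f \<and> open_at t U f}"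
  assume "\<not> ?thesis"
  then have S: "card S > 3" by (simp add: S_def)
  then have fS: "finite S" "S \<noteq> {}" by (auto intro: card_ge_0_finite)
  obtain f where f: "f \<in> S" "\<And>g. g \<in> S \<Longrightarrow> U g \<le> U f"
  proof -
    have "Max (U ` S) \<in> U ` S" using fS by (intro Max_in) auto
    then obtain f where "f \<in> S" "U f = Max (U ` S)" by auto
    then show ?thesis using that fS by auto
  qed
  have "S - {f} \<subseteq> {g \<in> square_lattice. u \<in> g \<and> U g < U f \<and> accepted U g}"
  proof
    fix g assume "g \<in> S - {f}"
    then have g: "g \<in> S" "g \<noteq> f" by auto
    then have "U g \<noteq> U f" using inj f(1) by (auto simp: S_def inj_on_def)
    then show "g \<in> {g \<in> square_lattice. u \<in> g \<and> U g < U f \<and> accepted U g}"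
      using f(2)[OF g(1)] g by (auto simp: S_def open_at_def)
  qed
  then have "card (S - {f}) \<le> card {g \<in> square_lattice. u \<in> g \<and> U g < U f \<and> accepted U g}"
    by (intro card_mono finite_subset[OF _ finite_incident[of u]]) auto
  moreover have "card {g \<in> square_lattice. u \<in> g \<and> U g < U f \<and> accepted U g} < 3"
    using f(1) accepted_iff[OF wf, of f] by (auto simp: S_def open_at_def feasible_def)
  ultimately show False using S f(1) by (simp add: card_Diff_singleton)
qed

section \<open>Local surgery\<close>

text \<open>The edge and the interval may depend on \<open>U\<close> in any way; only the positive
  length of the interval matters, and it makes null events propagate backwards.\<close>

definition resample :: "((edge \<Rightarrow> real) \<Rightarrow> bool) \<Rightarrow> (edge \<Rightarrow> real) \<Rightarrow> bool" where
  "resample Z U \<longleftrightarrow> (\<exists>e\<in>square_lattice. \<exists>a b. 0 \<le> a \<and> a < b \<and> b \<le> 1 \<and>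
     (\<forall>s\<in>{a<..<b}. Z (U(e := s))))"

text \<open>If \<open>e\<close> is closed at \<tau>, no decision before \<tau> counted it. If it is
  open, its absence only lowers counts, so the other edges open at \<tau> stay open; the danger
  comes from touching edges that were rejected because of \<open>e\<close>, and \<open>quiet\<close>
  says that no touching edge was rejected before \<tau>.\<close>

lemma open_at_raise:
  assumes wf: "wf (earlier U)" and s: "\<tau> < s"
    and quiet: "\<not> open_at \<tau> U e \<or>
      (\<forall>f\<in>square_lattice. f \<inter> e \<noteq> {} \<longrightarrow> \<not> open_at \<tau> U f \<longrightarrow> \<tau> \<le> U f)"
  shows "open_at \<tau> (U(e := s)) f \<longleftrightarrow> open_at \<tau> U f \<and> f \<noteq> e"
proof -
  define U' where "U' = U(e := s)"
  have U'e: "U' e = s" and U': "\<And>g. g \<noteq> e \<Longrightarrow> U' g = U g" by (simp_all add: U'_def)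
  have wf': "wf (earlier U')" unfolding U'_def using wf by (rule wf_earlier_update)
  have "f \<noteq> e \<longrightarrow> U f < \<tau> \<longrightarrow> (accepted U' f \<longleftrightarrow> accepted U f)" for f
    using wf
  proof (induction f rule: wf_induct_rule)
    case (less f)
    show ?case
    proof (intro impI)
      assume f: "f \<noteq> e" "U f < \<tau>"
      show "accepted U' f \<longleftrightarrow> accepted U f"
      proof (cases "f \<in> square_lattice")
        case True
        have IH: "accepted U' g \<longleftrightarrow> accepted U g"
          if "g \<in> square_lattice" "g \<inter> f \<noteq> {}" "g \<noteq> e" "U g < U f" for g
          using less.IH[of g] that True f by (auto simp: earlier_def)
        show ?thesis
        proof (cases "f \<inter> e \<noteq> {} \<and> open_at \<tau> U e")
          case False
          have "feasible U' (accepted U') f \<longleftrightarrow> feasible U (accepted U) f"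
          proof (rule feasible_cong)
            fix g assume g: "g \<in> square_lattice" "g \<inter> f \<noteq> {}"
            show "(U' g < U' f \<and> accepted U' g) \<longleftrightarrow> (U g < U f \<and> accepted U g)"
            proof (cases "g = e")
              case True
              then have "\<not> open_at \<tau> U e" using False g by blast
              then show ?thesis using True f s U'e U'[of f] by (auto simp: open_at_def)
            next
              case False
              then show ?thesis using IH[OF g] f U'[of f] U'[of g] by auto
            qed
          qed
          then show ?thesis using accepted_iff[OF wf, of f] accepted_iff[OF wf', of f] by simp
        next
          case touch: True
          have "open_at \<tau> U f" using quiet touch f True by force
          then have acc: "accepted U f" by (simp add: open_at_def)
          have "card {g \<in> square_lattice. u \<in> g \<and> U' g < U' f \<and> accepted U' g} < 3" if u: "u \<in> f" for u
          proof -
            have "{g \<in> square_lattice. u \<in> g \<and> U' g < U' f \<and> accepted U' g} \<subseteq>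
                {g \<in> square_lattice. u \<in> g \<and> U g < U f \<and> accepted U g}"
              proof clarify
                fix g assume g: "g \<in> square_lattice" "u \<in> g" "U' g < U' f" "accepted U' g"
                then have "g \<noteq> e" using U'e U'[of f] f s by auto
                moreover have "g \<inter> f \<noteq> {}" using g u by blast
                ultimately show "U g < U f \<and> accepted U g" using IH[of g] U'[of g] U'[of f] f g by simp
              qed
            then have "card {g \<in> square_lattice. u \<in> g \<and> U' g < U' f \<and> accepted U' g} \<le>
                card {g \<in> square_lattice. u \<in> g \<and> U g < U f \<and> accepted U g}"
              by (intro card_mono finite_subset[OF _ finite_incident[of u]]) auto
            then show ?thesis using acc accepted_iff[OF wf, of f] u by (auto simp: feasible_def)
          qed
          then have "feasible U' (accepted U') f" using True by (simp add: feasible_def)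
          then show ?thesis using acc accepted_iff[OF wf', of f] by simp
        qed
      next
        case False
        then show ?thesis using accepted_in_lattice by blast
      qed
    qed
  qed
  then have "open_at \<tau> U' f \<longleftrightarrow> open_at \<tau> U f \<and> f \<noteq> e"
    using s U'e U'[of f] by (cases "f = e") (auto simp: open_at_def)
  then show ?thesis by (simp add: U'_def)
qed

text \<open>The new clock exceeds those of all touching edges that attempt before \<tau>, so no
  other decision before \<tau> sees \<open>e\<close>, while \<open>e\<close> itself sees at most two
  open edges at each endpoint.\<close>

lemma open_at_insert:
  assumes wf: "wf (earlier U)" and e: "e \<in> square_lattice" "\<not> open_at \<tau> U e"
    and deg: "\<And>u. u \<in> e \<Longrightarrow> card {f \<in> square_lattice. u \<in> f \<and> open_at \<tau> U f} \<le> 2"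
    and s: "s < \<tau>" "\<And>f. f \<in> square_lattice \<Longrightarrow> f \<inter> e \<noteq> {} \<Longrightarrow> U f < \<tau> \<Longrightarrow> U f < s"
  shows "open_at \<tau> (U(e := s)) f \<longleftrightarrow> open_at \<tau> U f \<or> f = e"
proof -
  define U' where "U' = U(e := s)"
  have U'e: "U' e = s" and U': "\<And>g. g \<noteq> e \<Longrightarrow> U' g = U g" by (simp_all add: U'_def)
  have wf': "wf (earlier U')" unfolding U'_def using wf by (rule wf_earlier_update)
  have other: "f \<noteq> e \<longrightarrow> U f < \<tau> \<longrightarrow> (accepted U' f \<longleftrightarrow> accepted U f)" for f
    using wf
  proof (induction f rule: wf_induct_rule)
    case (less f)
    show ?case
    proof (intro impI)
      assume f: "f \<noteq> e" "U f < \<tau>"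
      show "accepted U' f \<longleftrightarrow> accepted U f"
      proof (cases "f \<in> square_lattice")
        case True
        have "feasible U' (accepted U') f \<longleftrightarrow> feasible U (accepted U) f"
        proof (rule feasible_cong)
          fix g assume g: "g \<in> square_lattice" "g \<inter> f \<noteq> {}"
          show "(U' g < U' f \<and> accepted U' g) \<longleftrightarrow> (U g < U f \<and> accepted U g)"
          proof (cases "g = e")
            case True
            have "f \<inter> e \<noteq> {}" using g True by blast
            then have "U f < s" using s(2)[OF \<open>f \<in> square_lattice\<close>] f by blast
            then show ?thesis using True f e(2) U'e U'[of f] by (auto simp: open_at_def)
          next
            case False
            then show ?thesis using less.IH[of g] g f U'[of g] U'[of f] \<open>f \<in> square_lattice\<close> by (auto simp: earlier_def)
          qed
        qed
        then show ?thesis using accepted_iff[OF wf, of f] accepted_iff[OF wf', of f] by simp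
      next
        case False
        then show ?thesis using accepted_in_lattice by blast
      qed
    qed
  qed
  have "card {g \<in> square_lattice. u \<in> g \<and> U' g < U' e \<and> accepted U' g} < 3" if u: "u \<in> e" for u
  proof -
    have "{g \<in> square_lattice. u \<in> g \<and> U' g < U' e \<and> accepted U' g} \<subseteq>
        {g \<in> square_lattice. u \<in> g \<and> open_at \<tau> U g}"
    proof clarify
      fix g assume g: "g \<in> square_lattice" "u \<in> g" "U' g < U' e" "accepted U' g"
      then have "g \<noteq> e" by auto
      then show "open_at \<tau> U g" using other[of g] U'[of g] U'e s(1) g by (simp add: open_at_def)
    qed
    then have "card {g \<in> square_lattice. u \<in> g \<and> U' g < U' e \<and> accepted U' g} \<le>
        card {g \<in> square_lattice. u \<in> g \<and> open_at \<tau> U g}"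
      by (intro card_mono finite_subset[OF _ finite_incident[of u]]) auto
    then show ?thesis using deg[OF u] by simp
  qed
  then have "accepted U' e" using accepted_iff[OF wf', of e] e(1) by (auto simp: feasible_def)
  then have "open_at \<tau> U' f \<longleftrightarrow> open_at \<tau> U f \<or> f = e"
    using other[of f] s(1) U'e U'[of f] by (cases "f = e") (auto simp: open_at_def)
  then show ?thesis by (simp add: U'_def)
qed

text \<open>One redrawing per edge, into the interval from \<tau> to 1. Raised clocks need not
  exceed the time of observation, so nothing is claimed after \<tau>. The hypothesis on
  \<open>Z\<close> ranges over all resulting clocks because later redrawings depend on them.\<close>

lemma resample_raise:
  assumes "finite M" "M \<subseteq> square_lattice" "wf (earlier U)" "0 < \<tau>" "\<tau> < 1"
    and "\<And>m. m \<in> M \<Longrightarrow> \<not> open_at \<tau> U m \<or>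
      (\<forall>f\<in>square_lattice. f \<inter> m \<noteq> {} \<longrightarrow> \<not> open_at \<tau> U f \<longrightarrow> \<tau> \<le> U f)"
    and "\<And>U'. wf (earlier U') \<Longrightarrow> (\<And>f. f \<notin> M \<Longrightarrow> U' f = U f) \<Longrightarrow> (\<And>m. m \<in> M \<Longrightarrow> \<tau> < U' m) \<Longrightarrow>
      (\<And>f. open_at \<tau> U' f \<longleftrightarrow> open_at \<tau> U f \<and> f \<notin> M) \<Longrightarrow> Z U'"
  shows "(resample ^^ card M) Z U"
  using assms
proof (induction M arbitrary: U rule: finite_induct)
  case empty
  then show ?case by simp
next
  case (insert m M)
  have "(resample ^^ card M) Z (U(m := s))" if s: "s \<in> {\<tau><..<1}" for s
  proof (rule insert.IH)
    let ?U = "U(m := s)"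
    have op: "open_at \<tau> ?U f \<longleftrightarrow> open_at \<tau> U f \<and> f \<noteq> m" for f
      using open_at_raise[OF insert.prems(2), of \<tau> s m f] s insert.prems(5)[of m] by simp
    show "M \<subseteq> square_lattice" "0 < \<tau>" "\<tau> < 1" using insert.prems by auto
    show wf: "wf (earlier ?U)" using wf_earlier_update insert.prems(2) .
    show "\<not> open_at \<tau> ?U n \<or>
        (\<forall>f\<in>square_lattice. f \<inter> n \<noteq> {} \<longrightarrow> \<not> open_at \<tau> ?U f \<longrightarrow> \<tau> \<le> ?U f)" if "n \<in> M" for n
      using insert.prems(5)[of n] that op s by auto
    fix U' assume U': "wf (earlier U')" "\<And>f. f \<notin> M \<Longrightarrow> U' f = ?U f" "\<And>m. m \<in> M \<Longrightarrow> \<tau> < U' m"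
      "\<And>f. open_at \<tau> U' f \<longleftrightarrow> open_at \<tau> ?U f \<and> f \<notin> M"
    show "Z U'"
    proof (rule insert.prems(6))
      show "wf (earlier U')" by fact
      show "U' f = U f" if "f \<notin> insert m M" for f using U'(2) that by auto
      show "\<tau> < U' n" if "n \<in> insert m M" for n
        using U'(2)[of m] U'(3)[of n] that insert.hyps s by (cases "n \<in> M") auto
      show "open_at \<tau> U' f \<longleftrightarrow> open_at \<tau> U f \<and> f \<notin> insert m M" for f
        using U'(4)[of f] op by auto
    qed
  qed
  moreover have "m \<in> square_lattice" using insert.prems by simp
  ultimately have "resample ((resample ^^ card M) Z) U"
    unfolding resample_def using insert.prems(3,4)
    by (intro bexI[of _ m] exI[of _ \<tau>] exI[of _ 1]) auto
  then show ?case using insert.hyps by simp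
qed

text \<open>The order matters: closed edges near \<open>X\<close> are postponed first, so that no
  rejected neighbour can take the place of an edge of \<open>Q\<close>; closing \<open>Q\<close>
  then frees both endpoints of \<open>e\<close>, which is inserted last. The number of redrawings
  depends on \<open>U\<close>.\<close>

lemma local_surgery:
  assumes wf: "wf (earlier U)" and t: "0 < t" "t \<le> 1" and X: "finite X"
    and Q: "finite Q" "\<And>q. q \<in> Q \<Longrightarrow> q \<in> square_lattice \<and> q \<subseteq> X"
    and e: "e \<in> square_lattice" "e \<subseteq> X" "\<not> open_at t U e"
    and deg: "\<And>u. u \<in> e \<Longrightarrow> card {f \<in> square_lattice. u \<in> f \<and> open_at t U f \<and> f \<notin> Q} \<le> 2"
    and Z: "\<And>U'. wf (earlier U') \<Longrightarrow> (\<And>f. open_at t U f \<Longrightarrow> f \<notin> Q \<Longrightarrow> open_at t U' f) \<Longrightarrow>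
      open_at t U' e \<Longrightarrow> finite {f. open_at t U f \<noteq> open_at t U' f} \<Longrightarrow> Z U'"
  shows "\<exists>n. (resample ^^ n) Z U"
proof -
  \<comment> \<open>\<open>F\<close> holds the edges whose clocks may change, \<open>W\<close> those
    whose decision can see an edge of \<open>F\<close>.\<close>
  define F where "F = {f \<in> square_lattice. f \<inter> X \<noteq> {}}"
  define W where "W = {g \<in> square_lattice. g \<inter> \<Union>F \<noteq> {}}"
  have fF: "finite F" unfolding F_def using X by (rule finite_touching)
  have "finite (\<Union>F)" using fF finite_edge by (auto simp: F_def)
  then have fW: "finite W" unfolding W_def by (rule finite_touching)
  have ne: "f \<noteq> {}" if "f \<in> square_lattice" for f using that by (auto elim: lattice_edgeE)
  have FW: "F \<subseteq> W" using ne by (fastforce simp: W_def F_def)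
  \<comment> \<open>The last clock below \<open>t\<close> in \<open>W\<close>; the inserted 0 keeps
    the maximum defined and \<tau> positive.\<close>
  define m where "m = Max (insert 0 {U g | g. g \<in> W \<and> U g < t})"
  have fm: "finite (insert 0 {U g | g. g \<in> W \<and> U g < t})" using fW by auto
  have "m < t" unfolding m_def using fm t by (subst Max_less_iff) auto
  have "0 \<le> m" unfolding m_def using fm by (intro Max_ge) auto
  obtain \<tau> where \<tau>: "m < \<tau>" "\<tau> < t" using dense[OF \<open>m < t\<close>] by blast
  have W: "U g < \<tau>" if "g \<in> W" "U g < t" for g
  proof -
    have "U g \<le> m" unfolding m_def using fm that by (intro Max_ge) auto
    then show ?thesis using \<tau> by simp
  qed
  have \<tau>01: "0 < \<tau>" "\<tau> < 1" using \<tau> \<open>0 \<le> m\<close> t by auto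
  have opW: "open_at \<tau> U g \<longleftrightarrow> open_at t U g" if "g \<in> W" for g
    using W[OF that] \<tau> by (auto simp: open_at_def)
  have QF: "Q \<subseteq> F" using Q(2) ne by (fastforce simp: F_def)
  have eF: "e \<in> F" using e ne by (fastforce simp: F_def)
  define M where "M = {f \<in> F. \<not> open_at \<tau> U f}"
  \<comment> \<open>Edges outside \<open>F\<close> with a clock from \<tau> up to \<open>t\<close>
    lie outside \<open>W\<close> and see no edge of \<open>F\<close>, so their decisions are
    unchanged. Inside \<open>F\<close>, edges open at \<tau> remain open, and whatever opens between
    \<tau> and \<open>t\<close> is only a gain.\<close>
  have final: "Z U3"
    if wf3: "wf (earlier U3)" and out: "\<And>f. f \<notin> F \<Longrightarrow> U3 f = U f"
      and op: "\<And>f. open_at \<tau> U3 f \<longleftrightarrow> (open_at \<tau> U f \<and> f \<notin> Q) \<or> f = e" for U3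
  proof -
    have acc: "g \<notin> F \<longrightarrow> U g < t \<longrightarrow> (accepted U3 g \<longleftrightarrow> accepted U g)" for g
      using wf
    proof (induction g rule: wf_induct_rule)
      case (less g)
      show ?case
      proof (intro impI)
        assume g: "g \<notin> F" "U g < t"
        show "accepted U3 g \<longleftrightarrow> accepted U g"
        proof (cases "U g < \<tau>")
          case True
          moreover have "g \<notin> Q" "g \<noteq> e" using g QF eF by auto
          ultimately show ?thesis using op[of g] out[OF g(1)] by (auto simp: open_at_def)
        next
          case False
          then have gW: "g \<notin> W" using W g by auto
          show ?thesis
          proof (cases "g \<in> square_lattice")
            case True
            have "feasible U3 (accepted U3) g \<longleftrightarrow> feasible U (accepted U) g"
            proof (rule feasible_cong)
              fix f assume f: "f \<in> square_lattice" "f \<inter> g \<noteq> {}"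
              then have "f \<notin> F" using gW True by (auto simp: W_def)
              then show "(U3 f < U3 g \<and> accepted U3 f) \<longleftrightarrow> (U f < U g \<and> accepted U f)"
                using out[OF g(1)] out[of f] less.IH[of f] f True g by (auto simp: earlier_def)
            qed
            then show ?thesis using accepted_iff[OF wf, of g] accepted_iff[OF wf3, of g] by simp
          next
            case False
            then show ?thesis using accepted_in_lattice by blast
          qed
        qed
      qed
    qed
    have away: "open_at t U3 f \<longleftrightarrow> open_at t U f" if "f \<notin> F" for f
      using acc[of f] out[OF that] that by (auto simp: open_at_def)
    have up: "open_at t U3 f" if "open_at \<tau> U3 f" for f using that \<tau> by (auto simp: open_at_def)
    show ?thesis
    proof (rule Z[OF wf3])
      show "open_at t U3 f" if "open_at t U f" "f \<notin> Q" for f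
        using that away[of f] up[of f] op[of f] opW[of f] FW by (cases "f \<in> F") auto
      show "open_at t U3 e" using up op by blast
      show "finite {f. open_at t U f \<noteq> open_at t U3 f}"
        using away by (intro finite_subset[OF _ fF]) auto
    qed
  qed
  have stage3: "resample Z U2"
    if wf2: "wf (earlier U2)" and out: "\<And>f. f \<notin> F \<Longrightarrow> U2 f = U f"
      and op: "\<And>f. open_at \<tau> U2 f \<longleftrightarrow> open_at \<tau> U f \<and> f \<notin> Q" for U2
  proof -
    define P where "P = {f \<in> square_lattice. f \<inter> e \<noteq> {}}"
    have fP: "finite P" unfolding P_def using e(1) finite_edge finite_touching by blast
    \<comment> \<open>\<open>a\<close> is the last clock below \<tau> among the edges touching
      \<open>e\<close>; a clock of \<open>e\<close> between \<open>a\<close> and \<tau> comes after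
      every decision before \<tau> that could see it.\<close>
    define a where "a = Max (insert 0 {U2 f | f. f \<in> P \<and> U2 f < \<tau>})"
    have fa: "finite (insert 0 {U2 f | f. f \<in> P \<and> U2 f < \<tau>})" using fP by auto
    have "a < \<tau>" unfolding a_def using fa \<tau>01 by (subst Max_less_iff) auto
    have "0 \<le> a" unfolding a_def using fa by (intro Max_ge) auto
    have a: "U2 f \<le> a" if "f \<in> P" "U2 f < \<tau>" for f
      unfolding a_def using fa that by (intro Max_ge) auto
    have "Z (U2(e := s))" if s: "s \<in> {a<..<\<tau>}" for s
    proof (rule final)
      show "wf (earlier (U2(e := s)))" using wf_earlier_update[OF wf2] .
      show "(U2(e := s)) f = U f" if "f \<notin> F" for f using out that eF by auto
      have "open_at \<tau> (U2(e := s)) f \<longleftrightarrow> open_at \<tau> U2 f \<or> f = e" for f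
      proof (rule open_at_insert[OF wf2 e(1)])
        show "\<not> open_at \<tau> U2 e" using op[of e] e(3) \<tau> by (auto simp: open_at_def)
        show "card {f \<in> square_lattice. u \<in> f \<and> open_at \<tau> U2 f} \<le> 2" if u: "u \<in> e" for u
        proof -
          have "card {f \<in> square_lattice. u \<in> f \<and> open_at \<tau> U2 f} \<le>
              card {f \<in> square_lattice. u \<in> f \<and> open_at t U f \<and> f \<notin> Q}"
            using op \<tau> by (intro card_mono finite_subset[OF _ finite_incident[of u]])
              (auto simp: open_at_def)
          then show ?thesis using deg[OF u] by simp
        qed
        show "s < \<tau>" using s by simp
        show "U2 f < s" if "f \<in> square_lattice" "f \<inter> e \<noteq> {}" "U2 f < \<tau>" for f
          using a[of f] that s by (auto simp: P_def)
      qed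
      then show "open_at \<tau> (U2(e := s)) f \<longleftrightarrow> (open_at \<tau> U f \<and> f \<notin> Q) \<or> f = e" for f
        using op by simp
    qed
    then show ?thesis unfolding resample_def using e(1) \<open>0 \<le> a\<close> \<open>a < \<tau>\<close> \<tau>01
      by (intro bexI[of _ e] exI[of _ a] exI[of _ \<tau>]) auto
  qed
  have stage2: "(resample ^^ card Q) (resample Z) U1"
    if wf1: "wf (earlier U1)" and out: "\<And>f. f \<notin> M \<Longrightarrow> U1 f = U f"
      and late: "\<And>f. f \<in> M \<Longrightarrow> \<tau> < U1 f"
      and op: "\<And>f. open_at \<tau> U1 f \<longleftrightarrow> open_at \<tau> U f \<and> f \<notin> M" for U1
  proof (rule resample_raise[OF Q(1) _ wf1 \<tau>01])
    show "Q \<subseteq> square_lattice" using Q(2) by auto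
    \<comment> \<open>Edges of \<open>Q\<close> lie inside \<open>X\<close>, so every edge touching
      one of them belongs to \<open>F\<close>, and the closed ones were postponed in the round
      before.\<close>
    show "\<not> open_at \<tau> U1 q \<or>
      (\<forall>f\<in>square_lattice. f \<inter> q \<noteq> {} \<longrightarrow> \<not> open_at \<tau> U1 f \<longrightarrow> \<tau> \<le> U1 f)" if "q \<in> Q" for q
    proof (intro disjI2 ballI impI)
      fix f assume f: "f \<in> square_lattice" "f \<inter> q \<noteq> {}" "\<not> open_at \<tau> U1 f"
      then have "f \<in> F" using Q(2)[OF that] by (auto simp: F_def)
      then have "f \<in> M" using op f by (auto simp: M_def)
      then show "\<tau> \<le> U1 f" using late by fastforce
    qed
    fix U2 assume U2: "wf (earlier U2)" "\<And>f. f \<notin> Q \<Longrightarrow> U2 f = U1 f" "\<And>m. m \<in> Q \<Longrightarrow> \<tau> < U2 m"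
      "\<And>f. open_at \<tau> U2 f \<longleftrightarrow> open_at \<tau> U1 f \<and> f \<notin> Q"
    show "resample Z U2"
    proof (rule stage3[OF U2(1)])
      show "U2 f = U f" if "f \<notin> F" for f using that QF U2(2)[of f] out[of f] by (auto simp: M_def)
      show "open_at \<tau> U2 f \<longleftrightarrow> open_at \<tau> U f \<and> f \<notin> Q" for f
        using U2(4)[of f] op[of f] by (auto simp: M_def)
    qed
  qed
  have "(resample ^^ card M) ((resample ^^ card Q) (resample Z)) U"
  proof (rule resample_raise[OF _ _ wf \<tau>01])
    show "finite M" "M \<subseteq> square_lattice" using fF by (simp_all add: M_def) (auto simp: F_def)
    show "\<not> open_at \<tau> U m \<or>
      (\<forall>f\<in>square_lattice. f \<inter> m \<noteq> {} \<longrightarrow> \<not> open_at \<tau> U f \<longrightarrow> \<tau> \<le> U f)" if "m \<in> M" for m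
      using that by (simp add: M_def)
  qed (rule stage2)
  then have "(resample ^^ (card M + card Q + 1)) Z U"
    by (simp add: funpow_add funpow_swap1)
  then show ?thesis by blast
qed

section \<open>The clock measure\<close>

abbreviation "unit_clock \<equiv> restrict_space lborel {0..1::real}"

abbreviation "clocks \<equiv> clock_measure square_lattice"

lemma prob_space_unit_clock: "prob_space unit_clock"
  by standard (simp add: space_restrict_space emeasure_restrict_space)

interpretation unit_clock: prob_space unit_clock
  by (rule prob_space_unit_clock)

interpretation clock_product: product_prob_space "\<lambda>_. unit_clock" square_lattice
  by standard

lemma clocks_eq: "clocks = (\<Pi>\<^sub>M _\<in>square_lattice. unit_clock)"
  by (simp add: clock_measure_def)

interpretation clocks: prob_space clocks
  unfolding clocks_eq by (rule clock_product.P.prob_space_axioms)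

lemma space_clocks: "space clocks = square_lattice \<rightarrow>\<^sub>E {0..1}"
  by (simp add: clocks_eq space_PiM space_restrict_space)

lemma clocks_range: "U \<in> space clocks \<Longrightarrow> e \<in> square_lattice \<Longrightarrow> U e \<in> {0..1}"
  by (auto simp: space_clocks PiE_iff)

lemma measurable_clock:
  assumes "e \<in> square_lattice"
  shows "(\<lambda>U. U e) \<in> borel_measurable clocks"
proof -
  have "(\<lambda>U. U e) \<in> measurable clocks unit_clock"
    unfolding clocks_eq using assms by (rule measurable_component_singleton)
  moreover have "(\<lambda>x. x) \<in> measurable unit_clock borel"
    by (rule measurable_restrict_space1) simp
  ultimately show ?thesis by (rule measurable_compose)
qed

lemma countable_lattice: "countable square_lattice"
proof -
  have "square_lattice \<subseteq> (\<lambda>(u, v). {u, v}) ` UNIV" by (auto simp: square_lattice_def)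
  then show ?thesis by (rule countable_subset) simp
qed

section \<open>Redrawing a single clock\<close>

lemma distr_update:
  assumes "e \<in> square_lattice"
  shows "distr (unit_clock \<Otimes>\<^sub>M (\<Pi>\<^sub>M _\<in>square_lattice - {e}. unit_clock)) clocks (\<lambda>(s, X). X(e := s)) = clocks"
  using distr_pair_PiM_eq_PiM[of "square_lattice - {e}" "\<lambda>_. unit_clock" e] assms
    prob_space_unit_clock by (simp add: clocks_eq insert_absorb)

lemma measurable_update:
  assumes "e \<in> square_lattice"
  shows "(\<lambda>(s, X). X(e := s)) \<in> measurable (unit_clock \<Otimes>\<^sub>M (\<Pi>\<^sub>M _\<in>square_lattice - {e}. unit_clock)) clocks"
proof -
  have "(\<lambda>x. (snd x)(e := fst x)) \<in> measurable (unit_clock \<Otimes>\<^sub>M (\<Pi>\<^sub>M _\<in>square_lattice - {e}. unit_clock))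
      (\<Pi>\<^sub>M _\<in>insert e (square_lattice - {e}). unit_clock)"
    by (rule measurable_fun_upd[where J = "square_lattice - {e}"]) auto
  then show ?thesis using assms by (simp add: clocks_eq insert_absorb case_prod_beta)
qed

lemma AE_update:
  assumes e: "e \<in> square_lattice" and P: "Measurable.pred clocks P"
  shows "(AE U in clocks. P U) \<longleftrightarrow>
    (AE X in (\<Pi>\<^sub>M _\<in>square_lattice - {e}. unit_clock). AE s in unit_clock. P (X(e := s)))"
proof -
  let ?R = "\<Pi>\<^sub>M _\<in>square_lattice - {e}. unit_clock"
  interpret R: prob_space ?R by (intro prob_space_PiM prob_space_unit_clock)
  interpret pair_sigma_finite unit_clock ?R ..
  interpret flip: pair_sigma_finite ?R unit_clock ..
  note [measurable] = P
  have m: "(\<lambda>x. (snd x)(e := fst x)) \<in> measurable (unit_clock \<Otimes>\<^sub>M ?R) clocks"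
    using measurable_update[OF e] by (simp add: case_prod_beta)
  have m': "(\<lambda>x. (fst x)(e := snd x)) \<in> measurable (?R \<Otimes>\<^sub>M unit_clock) clocks"
    using measurable_compose[OF measurable_pair_swap' m] by (simp add: case_prod_beta)
  have "(AE U in clocks. P U) \<longleftrightarrow> (AE U in distr (unit_clock \<Otimes>\<^sub>M ?R) clocks (\<lambda>x. (snd x)(e := fst x)). P U)"
    by (subst distr_update[OF e, unfolded case_prod_unfold]) (rule refl)
  also have "\<dots> \<longleftrightarrow> (AE x in unit_clock \<Otimes>\<^sub>M ?R. P ((snd x)(e := fst x)))"
    by (rule AE_distr_iff[OF m]) measurable
  also have "\<dots> \<longleftrightarrow> (AE x in distr (?R \<Otimes>\<^sub>M unit_clock) (unit_clock \<Otimes>\<^sub>M ?R) (\<lambda>(x, y). (y, x)). P ((snd x)(e := fst x)))"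
    by (subst distr_pair_swap) (rule refl)
  also have "\<dots> \<longleftrightarrow> (AE x in ?R \<Otimes>\<^sub>M unit_clock. P ((fst x)(e := snd x)))"
    by (subst AE_distr_iff[OF measurable_pair_swap'])
      (use measurable_compose[OF m P] in \<open>simp_all add: case_prod_beta\<close>)
  also have "\<dots> \<longleftrightarrow> (AE X in ?R. AE s in unit_clock. P (X(e := s)))"
    using flip.AE_pair_iff[of "\<lambda>X s. P (X(e := s))"] measurable_compose[OF m' P]
    by (simp add: case_prod_beta)
  finally show ?thesis .
qed

lemma AE_AE_update:
  assumes e: "e \<in> square_lattice" and P: "Measurable.pred clocks P" and ae: "AE U in clocks. P U"
  shows "AE U in clocks. AE s in unit_clock. P (U(e := s))"
proof -
  let ?R = "\<Pi>\<^sub>M _\<in>square_lattice - {e}. unit_clock"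
  have d: "distr clocks ?R (\<lambda>U. \<lambda>n\<in>square_lattice - {e}. U n) = ?R"
    unfolding clocks_eq using distr_PiM_reindex[of square_lattice "\<lambda>_. unit_clock" id "square_lattice - {e}"]
    by (simp add: prob_space_unit_clock)
  have "AE X in distr clocks ?R (\<lambda>U. \<lambda>n\<in>square_lattice - {e}. U n). AE s in unit_clock. P (X(e := s))"
    unfolding d using AE_update[OF e P] ae by simp
  then have "AE U in clocks. AE s in unit_clock. P ((\<lambda>n\<in>square_lattice - {e}. U n)(e := s))"
    by (rule AE_distrD[rotated]) (unfold clocks_eq, auto intro!: measurable_restrict measurable_component_singleton)
  then show ?thesis using AE_space
  proof eventually_elim
    case (elim U)
    then have U: "U \<in> space clocks" "AE s in unit_clock. P ((\<lambda>n\<in>square_lattice - {e}. U n)(e := s))"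
      by simp_all
    have "(\<lambda>n\<in>square_lattice - {e}. U n)(e := s) = U(e := s)" for s
      using U(1) by (auto simp: space_clocks PiE_iff extensional_def fun_eq_iff)
    then show ?case using U(2) by simp
  qed
qed

text \<open>By Fubini, for almost all clocks a fresh clock of any edge avoids the null event almost
  surely; an interval of positive length cannot lie in the exceptional set.\<close>

lemma AE_not_resample:
  assumes "AE U in clocks. \<not> Z U"
  shows "AE U in clocks. \<not> resample Z U"
proof -
  \<comment> \<open>\<open>Z\<close> need not be measurable and is replaced by a measurable null
    cover.\<close>
  obtain N where N: "N \<in> null_sets clocks" "{U \<in> space clocks. Z U} \<subseteq> N"
    using assms by (auto simp: eventually_ae_filter)
  have P: "Measurable.pred clocks (\<lambda>U. U \<notin> N)" using N(1) by (auto dest: null_setsD2)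
  have "AE U in clocks. U \<notin> N" using N(1) by (rule AE_not_in)
  then have "AE U in clocks. AE s in unit_clock. U(e := s) \<notin> N" if "e \<in> square_lattice" for e
    using AE_AE_update[OF that P] by simp
  then have "AE U in clocks. \<forall>e\<in>square_lattice. AE s in unit_clock. U(e := s) \<notin> N"
    using countable_lattice by (simp add: AE_ball_countable)
  then show ?thesis
  proof (rule AE_mp, intro AE_I2 impI notI)
    fix U assume U: "U \<in> space clocks" "\<forall>e\<in>square_lattice. AE s in unit_clock. U(e := s) \<notin> N"
      and "resample Z U"
    then obtain e a b where e: "e \<in> square_lattice" and ab: "0 \<le> a" "a < b" "b \<le> 1"
      and Z: "\<And>s. s \<in> {a<..<b} \<Longrightarrow> Z (U(e := s))" by (auto simp: resample_def)
    have "U(e := s) \<in> N" if "s \<in> {a<..<b}" for s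
      using Z[OF that] N(2) U(1) ab that e by (auto simp: space_clocks PiE_iff extensional_def)
    moreover have "AE s in unit_clock. U(e := s) \<notin> N" using U(2) e by blast
    ultimately have "AE s in unit_clock. s \<notin> {a<..<b}" by (auto elim!: eventually_mono)
    moreover have "{a<..<b} \<in> sets unit_clock"
      using ab by (auto simp: sets_restrict_space_iff)
    ultimately have "emeasure unit_clock {a<..<b} = 0"
      by (subst (asm) AE_iff_measurable[of "{a<..<b}"])
        (use ab in \<open>auto simp: space_restrict_space\<close>)
    then show False using ab by (subst (asm) emeasure_restrict_space) auto
  qed
qed

lemma AE_not_resample_pow:
  assumes "AE U in clocks. \<not> Z U"
  shows "AE U in clocks. \<forall>n. \<not> (resample ^^ n) Z U"
proof -
  have "AE U in clocks. \<not> (resample ^^ n) Z U" for n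
  proof (induction n)
    case (Suc n)
    then show ?case using AE_not_resample[OF Suc] by simp
  qed (use assms in simp)
  then show ?thesis by (simp add: AE_all_countable)
qed

lemma AE_inj_clocks: "AE U in clocks. inj_on U square_lattice"
proof -
  have "AE U in clocks. U e \<noteq> U f" if ef: "e \<in> square_lattice" "f \<in> square_lattice" "e \<noteq> f" for e f
  proof (subst AE_update[OF ef(1)])
    note [measurable] = measurable_clock[OF ef(1)] measurable_clock[OF ef(2)]
    have "Measurable.pred clocks (\<lambda>U. U e < U f \<or> U f < U e)" by measurable
    then show "Measurable.pred clocks (\<lambda>U. U e \<noteq> U f)" by (simp only: neq_iff)
    have "AE s in unit_clock. s \<noteq> x" for x :: real
      using AE_lborel_singleton[of x]
      by (subst AE_restrict_space_iff) (auto elim: eventually_mono)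
    then show "AE X in (\<Pi>\<^sub>M _\<in>square_lattice - {e}. unit_clock). AE s in unit_clock. (X(e := s)) e \<noteq> (X(e := s)) f"
      using ef(3) by simp
  qed
  then have "AE U in clocks. \<forall>e\<in>square_lattice. \<forall>f\<in>square_lattice. e \<noteq> f \<longrightarrow> U e \<noteq> U f"
    using countable_lattice by (auto simp: AE_ball_countable intro: AE_impI)
  then show ?thesis by (rule eventually_mono) (auto simp: inj_on_def)
qed

section \<open>Almost sure absence of infinite chains of decreasing clocks\<close>

fun descents :: "nat \<Rightarrow> edge \<Rightarrow> edge list set" where
  "descents 0 e = {[]}"
| "descents (Suc n) e = (\<Union>f\<in>{f \<in> square_lattice. f \<inter> e \<noteq> {}}. (#) f ` descents n f)"

text \<open>Four edges at each of the two endpoints; \<open>e\<close> is counted twice, which is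
  harmless because any bound below 10 will do.\<close>

lemma card_touching:
  assumes "e \<in> square_lattice"
  shows "card {f \<in> square_lattice. f \<inter> e \<noteq> {}} \<le> 8"
proof -
  obtain u v where e: "e = {u, v}" using assms by (rule lattice_edgeE)
  have "{f \<in> square_lattice. f \<inter> e \<noteq> {}} = {f \<in> square_lattice. u \<in> f} \<union> {f \<in> square_lattice. v \<in> f}"
    using e by auto
  then show ?thesis
    using card_Un_le[of "{f \<in> square_lattice. u \<in> f}" "{f \<in> square_lattice. v \<in> f}"]
      card_incident[of u] card_incident[of v] by simp
qed

lemma descents_bound:
  "e \<in> square_lattice \<Longrightarrow> finite (descents n e) \<and> card (descents n e) \<le> 8 ^ n \<and>
    (\<forall>l\<in>descents n e. length l = n \<and> set l \<subseteq> square_lattice)"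
proof (induction n arbitrary: e)
  case (Suc n)
  let ?A = "{f \<in> square_lattice. f \<inter> e \<noteq> {}}"
  have fin: "finite ?A" using Suc.prems finite_edge finite_touching by blast
  have "card (descents (Suc n) e) \<le> (\<Sum>f\<in>?A. card ((#) f ` descents n f))"
    using fin by (simp add: card_UN_le)
  also have "\<dots> \<le> (\<Sum>f\<in>?A. 8 ^ n)"
    using Suc.IH by (intro sum_mono) (auto intro: card_image_le[THEN le_trans])
  also have "\<dots> \<le> 8 ^ Suc n" using card_touching[OF Suc.prems] by simp
  finally show ?case using fin Suc.IH by auto
qed simp

lemma descents_chain:
  assumes "\<And>i. (f (Suc i), f i) \<in> earlier U"
  shows "map (\<lambda>i. f (k + Suc i)) [0..<n] \<in> descents n (f k)"
proof (induction n arbitrary: k)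
  case (Suc n)
  have "map (\<lambda>i. f (k + Suc i)) [0..<Suc n] = f (Suc k) # map (\<lambda>i. f (Suc k + Suc i)) [0..<n]"
    by (simp add: upt_conv_Cons map_Suc_upt[symmetric] comp_def del: upt_Suc)
  then show ?case using Suc[of "Suc k"] assms[of k] by (auto simp: earlier_def)
qed simp

text \<open>Width 1/10 beats the branching number 8: the union bound over chains of length
  \<open>n\<close> in one cell is \<open>(8 / 10) ^ n\<close>. The cell with index 10 consists of
  the point 1.\<close>

definition time_cell :: "int \<Rightarrow> real set" where
  "time_cell j = {x\<in>{0..1}. \<lfloor>10 * x\<rfloor> = j}"

lemma time_cell_measure:
  "time_cell j \<in> sets unit_clock" "measure unit_clock (time_cell j) \<le> 1 / 10"
proof -
  have sub: "time_cell j \<subseteq> {j / 10 ..< (j + 1) / 10}"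
    by (auto simp: time_cell_def floor_eq_iff)
  have b: "time_cell j \<in> sets borel" unfolding time_cell_def by measurable
  then show s: "time_cell j \<in> sets unit_clock"
    by (auto simp: sets_restrict_space_iff time_cell_def)
  have "measure unit_clock (time_cell j) = measure lborel (time_cell j)"
    by (rule measure_restrict_space) (auto simp: time_cell_def)
  also have "\<dots> \<le> measure lborel {j / 10 ..< (j + 1) / 10}"
    using sub b by (intro measure_mono_fmeasurable) (auto simp: fmeasurable_def)
  also have "\<dots> = 1 / 10" by (simp add: field_simps)
  finally show "measure unit_clock (time_cell j) \<le> 1 / 10" .
qed

text \<open>A decreasing chain of clocks eventually stays in one cell of width 1/10; an edge touches at most
  eight edges, so chains inside a cell are those of a subcritical branching process.\<close>
lemma AE_wf_earlier: "AE U in clocks. wf (earlier U)"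
proof -
  \<comment> \<open>Clocks of distinct edges are independent, so the probability that all of them
    fall into one cell factorises.\<close>
  define B where "B = (\<lambda>n e j. {U \<in> space clocks. \<exists>l\<in>descents n e. distinct l \<and> (\<forall>f\<in>set l. U f \<in> time_cell j)})"
  have single: "{U \<in> space clocks. \<forall>f\<in>set l. U f \<in> time_cell j} \<in> sets clocks \<and>
      measure clocks {U \<in> space clocks. \<forall>f\<in>set l. U f \<in> time_cell j} \<le> (1 / 10) ^ n"
    if l: "distinct l" "length l = n" "set l \<subseteq> square_lattice" for l n j
  proof
    have eq: "{U \<in> space clocks. \<forall>f\<in>set l. U f \<in> time_cell j} =
        prod_emb square_lattice (\<lambda>_. unit_clock) (set l) (Pi\<^sub>E (set l) (\<lambda>_. time_cell j))"
      by (auto simp only: prod_emb_def clocks_eq space_PiM restrict_PiE_iff vimage_eq Int_iff mem_Collect_eq)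
    show "{U \<in> space clocks. \<forall>f\<in>set l. U f \<in> time_cell j} \<in> sets clocks"
      unfolding eq unfolding clocks_eq using l(3) time_cell_measure(1) by (intro sets_PiM_I) auto
    have "measure clocks {U \<in> space clocks. \<forall>f\<in>set l. U f \<in> time_cell j} =
        (\<Prod>f\<in>set l. measure unit_clock (time_cell j))"
      unfolding eq unfolding clocks_eq
      by (rule clock_product.measure_PiM_emb) (use l time_cell_measure(1) in auto)
    also have "\<dots> = measure unit_clock (time_cell j) ^ n"
      using l by (simp add: distinct_card)
    also have "\<dots> \<le> (1 / 10) ^ n" using time_cell_measure(2) by (intro power_mono) auto
    finally show "measure clocks {U \<in> space clocks. \<forall>f\<in>set l. U f \<in> time_cell j} \<le> (1 / 10) ^ n" .
  qed
  have B: "B n e j \<in> sets clocks \<and> measure clocks (B n e j) \<le> (8 / 10) ^ n"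
    if e: "e \<in> square_lattice" for n e j
  proof
    let ?L = "{l \<in> descents n e. distinct l}"
    have eq: "B n e j = (\<Union>l\<in>?L. {U \<in> space clocks. \<forall>f\<in>set l. U f \<in> time_cell j})"
      by (auto simp: B_def)
    have fin: "finite ?L" using descents_bound[OF e] by simp
    have L: "distinct l" "length l = n" "set l \<subseteq> square_lattice" if "l \<in> ?L" for l
      using that descents_bound[OF e, of n] by auto
    show "B n e j \<in> sets clocks" unfolding eq
    proof (intro sets.finite_UN fin)
      show "{U \<in> space clocks. \<forall>f\<in>set l. U f \<in> time_cell j} \<in> sets clocks" if "l \<in> ?L" for l
        using single[OF L[OF that]] by blast
    qed
    have "measure clocks (B n e j) \<le> (\<Sum>l\<in>?L. measure clocks {U \<in> space clocks. \<forall>f\<in>set l. U f \<in> time_cell j})"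
      unfolding eq
    proof (intro clocks.finite_measure_subadditive_finite fin image_subsetI)
      show "{U \<in> space clocks. \<forall>f\<in>set l. U f \<in> time_cell j} \<in> sets clocks" if "l \<in> ?L" for l
        using single[OF L[OF that]] by blast
    qed
    also have "\<dots> \<le> (\<Sum>l\<in>?L. (1 / 10) ^ n)" 
    proof (rule sum_mono)
      show "measure clocks {U \<in> space clocks. \<forall>f\<in>set l. U f \<in> time_cell j} \<le> (1 / 10) ^ n"
        if "l \<in> ?L" for l using single[OF L[OF that]] by blast
    qed
    also have "\<dots> = real (card ?L) * (1 / 10) ^ n" by simp
    also have "\<dots> \<le> 8 ^ n * (1 / 10) ^ n"
    proof (rule mult_right_mono)
      have "card ?L \<le> card (descents n e)" using descents_bound[OF e] by (intro card_mono) auto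
      then have "card ?L \<le> 8 ^ n" using descents_bound[OF e, of n] by linarith
      then have "real (card ?L) \<le> real (8 ^ n)" by (simp only: of_nat_le_iff)
      then show "real (card ?L) \<le> 8 ^ n" by simp
    qed simp
    also have "\<dots> = (8 / 10) ^ n" by (simp add: power_mult_distrib[symmetric])
    finally show "measure clocks (B n e j) \<le> (8 / 10) ^ n" .
  qed
  have "(\<Inter>n. B n e j) \<in> null_sets clocks" if e: "e \<in> square_lattice" for e j
  proof -
    have s: "(\<Inter>n. B n e j) \<in> sets clocks" using B[OF e] by (intro sets.countable_INT) auto
    have "measure clocks (\<Inter>n. B n e j) \<le> (8 / 10) ^ n" for n
      using B[OF e, of n j] clocks.finite_measure_mono[of "\<Inter>n. B n e j" "B n e j"] by force
    moreover have "(\<lambda>n. (8 / 10) ^ n) \<longlonglongrightarrow> (0::real)" by (rule LIMSEQ_power_zero) simp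
    ultimately have "measure clocks (\<Inter>n. B n e j) \<le> 0" by (intro LIMSEQ_le_const) auto
    then show ?thesis using s by (simp add: null_sets_def clocks.emeasure_eq_measure measure_le_0_iff)
  qed
  then have "AE U in clocks. U \<notin> (\<Inter>n. B n e j)" if "e \<in> square_lattice" for e j
    using that by (intro AE_not_in) auto
  then have "AE U in clocks. \<forall>e\<in>square_lattice. \<forall>j. U \<notin> (\<Inter>n. B n e j)"
    using countable_lattice by (simp add: AE_ball_countable AE_all_countable)
  then show ?thesis using AE_space
  proof eventually_elim
    case (elim U)
    then have U: "U \<in> space clocks" "\<forall>e\<in>square_lattice. \<forall>j. U \<notin> (\<Inter>n. B n e j)"
      by simp_all
    show ?case
    proof (rule ccontr)
      assume "\<not> wf (earlier U)"
      then obtain f where f: "\<And>i. (f (Suc i), f i) \<in> earlier U"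
        by (auto simp: wf_iff_no_infinite_down_chain)
      have fE: "f i \<in> square_lattice" for i using f[of i] by (auto simp: earlier_def)
      have dec: "U (f (Suc i)) < U (f i)" for i using f[of i] by (auto simp: earlier_def)
      have anti: "U (f j) < U (f i)" if "i < j" for i j
        using that by (induction rule: strict_inc_induct) (use dec in \<open>auto intro: less_trans\<close>)
      \<comment> \<open>Cell numbers are natural and never increase along the chain, so after
        reaching its minimum the chain stays in one cell.\<close>
      define c where "c = (\<lambda>i. nat \<lfloor>10 * U (f i)\<rfloor>)"
      obtain k where k: "\<And>i. c k \<le> c i"
        using ex_has_least_nat[of "\<lambda>_. True" 0 c] by blast
      have flo: "\<lfloor>10 * U (f i)\<rfloor> \<ge> 0" for i using clocks_range[OF U(1) fE] by simp
      have same: "\<lfloor>10 * U (f i)\<rfloor> = int (c k)" if "i > k" for i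
      proof -
        have "\<lfloor>10 * U (f i)\<rfloor> \<le> \<lfloor>10 * U (f k)\<rfloor>" using anti[OF that] by (intro floor_mono) simp
        moreover have "\<lfloor>10 * U (f k)\<rfloor> \<le> \<lfloor>10 * U (f i)\<rfloor>"
          using k[of i] flo[of i] unfolding c_def by (subst (asm) nat_le_eq_zle) blast+
        moreover have "int (c k) = \<lfloor>10 * U (f k)\<rfloor>" using flo[of k] unfolding c_def by (rule nat_0_le)
        ultimately show ?thesis by linarith
      qed
      have "U \<in> B n (f k) (int (c k))" for n
      proof -
        let ?l = "map (\<lambda>i. f (k + Suc i)) [0..<n]"
        have inj: "f i \<noteq> f j" if "i < j" for i j using anti[OF that] by auto
        have "distinct ?l"
          by (auto simp: distinct_map inj_on_def) (metis inj add_left_cancel linorder_neqE_nat nat.inject)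
        moreover have "\<forall>g\<in>set ?l. U g \<in> time_cell (int (c k))"
          using same clocks_range[OF U(1) fE] by (auto simp: time_cell_def)
        moreover have "?l \<in> descents n (f k)" using f by (rule descents_chain)
        ultimately show ?thesis unfolding B_def using U(1) by blast
      qed
      then show False using U(2) fE by blast
    qed
  qed
qed

section \<open>Translations\<close>

definition shift_edge :: "int \<times> int \<Rightarrow> edge \<Rightarrow> edge" where
  "shift_edge z e = (\<lambda>v. v + z) ` e"

definition shift_clocks :: "int \<times> int \<Rightarrow> (edge \<Rightarrow> real) \<Rightarrow> edge \<Rightarrow> real" where
  "shift_clocks z U = (\<lambda>e\<in>square_lattice. U (shift_edge z e))"

lemma shift_edge_doubleton: "shift_edge z {u, v} = {u + z, v + z}"
  by (simp add: shift_edge_def)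

lemma shift_edge_inverse: "shift_edge (- z) (shift_edge z e) = e" "shift_edge z (shift_edge (- z) e) = e"
  by (simp_all add: shift_edge_def image_image)

lemma inj_shift_edge: "inj (shift_edge z)"
  by (metis injI shift_edge_inverse(1))

lemma shift_edge_in_lattice: "shift_edge z e \<in> square_lattice \<longleftrightarrow> e \<in> square_lattice"
proof -
  have *: "shift_edge z e \<in> square_lattice" if e: "e \<in> square_lattice" for z e
  proof -
    obtain u v where uv: "e = {u, v}" "v \<in> neighbours u" using e by (blast elim: lattice_edgeE)
    then have "v + z \<in> neighbours (u + z)"
      by (cases u; cases v; cases z) (auto simp: neighbours_def)
    then show ?thesis using uv(1) doubleton_in_lattice by (simp add: shift_edge_doubleton)
  qed
  show ?thesis using *[of e z] *[of "shift_edge z e" "- z"] by (auto simp: shift_edge_inverse)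
qed

lemma distr_shift: "distr clocks clocks (shift_clocks z) = clocks"
  unfolding clocks_eq shift_clocks_def
  using distr_PiM_reindex[of square_lattice "\<lambda>_. unit_clock" "shift_edge z" square_lattice]
  by (simp add: prob_space_unit_clock shift_edge_in_lattice inj_on_subset[OF inj_shift_edge] Pi_iff)

lemma measurable_shift [measurable]: "shift_clocks z \<in> measurable clocks clocks"
  unfolding clocks_eq shift_clocks_def
  by (intro measurable_restrict measurable_component_singleton) (simp add: shift_edge_in_lattice)

lemma attempt_shift: "attempt n (shift_clocks z U) e \<longleftrightarrow> attempt n U (shift_edge z e)"
proof (induction n arbitrary: e)
  case (Suc n)
  show ?case
  proof (cases "e \<in> square_lattice")
    case True
    have "card {f \<in> square_lattice. u \<in> f \<and> shift_clocks z U f < shift_clocks z U e \<and> attempt n (shift_clocks z U) f} =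
      card {f \<in> square_lattice. u + z \<in> f \<and> U f < U (shift_edge z e) \<and> attempt n U f}" for u
    proof (rule bij_betw_same_card[of "shift_edge z"])
      show "bij_betw (shift_edge z)
        {f \<in> square_lattice. u \<in> f \<and> shift_clocks z U f < shift_clocks z U e \<and> attempt n (shift_clocks z U) f}
        {f \<in> square_lattice. u + z \<in> f \<and> U f < U (shift_edge z e) \<and> attempt n U f}"
      proof (rule bij_betw_byWitness[where f' = "shift_edge (- z)"])
        have mem: "u + z \<in> shift_edge z f \<longleftrightarrow> u \<in> f" for f by (auto simp: shift_edge_def)
        show "shift_edge z ` {f \<in> square_lattice. u \<in> f \<and> shift_clocks z U f < shift_clocks z U e \<and> attempt n (shift_clocks z U) f}
          \<subseteq> {f \<in> square_lattice. u + z \<in> f \<and> U f < U (shift_edge z e) \<and> attempt n U f}"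
          using True by (auto simp: mem Suc shift_edge_in_lattice) (simp add: shift_clocks_def)
        show "shift_edge (- z) ` {f \<in> square_lattice. u + z \<in> f \<and> U f < U (shift_edge z e) \<and> attempt n U f}
          \<subseteq> {f \<in> square_lattice. u \<in> f \<and> shift_clocks z U f < shift_clocks z U e \<and> attempt n (shift_clocks z U) f}"
        proof (rule image_subsetI)
          fix f assume f: "f \<in> {f \<in> square_lattice. u + z \<in> f \<and> U f < U (shift_edge z e) \<and> attempt n U f}"
          obtain g where g: "f = shift_edge z g" by (metis shift_edge_inverse(2))
          have "g \<in> square_lattice" using f g by (simp add: shift_edge_in_lattice)
          then show "shift_edge (- z) f \<in> {f \<in> square_lattice. u \<in> f \<and> shift_clocks z U f < shift_clocks z U e \<and> attempt n (shift_clocks z U) f}"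
            using f True by (simp add: g shift_edge_inverse mem Suc) (simp add: shift_clocks_def)
        qed
      qed (simp_all add: shift_edge_inverse)
    qed
    then show ?thesis using True
      by (simp add: feasible_def shift_edge_in_lattice) (simp add: shift_edge_def)
  qed (simp add: feasible_def shift_edge_in_lattice)
qed simp

lemma open_at_shift: "open_at t (shift_clocks z U) = (\<lambda>e. open_at t U (shift_edge z e))"
proof
  fix e
  show "open_at t (shift_clocks z U) e = open_at t U (shift_edge z e)"
  proof (cases "e \<in> square_lattice")
    case True
    then show ?thesis by (simp add: open_at_def accepted_def attempt_shift) (simp add: shift_clocks_def)
  next
    case False
    then show ?thesis
      using open_at_in_lattice[of t "shift_clocks z U" e] open_at_in_lattice[of t U "shift_edge z e"]
      by (auto simp: shift_edge_in_lattice)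
  qed
qed

lemma linked_shift_forward:
  assumes "linked (\<lambda>e. \<eta> (shift_edge z e)) D x y"
  shows "linked \<eta> ((\<lambda>v. v + z) ` D) (x + z) (y + z)"
  using assms
proof (induction rule: linked_induct)
  case (step y y')
  have "linked \<eta> ((\<lambda>v. v + z) ` D) (y + z) (y' + z)"
    using step by (intro linked_step) (auto simp: shift_edge_doubleton)
  then show ?case using step linked_trans by metis
qed simp

lemma linked_shift:
  "linked (\<lambda>e. \<eta> (shift_edge z e)) D x y \<longleftrightarrow> linked \<eta> ((\<lambda>v. v + z) ` D) (x + z) (y + z)"
proof
  assume "linked \<eta> ((\<lambda>v. v + z) ` D) (x + z) (y + z)"
  then have "linked (\<lambda>e. \<eta> (shift_edge z (shift_edge (- z) e))) ((\<lambda>v. v + z) ` D) (x + z) (y + z)"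
    by (simp add: shift_edge_inverse)
  then show "linked (\<lambda>e. \<eta> (shift_edge z e)) D x y"
    using linked_shift_forward[of "\<lambda>e. \<eta> (shift_edge z e)" "- z"]
    by (fastforce simp: image_image shift_edge_inverse)
qed (rule linked_shift_forward)

lemma escapes_shift:
  "escapes (\<lambda>e. \<eta> (shift_edge z e)) D x \<longleftrightarrow> escapes \<eta> ((\<lambda>v. v + z) ` D) (x + z)"
proof -
  have "{y. linked \<eta> ((\<lambda>v. v + z) ` D) (x + z) y} = (\<lambda>v. v + z) ` {y. linked (\<lambda>e. \<eta> (shift_edge z e)) D x y}"
  proof (intro equalityI subsetI)
    fix y assume "y \<in> {y. linked \<eta> ((\<lambda>v. v + z) ` D) (x + z) y}"
    then have "linked (\<lambda>e. \<eta> (shift_edge z e)) D x (y - z)" by (simp add: linked_shift)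
    then show "y \<in> (\<lambda>v. v + z) ` {y. linked (\<lambda>e. \<eta> (shift_edge z e)) D x y}"
      by (intro image_eqI[of _ _ "y - z"]) auto
  qed (auto simp: linked_shift)
  moreover have "inj_on (\<lambda>v. v + z) S" for S :: "(int \<times> int) set" by (simp add: inj_on_def)
  ultimately show ?thesis by (simp add: escapes_def finite_image_iff)
qed

section \<open>Measurability of the events\<close>

lemma pred_card_less:
  assumes "finite S" "\<And>f. f \<in> S \<Longrightarrow> Measurable.pred M (P f)"
  shows "Measurable.pred M (\<lambda>x. card {f \<in> S. P f x} < (n::nat))"
proof -
  \<comment> \<open>Splitting by the exact set \<open>T\<close> of successes gives a finite union of
    finite intersections.\<close>
  have "(card {f \<in> S. P f x} < n) \<longleftrightarrow> (\<exists>T\<in>Pow S. card T < n \<and> (\<forall>f\<in>S. P f x \<longleftrightarrow> f \<in> T))" for x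
  proof
    assume "card {f \<in> S. P f x} < n"
    then show "\<exists>T\<in>Pow S. card T < n \<and> (\<forall>f\<in>S. P f x \<longleftrightarrow> f \<in> T)"
      by (intro bexI[of _ "{f \<in> S. P f x}"]) auto
  next
    assume "\<exists>T\<in>Pow S. card T < n \<and> (\<forall>f\<in>S. P f x \<longleftrightarrow> f \<in> T)"
    then obtain T where "T \<subseteq> S" "card T < n" "\<forall>f\<in>S. P f x \<longleftrightarrow> f \<in> T" by auto
    moreover from this have "{f \<in> S. P f x} = T" by auto
    ultimately show "card {f \<in> S. P f x} < n" by simp
  qed
  moreover have "Measurable.pred M (\<lambda>x. \<exists>T\<in>Pow S. card T < n \<and> (\<forall>f\<in>S. P f x \<longleftrightarrow> f \<in> T))"
  proof (rule pred_intros_finite)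
    fix T
    have "Measurable.pred M (\<lambda>x. \<forall>f\<in>S. P f x \<longleftrightarrow> f \<in> T)"
      by (rule pred_intros_finite(3)[OF assms(1)]) (use assms(2) in measurable)
    then show "Measurable.pred M (\<lambda>x. card T < n \<and> (\<forall>f\<in>S. P f x \<longleftrightarrow> f \<in> T))" by measurable
  qed (use assms in simp)
  ultimately show ?thesis by simp
qed

lemma pred_attempt: "Measurable.pred clocks (\<lambda>U. attempt n U e)"
proof (induction n arbitrary: e)
  case (Suc n)
  show ?case
  proof (cases "e \<in> square_lattice")
    case True
    have "Measurable.pred clocks (\<lambda>U. card {f \<in> {f \<in> square_lattice. u \<in> f}. U f < U e \<and> attempt n U f} < 3)" for u
    proof (rule pred_card_less[OF finite_incident])
      fix f assume "f \<in> {f \<in> square_lattice. u \<in> f}"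
      then have [measurable]: "(\<lambda>U. U f) \<in> borel_measurable clocks" by (intro measurable_clock) simp
      note [measurable] = measurable_clock[OF True] Suc
      show "Measurable.pred clocks (\<lambda>U. U f < U e \<and> attempt n U f)" by measurable
    qed
    then have "Measurable.pred clocks (\<lambda>U. \<forall>u\<in>e. card {f \<in> {f \<in> square_lattice. u \<in> f}. U f < U e \<and> attempt n U f} < 3)"
      using finite_edge[OF True] by (intro pred_intros_finite(3)) auto
    then show ?thesis using True by (simp add: feasible_def conj_assoc)
  qed (simp add: feasible_def)
qed simp

lemma pred_open_at: "Measurable.pred clocks (\<lambda>U. open_at t U e)"
proof (cases "e \<in> square_lattice")
  case True
  note [measurable] = measurable_clock[OF True] pred_attempt
  show ?thesis unfolding open_at_def accepted_def by measurable
next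
  case False
  then have "\<not> open_at t U e" for U using open_at_in_lattice by blast
  then show ?thesis by simp
qed

lemma pred_linked:
  fixes \<eta> :: "'a \<Rightarrow> 'v::countable set \<Rightarrow> bool"
  assumes "\<And>e. Measurable.pred M (\<lambda>U. \<eta> U e)"
  shows "Measurable.pred M (\<lambda>U. linked (\<eta> U) D x y)"
proof -
  note [measurable] = assms
  have "Measurable.pred M (\<lambda>U. ((\<lambda>u v. \<eta> U {u, v} \<and> u \<notin> D \<and> v \<notin> D) ^^ n) x y)" for n y
  proof (induction n arbitrary: y)
    case (Suc n)
    note [measurable] = Suc
    show ?case unfolding relpowp.simps relcompp_apply by measurable
  qed simp
  then show ?thesis unfolding linked_def rtranclp_power by measurable
qed

text \<open>Vertices are countable, so infinitude means unbounded codes under \<open>to_nat\<close>,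
  which needs only countable unions and intersections.\<close>

lemma pred_escapes:
  fixes \<eta> :: "'a \<Rightarrow> 'v::countable set \<Rightarrow> bool"
  assumes "\<And>e. Measurable.pred M (\<lambda>U. \<eta> U e)"
  shows "Measurable.pred M (\<lambda>U. escapes (\<eta> U) D x)"
proof -
  note [measurable] = pred_linked[OF assms]
  have "infinite S \<longleftrightarrow> (\<forall>n::nat. \<exists>y. n < to_nat y \<and> y \<in> S)" for S :: "'v set"
  proof -
    have "infinite S \<longleftrightarrow> infinite (to_nat ` S)" by (simp add: finite_image_iff)
    moreover have "(\<exists>k>n. k \<in> to_nat ` S) \<longleftrightarrow> (\<exists>y. n < to_nat y \<and> y \<in> S)" for n by blast
    ultimately show ?thesis by (simp only: infinite_nat_iff_unbounded)
  qed
  then show ?thesis unfolding escapes_def by simp measurable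
qed

section \<open>Ergodicity\<close>

text \<open>These are the cylinder events with finite base \<open>J\<close>.\<close>

definition local_event :: "edge set \<Rightarrow> (edge \<Rightarrow> real) set \<Rightarrow> bool" where
  "local_event J A \<longleftrightarrow> finite J \<and> J \<subseteq> square_lattice \<and>
     (\<exists>B\<in>sets (\<Pi>\<^sub>M _\<in>J. unit_clock). A = {U \<in> space clocks. restrict U J \<in> B})"

lemma measurable_restrict_clocks:
  "J \<subseteq> square_lattice \<Longrightarrow> (\<lambda>U. restrict U J) \<in> measurable clocks (\<Pi>\<^sub>M _\<in>J. unit_clock)"
  unfolding clocks_eq by (rule measurable_restrict_subset)

lemma local_event_sets: "local_event J A \<Longrightarrow> A \<in> sets clocks"
  unfolding local_event_def
  using measurable_sets[OF measurable_restrict_clocks, of J]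
  by (auto simp: vimage_def Int_def conj_commute)

lemma local_event_mono:
  assumes "local_event J A" "J \<subseteq> K" "finite K" "K \<subseteq> square_lattice"
  shows "local_event K A"
proof -
  obtain B where B: "B \<in> sets (\<Pi>\<^sub>M _\<in>J. unit_clock)" "A = {U \<in> space clocks. restrict U J \<in> B}"
    using assms(1) by (auto simp: local_event_def)
  have m: "(\<lambda>U. restrict U J) \<in> measurable (\<Pi>\<^sub>M _\<in>K. unit_clock) (\<Pi>\<^sub>M _\<in>J. unit_clock)"
    using assms(2) by (rule measurable_restrict_subset)
  let ?B = "(\<lambda>U. restrict U J) -` B \<inter> space (\<Pi>\<^sub>M _\<in>K. unit_clock)"
  have "?B \<in> sets (\<Pi>\<^sub>M _\<in>K. unit_clock)" using m B(1) by (rule measurable_sets)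
  moreover have "A = {U \<in> space clocks. restrict U K \<in> ?B}"
  proof -
    have "restrict U K \<in> ?B \<longleftrightarrow> restrict U J \<in> B" if "U \<in> space clocks" for U
      using measurable_space[OF measurable_restrict_clocks[OF assms(4)] that] assms(2)
      by (simp add: Int_absorb1)
    then show ?thesis unfolding B(2) by (intro Collect_cong conj_cong refl) simp
  qed
  ultimately show ?thesis using assms(3,4) unfolding local_event_def by blast
qed

lemma local_event_Compl: "local_event J A \<Longrightarrow> local_event J (space clocks - A)"
proof -
  assume A: "local_event J A"
  then obtain B where B: "B \<in> sets (\<Pi>\<^sub>M _\<in>J. unit_clock)" "A = {U \<in> space clocks. restrict U J \<in> B}"
    and J: "finite J" "J \<subseteq> square_lattice" by (auto simp: local_event_def)
  have "space clocks - A = {U \<in> space clocks. restrict U J \<in> space (\<Pi>\<^sub>M _\<in>J. unit_clock) - B}"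
    using measurable_space[OF measurable_restrict_clocks[OF J(2)]] by (auto simp: B(2))
  then show ?thesis using B(1) J by (auto simp: local_event_def)
qed

lemma local_event_Un:
  assumes A: "local_event J A" and C: "local_event K C"
  shows "local_event (J \<union> K) (A \<union> C)"
proof -
  have JK: "finite (J \<union> K)" "J \<union> K \<subseteq> square_lattice" using A C by (auto simp: local_event_def)
  obtain B where B: "B \<in> sets (\<Pi>\<^sub>M _\<in>J \<union> K. unit_clock)" "A = {U \<in> space clocks. restrict U (J \<union> K) \<in> B}"
    using local_event_mono[OF A _ JK] by (auto simp: local_event_def)
  obtain B' where B': "B' \<in> sets (\<Pi>\<^sub>M _\<in>J \<union> K. unit_clock)" "C = {U \<in> space clocks. restrict U (J \<union> K) \<in> B'}"
    using local_event_mono[OF C _ JK] by (auto simp: local_event_def)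
  have "A \<union> C = {U \<in> space clocks. restrict U (J \<union> K) \<in> B \<union> B'}" by (auto simp: B(2) B'(2))
  then show ?thesis using B(1) B'(1) JK unfolding local_event_def by blast
qed

definition approximable :: "(edge \<Rightarrow> real) set \<Rightarrow> bool" where
  "approximable A \<longleftrightarrow> A \<in> sets clocks \<and>
     (\<forall>\<epsilon>>0. \<exists>J B. local_event J B \<and> measure clocks (sym_diff A B) < \<epsilon>)"

lemma approximable_Un:
  assumes "approximable A" "approximable B"
  shows "approximable (A \<union> B)"
  unfolding approximable_def
proof (intro conjI allI impI)
  show s: "A \<union> B \<in> sets clocks" using assms by (auto simp: approximable_def)
  fix \<epsilon> :: real assume "\<epsilon> > 0"
  then have e: "\<epsilon> / 2 > 0" by simp
  obtain J A' where A': "local_event J A'" "measure clocks (sym_diff A A') < \<epsilon> / 2"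
    using assms(1) e unfolding approximable_def by blast
  obtain K B' where B': "local_event K B'" "measure clocks (sym_diff B B') < \<epsilon> / 2"
    using assms(2) e unfolding approximable_def by blast
  have [measurable]: "A \<in> sets clocks" "B \<in> sets clocks" "A' \<in> sets clocks" "B' \<in> sets clocks"
    using assms A' B' local_event_sets by (auto simp: approximable_def)
  have "measure clocks (sym_diff (A \<union> B) (A' \<union> B')) \<le>
      measure clocks (sym_diff A A' \<union> sym_diff B B')"
    by (intro clocks.finite_measure_mono) auto
  also have "\<dots> \<le> measure clocks (sym_diff A A') + measure clocks (sym_diff B B')"
    by (intro measure_Un_le) auto
  finally show "\<exists>J C. local_event J C \<and> measure clocks (sym_diff (A \<union> B) C) < \<epsilon>"
    using local_event_Un[OF A'(1) B'(1)] A'(2) B'(2)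
    by (intro exI[of _ "J \<union> K"] exI[of _ "A' \<union> B'"]) auto
qed

lemma approximable_empty: "approximable {}"
proof -
  have "local_event {} {}" by (auto simp: local_event_def intro!: bexI[of _ "{}"])
  then have "local_event {} {} \<and> measure clocks (sym_diff {} {}) < \<epsilon>" if "\<epsilon> > 0" for \<epsilon>
    using that by simp
  then show ?thesis unfolding approximable_def by blast
qed

text \<open>Events approximable by cylinders contain the generating cylinders and are closed under
  complements and countable unions.\<close>

lemma approximable_all:
  assumes "A \<in> sets clocks"
  shows "approximable A"
proof -
  have "A \<in> sigma_sets (space clocks) (prod_algebra square_lattice (\<lambda>_. unit_clock))"
    using assms by (simp add: clocks_eq sets_PiM space_PiM)
  then show ?thesis
  proof (induction rule: sigma_sets.induct)
    case (Basic a)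
    then obtain J X where a: "a = prod_emb square_lattice (\<lambda>_. unit_clock) J (Pi\<^sub>E J X)"
      "finite J" "J \<subseteq> square_lattice" "\<And>i. i \<in> J \<Longrightarrow> X i \<in> sets unit_clock"
      by (elim prod_algebraE) auto
    have "local_event J a" unfolding local_event_def
      using a by (auto simp: prod_emb_def clocks_eq space_PiM intro!: bexI[of _ "Pi\<^sub>E J X"])
    moreover from this have "a \<in> sets clocks" by (rule local_event_sets)
    ultimately show ?case unfolding approximable_def by (auto intro!: exI[of _ J] exI[of _ a])
  next
    case Empty
    show ?case by (rule approximable_empty)
  next
    case (Compl a)
    show ?case unfolding approximable_def
    proof (intro conjI allI impI)
      show "space clocks - a \<in> sets clocks" using Compl by (auto simp: approximable_def)
      fix \<epsilon> :: real assume "\<epsilon> > 0"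
      then obtain J B where B: "local_event J B" "measure clocks (sym_diff a B) < \<epsilon>"
        using Compl(2) unfolding approximable_def by blast
      have "sym_diff (space clocks - a) (space clocks - B) = sym_diff a B"
        using local_event_sets[OF B(1)] Compl(2)[unfolded approximable_def]
        by (auto dest: sets.sets_into_space)
      then show "\<exists>J B. local_event J B \<and> measure clocks (sym_diff (space clocks - a) B) < \<epsilon>"
        using local_event_Compl[OF B(1)] B(2) by (intro exI[of _ J] exI[of _ "space clocks - B"]) simp
    qed
  next
    case (Union a)
    have fin: "approximable (\<Union>i<n. a i)" for n
    proof (induction n)
      case (Suc n)
      have "(\<Union>i<Suc n. a i) = (\<Union>i<n. a i) \<union> a n" by (auto simp: lessThan_Suc)
      then show ?case using approximable_Un[OF Suc Union(2)[of n]] by simp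
    qed (simp add: approximable_empty)
    have s: "a i \<in> sets clocks" for i using Union(2) by (simp add: approximable_def)
    have sn: "(\<Union>i<n. a i) \<in> sets clocks" for n using s by auto
    have su: "(\<Union>i. a i) \<in> sets clocks" using s by auto
    show ?case unfolding approximable_def
    proof (intro conjI allI impI su)
      fix \<epsilon> :: real assume "\<epsilon> > 0"
      \<comment> \<open>A finite partial union already carries almost the whole measure of the
        countable one.\<close>
      have "(\<lambda>n. measure clocks (\<Union>i<n. a i)) \<longlonglongrightarrow> measure clocks (\<Union>n. \<Union>i<n. a i)"
      proof (rule clocks.finite_Lim_measure_incseq)
        show "range (\<lambda>n. \<Union>i<n. a i) \<subseteq> sets clocks" using sn by blast
        show "incseq (\<lambda>n. \<Union>i<n. a i)" unfolding incseq_def by (intro allI impI UN_mono) auto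
      qed
      moreover have "(\<Union>n. \<Union>i<n. a i) = (\<Union>i. a i)" by auto
      ultimately have "(\<lambda>n. measure clocks (\<Union>i<n. a i)) \<longlonglongrightarrow> measure clocks (\<Union>i. a i)" by simp
      then obtain n where n: "\<bar>measure clocks (\<Union>i<n. a i) - measure clocks (\<Union>i. a i)\<bar> < \<epsilon> / 2"
        using \<open>\<epsilon> > 0\<close> by (metis LIMSEQ_D half_gt_zero le_refl real_norm_def)
      obtain J B where B: "local_event J B" "measure clocks (sym_diff (\<Union>i<n. a i) B) < \<epsilon> / 2"
        using fin[of n] \<open>\<epsilon> > 0\<close> unfolding approximable_def by (metis half_gt_zero)
      note [measurable] = local_event_sets[OF B(1)] sn[of n] su
      have "measure clocks ((\<Union>i. a i) - (\<Union>i<n. a i)) = measure clocks (\<Union>i. a i) - measure clocks (\<Union>i<n. a i)"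
        using sn su by (intro clocks.finite_measure_Diff) auto
      then have d: "measure clocks ((\<Union>i. a i) - (\<Union>i<n. a i)) < \<epsilon> / 2" using n by linarith
      have "measure clocks (sym_diff (\<Union>i. a i) B) \<le>
          measure clocks (((\<Union>i. a i) - (\<Union>i<n. a i)) \<union> sym_diff (\<Union>i<n. a i) B)"
        using sn su local_event_sets[OF B(1)] by (intro clocks.finite_measure_mono) auto
      also have "\<dots> \<le> measure clocks ((\<Union>i. a i) - (\<Union>i<n. a i)) + measure clocks (sym_diff (\<Union>i<n. a i) B)"
        using sn su local_event_sets[OF B(1)] by (intro measure_Un_le) auto
      finally show "\<exists>J B. local_event J B \<and> measure clocks (sym_diff (\<Union>i. a i) B) < \<epsilon>"
        using B d by (intro exI[of _ J] exI[of _ B]) auto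
    qed
  qed
qed

lemma indep_clocks: "clocks.indep_vars (\<lambda>_. unit_clock) (\<lambda>e U. U e) square_lattice"
proof -
  have "{(0, 0), (1, 0)} \<in> square_lattice" by (simp add: doubleton_in_lattice neighbours_def)
  then have ne: "square_lattice \<noteq> {}" by blast
  have rv: "(\<lambda>U. U e) \<in> measurable clocks unit_clock" if "e \<in> square_lattice" for e
    unfolding clocks_eq using that by (rule measurable_component_singleton)
  have "distr clocks (\<Pi>\<^sub>M _\<in>square_lattice. unit_clock) (\<lambda>U. \<lambda>e\<in>square_lattice. U e) =
      distr clocks clocks (\<lambda>U. U)"
    by (intro distr_cong) (auto simp: clocks_eq space_PiM PiE_def extensional_restrict)
  also have "\<dots> = clocks" by (rule distr_id)
  also have "\<dots> = (\<Pi>\<^sub>M e\<in>square_lattice. distr clocks unit_clock (\<lambda>U. U e))"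
    unfolding clocks_eq by (intro PiM_cong clock_product.PiM_component[symmetric]) auto
  finally show ?thesis using clocks.indep_vars_iff_distr_eq_PiM'[OF ne rv] by simp
qed

lemma local_events_indep:
  assumes "local_event J A" "local_event K B" "J \<inter> K = {}"
  shows "measure clocks (A \<inter> B) = measure clocks A * measure clocks B"
proof -
  obtain A' where A': "A' \<in> sets (\<Pi>\<^sub>M _\<in>J. unit_clock)" "A = {U \<in> space clocks. restrict U J \<in> A'}"
    and J: "J \<subseteq> square_lattice" using assms(1) by (auto simp: local_event_def)
  obtain B' where B': "B' \<in> sets (\<Pi>\<^sub>M _\<in>K. unit_clock)" "B = {U \<in> space clocks. restrict U K \<in> B'}"
    and K: "K \<subseteq> square_lattice" using assms(2) by (auto simp: local_event_def)
  have "clocks.indep_vars (\<lambda>b. \<Pi>\<^sub>M _\<in>case_bool J K b. unit_clock)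
      (\<lambda>b U. restrict (\<lambda>e. U e) (case_bool J K b)) UNIV"
  proof (rule clocks.indep_vars_restrict[OF indep_clocks])
    show "case_bool J K b \<subseteq> square_lattice" for b using J K by (cases b) auto
    show "disjoint_family_on (case_bool J K) UNIV"
      using assms(3) by (auto simp: disjoint_family_on_def split: bool.splits)
  qed
  from clocks.indep_varsD_finite[OF this, of "case_bool A' B'"] A'(1) B'(1)
  have "measure clocks (\<Inter>b. (\<lambda>U. restrict U (case_bool J K b)) -` (case_bool A' B' b) \<inter> space clocks) =
      (\<Prod>b\<in>UNIV. measure clocks ((\<lambda>U. restrict U (case_bool J K b)) -` (case_bool A' B' b) \<inter> space clocks))"
    by (auto split: bool.split)
  moreover have "(\<Inter>b. (\<lambda>U. restrict U (case_bool J K b)) -` (case_bool A' B' b) \<inter> space clocks) = A \<inter> B"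
    by (auto simp: A'(2) B'(2) UNIV_bool)
  moreover have "(\<lambda>U. restrict U J) -` A' \<inter> space clocks = A" "(\<lambda>U. restrict U K) -` B' \<inter> space clocks = B"
    by (auto simp: A'(2) B'(2))
  ultimately show ?thesis by (simp add: UNIV_bool mult.commute)
qed

lemma local_event_shift:
  assumes "local_event J A"
  shows "local_event (shift_edge z ` J) (shift_clocks z -` A \<inter> space clocks)"
proof -
  obtain B where B: "B \<in> sets (\<Pi>\<^sub>M _\<in>J. unit_clock)" "A = {U \<in> space clocks. restrict U J \<in> B}"
    and J: "finite J" "J \<subseteq> square_lattice" using assms by (auto simp: local_event_def)
  let ?f = "\<lambda>X. \<lambda>e\<in>J. X (shift_edge z e)"
  have m: "?f \<in> measurable (\<Pi>\<^sub>M _\<in>shift_edge z ` J. unit_clock) (\<Pi>\<^sub>M _\<in>J. unit_clock)"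
    by (intro measurable_restrict measurable_component_singleton) auto
  let ?B = "?f -` B \<inter> space (\<Pi>\<^sub>M _\<in>shift_edge z ` J. unit_clock)"
  have sub: "shift_edge z ` J \<subseteq> square_lattice" using J(2) by (auto simp: shift_edge_in_lattice)
  have "restrict (shift_clocks z U) J = ?f (restrict U (shift_edge z ` J))" for U
    using J(2) by (auto simp: shift_clocks_def fun_eq_iff)
  then have "shift_clocks z -` A \<inter> space clocks = {U \<in> space clocks. restrict U (shift_edge z ` J) \<in> ?B}"
    using measurable_space[OF measurable_restrict_clocks[OF sub]] measurable_space[OF measurable_shift[of z]]
    by (auto simp: B(2))
  moreover have "?B \<in> sets (\<Pi>\<^sub>M _\<in>shift_edge z ` J. unit_clock)" using m B(1) by (rule measurable_sets)
  ultimately show ?thesis using sub J(1) unfolding local_event_def by blast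
qed

text \<open>A vector that is no difference of two endpoints of edges in \<open>J\<close> moves every
  edge of \<open>J\<close> off all the others and off itself.\<close>

lemma disjoint_shift:
  assumes "finite J" "J \<subseteq> square_lattice"
  shows "\<exists>z. J \<inter> shift_edge z ` J = {}"
proof -
  define V where "V = \<Union>J"
  have "finite V" using assms finite_edge by (auto simp: V_def)
  then have "finite ((\<lambda>(u, v). v - u) ` (V \<times> V))" by simp
  then obtain z where z: "z \<notin> (\<lambda>(u, v). v - u) ` (V \<times> V)"
    using ex_new_if_finite[OF infinite_UNIV_char_0] ex_new_if_finite
    by (metis finite_prod infinite_UNIV_int)
  have "J \<inter> shift_edge z ` J = {}"
  proof (rule ccontr)
    assume "\<not> ?thesis"
    then obtain e f where ef: "e \<in> J" "f \<in> J" "e = shift_edge z f" by auto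
    then obtain u where "u \<in> f" using assms(2) by (blast elim: lattice_edgeE)
    then have "u + z \<in> e" unfolding ef(3) shift_edge_def by (rule imageI)
    then have "u \<in> V" "u + z \<in> V" using ef(1,2) \<open>u \<in> f\<close> unfolding V_def by blast+
    then have "(\<lambda>(u, v). v - u) (u, u + z) \<in> (\<lambda>(u, v). v - u) ` (V \<times> V)" by blast
    then show False using z by simp
  qed
  then show ?thesis ..
qed

text \<open>An invariant event is close to a cylinder event and to a translate of it on disjoint
  edges. These two are independent with equal probability, so \<open>p\<close> is arbitrarily close
  to \<open>p * p\<close>.\<close>

lemma zero_one_law:
  assumes P: "Measurable.pred clocks P" and inv: "\<And>z U. U \<in> space clocks \<Longrightarrow> P (shift_clocks z U) \<longleftrightarrow> P U"
  shows "(AE U in clocks. P U) \<or> (AE U in clocks. \<not> P U)"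
proof -
  define A where "A = {U \<in> space clocks. P U}"
  define p where "p = measure clocks A"
  have sA: "A \<in> sets clocks" using P unfolding A_def by measurable
  have shA: "shift_clocks z -` A \<inter> space clocks = A" for z
  proof -
    have "U \<in> shift_clocks z -` A \<inter> space clocks \<longleftrightarrow> U \<in> A" for U
      using measurable_space[OF measurable_shift[of z], of U] inv[of U z] by (auto simp: A_def)
    then show ?thesis by blast
  qed
  have p01: "0 \<le> p" "p \<le> 1" by (simp_all add: p_def)
  have "\<bar>p - p * p\<bar> \<le> 4 * \<epsilon>" if eps: "\<epsilon> > 0" for \<epsilon>
  proof -
    obtain J B where B: "local_event J B" "measure clocks (sym_diff A B) < \<epsilon>"
      using approximable_all[OF sA] eps unfolding approximable_def by blast
    obtain z where z: "J \<inter> shift_edge z ` J = {}"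
      using disjoint_shift[of J] B(1) unfolding local_event_def by blast
    define B' where "B' = shift_clocks z -` B \<inter> space clocks"
    have B': "local_event (shift_edge z ` J) B'" unfolding B'_def using B(1) by (rule local_event_shift)
    have sB: "B \<in> sets clocks" "B' \<in> sets clocks" using B(1) B' local_event_sets by blast+
    define b where "b = measure clocks B"
    have shm: "measure clocks (shift_clocks z -` C \<inter> space clocks) = measure clocks C" if "C \<in> sets clocks" for C
      using measure_distr[OF measurable_shift that, of z] distr_shift[of z] by simp
    have bb: "measure clocks (B \<inter> B') = b * b"
      using local_events_indep[OF B(1) B' z] shm[OF sB(1)] by (simp add: B'_def b_def)
    have "sym_diff A B' = shift_clocks z -` (sym_diff A B) \<inter> space clocks"
      using shA[of z] by (auto simp: B'_def)
    then have d': "measure clocks (sym_diff A B') < \<epsilon>"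
      using shm[of "sym_diff A B"] sA sB B(2) by simp
    have close: "\<bar>measure clocks A - measure clocks C\<bar> \<le> measure clocks (sym_diff A C)"
      if C: "C \<in> sets clocks" for C
    proof -
      have "measure clocks A \<le> measure clocks (C \<union> sym_diff A C)"
        "measure clocks C \<le> measure clocks (A \<union> sym_diff A C)"
        using sA C by (auto intro!: clocks.finite_measure_mono)
      moreover have "measure clocks (C \<union> sym_diff A C) \<le> measure clocks C + measure clocks (sym_diff A C)"
        "measure clocks (A \<union> sym_diff A C) \<le> measure clocks A + measure clocks (sym_diff A C)"
        using sA C by (auto intro!: measure_Un_le)
      ultimately show ?thesis by linarith
    qed
    have "measure clocks (sym_diff A (B \<inter> B')) \<le> measure clocks (sym_diff A B \<union> sym_diff A B')"
      using sA sB by (intro clocks.finite_measure_mono) auto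
    also have "\<dots> \<le> measure clocks (sym_diff A B) + measure clocks (sym_diff A B')"
      using sA sB by (intro measure_Un_le) auto
    \<comment> \<open>Half of the error 4 \<epsilon> comes from replacing \<open>A\<close> by
      \<open>B \<inter> B'\<close>, the other half from replacing \<open>b * b\<close> by
      \<open>p * p\<close>.\<close>
    finally have "\<bar>p - b * b\<bar> \<le> 2 * \<epsilon>"
      using close[of "B \<inter> B'"] sB B(2) d' by (simp add: p_def bb)
    moreover have "\<bar>p - b\<bar> \<le> \<epsilon>" using close[OF sB(1)] B(2) by (simp add: p_def b_def)
    moreover have "0 \<le> b" "b \<le> 1" by (simp_all add: b_def)
    moreover have "\<bar>b * b - p * p\<bar> = \<bar>p - b\<bar> * \<bar>p + b\<bar>"
      by (simp add: abs_mult[symmetric] algebra_simps abs_minus_commute)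
    moreover have "\<bar>p - b\<bar> * \<bar>p + b\<bar> \<le> \<epsilon> * 2"
      using p01 \<open>0 \<le> b\<close> \<open>b \<le> 1\<close> \<open>\<bar>p - b\<bar> \<le> \<epsilon>\<close> eps by (intro mult_mono) auto
    ultimately show ?thesis by linarith
  qed
  then have "\<bar>p - p * p\<bar> \<le> 0 + \<epsilon>" if "\<epsilon> > 0" for \<epsilon>
    using that by (metis add_0 mult.commute nonzero_divide_eq_eq zero_less_divide_iff zero_less_numeral zero_neq_numeral)
  then have "\<bar>p - p * p\<bar> \<le> 0" by (rule field_le_epsilon)
  then have "p = 0 \<or> p = 1" by (auto simp: field_simps)
  then show ?thesis
  proof
    assume "p = 0"
    then have "A \<in> null_sets clocks" using sA by (simp add: p_def null_sets_def clocks.emeasure_eq_measure)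
    then have "AE U in clocks. U \<notin> A" by (rule AE_not_in)
    then have "AE U in clocks. \<not> P U" using AE_space by eventually_elim (auto simp: A_def)
    then show ?thesis ..
  next
    assume "p = 1"
    then have "AE U in clocks. U \<in> A" using sA clocks.prob_eq_1 by (simp add: p_def)
    then have "AE U in clocks. P U" by (rule eventually_mono) (simp add: A_def)
    then show ?thesis ..
  qed
qed

section \<open>Absence of trifurcations\<close>

definition centred_box :: "nat \<Rightarrow> (int \<times> int) set" where
  "centred_box n = {- int n..int n} \<times> {- int n..int n}"

lemma finite_subset_box:
  assumes "finite S"
  shows "\<exists>n. S \<subseteq> centred_box n"
  using assms
proof (induction S rule: finite_induct)
  case (insert v S)
  then obtain n where n: "S \<subseteq> centred_box n" by blast
  define m where "m = n + nat \<bar>fst v\<bar> + nat \<bar>snd v\<bar>"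
  have "centred_box n \<subseteq> centred_box m" by (auto simp: centred_box_def m_def)
  moreover have "v \<in> centred_box m" by (cases v) (auto simp: centred_box_def m_def)
  ultimately show ?case using n by (intro exI[of _ m]) auto
qed simp

text \<open>Deleting \<open>- D\<close> leaves only paths inside \<open>D\<close>, so the first
  condition says that \<open>D\<close> is connected; the links to \<open>d\<close> make all three
  branches adjacent to \<open>D\<close>.\<close>

definition splits_cluster :: "('v set \<Rightarrow> bool) \<Rightarrow> 'v set \<Rightarrow> bool" where
  "splits_cluster \<eta> D \<longleftrightarrow> (\<exists>d\<in>D. \<exists>x y z. (\<forall>p\<in>D. \<forall>q\<in>D. linked \<eta> (- D) p q) \<and>
     escapes \<eta> D x \<and> escapes \<eta> D y \<and> escapes \<eta> D z \<and>
     \<not> linked \<eta> D x y \<and> \<not> linked \<eta> D x z \<and> \<not> linked \<eta> D y z \<and>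
     linked \<eta> {} x d \<and> linked \<eta> {} y d \<and> linked \<eta> {} z d)"

text \<open>Only the cutting set is confined to \<open>S\<close>, not the branches. For finite
  \<open>S\<close> this is a finite union over \<open>D\<close>, hence a measurable event, and it
  moves along with translations.\<close>

definition trifurcates_in :: "('v set \<Rightarrow> bool) \<Rightarrow> 'v set \<Rightarrow> bool" where
  "trifurcates_in \<eta> S \<longleftrightarrow> (\<exists>D\<in>Pow S. splits_cluster \<eta> D)"

lemma linked_path_set:
  assumes "linked \<eta> {} x y"
  shows "\<exists>P. finite P \<and> x \<in> P \<and> y \<in> P \<and> (\<forall>p\<in>P. linked \<eta> (- P) x p)"
  using assms
proof (induction rule: linked_induct)
  case refl
  show ?case by (intro exI[of _ "{x}"]) simp
next
  case (step y z)
  then obtain P where P: "finite P" "x \<in> P" "y \<in> P" "\<And>p. p \<in> P \<Longrightarrow> linked \<eta> (- P) x p" by blast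
  have up: "linked \<eta> (- insert z P) x p" if "p \<in> P" for p
    by (rule linked_mono[OF P(4)[OF that]]) auto
  have "linked \<eta> (- insert z P) y z" using step(2) P(3) by (intro linked_step) auto
  then have "linked \<eta> (- insert z P) x z" using up[OF P(3)] linked_trans by metis
  then show ?case using P up by (intro exI[of _ "insert z P"]) auto
qed

text \<open>The cutting set is made connected: paths join \<open>x\<close> to every point of
  \<open>D0\<close> in its cluster, and the branch points move further out, past these paths. The
  part of \<open>D0\<close> in other clusters is left out, since no path from \<open>x\<close> meets
  it.\<close>

lemma trifurcates_in_box:
  fixes \<eta> :: "(int \<times> int) set \<Rightarrow> bool"
  assumes lf: "\<And>x. finite {y. \<eta> {x, y}}" and tri: "trifurcates \<eta>"
  shows "\<exists>n. trifurcates_in \<eta> (centred_box n)"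
proof -
  obtain D0 x y z where D0: "finite D0" and esc: "escapes \<eta> D0 x" "escapes \<eta> D0 y" "escapes \<eta> D0 z"
    and sep: "\<not> linked \<eta> D0 x y" "\<not> linked \<eta> D0 x z" "\<not> linked \<eta> D0 y z"
    and same: "linked \<eta> {} x y" "linked \<eta> {} x z"
    using tri unfolding trifurcates_def by blast
  \<comment> \<open>\<open>x\<close> is included as the common base point; it is the member of
    \<open>D\<close> to which all three branches are linked.\<close>
  define C where "C = {d \<in> insert x D0. linked \<eta> {} x d}"
  have "finite C" using D0 by (simp add: C_def)
  have "\<forall>d\<in>C. \<exists>P. finite P \<and> x \<in> P \<and> d \<in> P \<and> (\<forall>p\<in>P. linked \<eta> (- P) x p)"
    using linked_path_set[of \<eta> x] by (simp add: C_def)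
  then obtain P where P: "\<And>d. d \<in> C \<Longrightarrow> finite (P d) \<and> x \<in> P d \<and> d \<in> P d \<and> (\<forall>p\<in>P d. linked \<eta> (- P d) x p)"
    by metis
  define D where "D = (\<Union>d\<in>C. P d)"
  have fD: "finite D" using \<open>finite C\<close> P by (auto simp: D_def)
  have "x \<in> C" by (simp add: C_def)
  then have xD: "x \<in> D" using P[OF \<open>x \<in> C\<close>] unfolding D_def by blast
  have CD: "C \<subseteq> D" using P unfolding D_def by blast
  have xp: "linked \<eta> (- D) x p" if p: "p \<in> D" for p
  proof -
    obtain d where d: "d \<in> C" "p \<in> P d" using p unfolding D_def by blast
    then have "linked \<eta> (- P d) x p" using P by blast
    then show ?thesis by (rule linked_mono) (use d in \<open>auto simp: D_def\<close>)
  qed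
  have conn: "linked \<eta> (- D) p q" if "p \<in> D" "q \<in> D" for p q
    using linked_trans[OF linked_sym[OF xp[OF that(1)]] xp[OF that(2)]] .
  \<comment> \<open>Within the cluster of \<open>x\<close> the set \<open>D\<close> contains all of
    \<open>D0\<close>, so branches separated by \<open>D0\<close> remain separated by
    \<open>D\<close>.\<close>
  have inside: "linked \<eta> D0 a b" if "linked \<eta> D a b" "linked \<eta> {} x a" for a b
  proof -
    have "linked \<eta> D0 a b \<and> linked \<eta> {} x b"
      using that(1)
    proof (induction rule: linked_induct)
      case (step b c)
      then have c: "linked \<eta> {} x c" using linked_step[of \<eta> b c "{}"] linked_trans[of \<eta> "{}" x b c] by simp
      have "b \<notin> D0" "c \<notin> D0" using step c CD by (auto simp: C_def)
      then show ?case using c step linked_step[of \<eta> b c D0] linked_trans[of \<eta> D0 a b c] by simp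
    qed (simp add: that(2))
    then show ?thesis ..
  qed
  have move: "\<exists>a'. linked \<eta> D0 a a' \<and> escapes \<eta> D a' \<and> linked \<eta> {} x a'"
    if h: "escapes \<eta> D0 a" "linked \<eta> {} x a" for a
  proof -
    obtain a' where a': "linked \<eta> D0 a a'" "escapes \<eta> (D0 \<union> D) a'"
      using escapes_remove[OF lf _ _ h(1), of "D0 \<union> D"] D0 fD by auto
    have "linked \<eta> {} a a'" by (rule linked_mono[OF a'(1)]) auto
    moreover have "escapes \<eta> D a'" by (rule escapes_mono[OF a'(2)]) auto
    ultimately show ?thesis using a'(1) h(2) linked_trans by metis
  qed
  obtain x' where x': "linked \<eta> D0 x x'" "escapes \<eta> D x'" "linked \<eta> {} x x'" using move[OF esc(1)] by auto
  obtain y' where y': "linked \<eta> D0 y y'" "escapes \<eta> D y'" "linked \<eta> {} x y'" using move[OF esc(2) same(1)] by auto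
  obtain z' where z': "linked \<eta> D0 z z'" "escapes \<eta> D z'" "linked \<eta> {} x z'" using move[OF esc(3) same(2)] by auto
  have sep': "\<not> linked \<eta> D a' b'" if "\<not> linked \<eta> D0 a b" "linked \<eta> D0 a a'" "linked \<eta> D0 b b'" "linked \<eta> {} x a'"
    for a b a' b'
    using inside[of a' b'] that linked_trans linked_sym by metis
  obtain n where n: "D \<subseteq> centred_box n" using finite_subset_box[OF fD] by blast
  have "splits_cluster \<eta> D" unfolding splits_cluster_def
  proof (rule bexI[OF _ xD], rule exI[of _ x'], rule exI[of _ y'], rule exI[of _ z'], intro conjI)
    show "\<forall>p\<in>D. \<forall>q\<in>D. linked \<eta> (- D) p q" using conn by blast
    show "\<not> linked \<eta> D x' y'" "\<not> linked \<eta> D x' z'" "\<not> linked \<eta> D y' z'"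
      using sep' sep x' y' z' by blast+
    show "linked \<eta> {} x' x" "linked \<eta> {} y' x" "linked \<eta> {} z' x" using x'(3) y'(3) z'(3) by (blast intro: linked_sym)+
  qed (use x' y' z' in auto)
  then show ?thesis using n unfolding trifurcates_in_def by blast
qed

section \<open>Volume against boundary\<close>

definition square :: "int \<Rightarrow> int \<Rightarrow> (int \<times> int) set" where
  "square a b = {a..b} \<times> {a..b}"

definition square_boundary :: "int \<Rightarrow> int \<Rightarrow> (int \<times> int) set" where
  "square_boundary a b = square a b - {a<..<b} \<times> {a<..<b}"

lemma card_square_boundary:
  assumes "a \<le> b"
  shows "finite (square_boundary a b)" "card (square_boundary a b) \<le> 4 * nat (b - a + 1)"
proof -
  have eq: "square_boundary a b = {a, b} \<times> {a..b} \<union> {a..b} \<times> {a, b}"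
    using assms by (auto simp: square_boundary_def square_def)
  show "finite (square_boundary a b)" unfolding eq by simp
  have "card {a, b} \<le> 2" by (simp add: card_insert_if)
  then have "card ({a, b} \<times> {a..b}) \<le> 2 * nat (b - a + 1)" "card ({a..b} \<times> {a, b}) \<le> 2 * nat (b - a + 1)"
    by (simp_all add: card_cartesian_product)
  then show "card (square_boundary a b) \<le> 4 * nat (b - a + 1)"
    unfolding eq using card_Un_le[of "{a, b} \<times> {a..b}" "{a..b} \<times> {a, b}"] by linarith
qed

lemma neighbours_square:
  assumes "v \<in> neighbours u"
  shows "u \<in> {a<..<b} \<times> {a<..<b} \<Longrightarrow> v \<in> square a b"
    and "u \<in> square a b \<Longrightarrow> v \<notin> square a b \<Longrightarrow> u \<in> square_boundary a b"
  using assms by (cases u; cases v; auto simp: neighbours_def square_def square_boundary_def)+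

text \<open>An infinite branch leaves the finite square, and it has a point in the square because it
  is adjacent to \<open>D\<close> in the interior. Between the two it visits the boundary without
  meeting \<open>D\<close>.\<close>

lemma reaches_boundary:
  assumes lat: "\<And>e. \<eta> e \<Longrightarrow> e \<in> square_lattice"
    and D: "D \<subseteq> {a<..<b} \<times> {a<..<b}" and esc: "escapes \<eta> D x" and d: "d \<in> D" "linked \<eta> {} x d"
  shows "\<exists>c\<in>square_boundary a b - D. linked \<eta> D x c"
proof -
  obtain u v where uv: "linked \<eta> D x u" "v \<in> D" "\<eta> {u, v}"
    using linked_first_hit[OF d(2,1) escapes_notin[OF esc]] by blast
  have "u \<in> neighbours v" using lat[OF uv(3)] doubleton_in_lattice[of v u] by (simp add: insert_commute)
  then have u: "u \<in> square a b" using neighbours_square(1)[of u v a b] uv(2) D by blast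
  have "finite (square a b)" by (simp add: square_def)
  then obtain y where y: "linked \<eta> D x y" "y \<notin> square a b"
    using esc unfolding escapes_def by (metis (full_types) finite_subset mem_Collect_eq subsetI)
  have uy: "linked \<eta> D u y" using linked_trans[OF linked_sym[OF uv(1)] y(1)] .
  have "y \<in> square a b \<or> (\<exists>c\<in>square_boundary a b. linked \<eta> D u c)"
    using uy
  proof (induction rule: linked_induct)
    case (step y z)
    have "z \<in> neighbours y" using lat[OF step(2)] doubleton_in_lattice by blast
    then show ?case using step neighbours_square(2)[of z y a b] by blast
  qed (simp add: u)
  then obtain c where c: "c \<in> square_boundary a b" "linked \<eta> D u c" using y by blast
  moreover have "c \<notin> D" using c(1) D by (auto simp: square_boundary_def)
  ultimately show ?thesis using linked_trans[OF uv(1) c(2)] by blast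
qed

lemma count_tiles:
  assumes lat: "\<And>e. \<eta> e \<Longrightarrow> e \<in> square_lattice" and "finite I"
    and disj: "disjoint_family_on T I" and T: "\<And>i. i \<in> I \<Longrightarrow> T i \<subseteq> {a<..<b} \<times> {a<..<b}"
    and tri: "\<And>i. i \<in> I \<Longrightarrow> trifurcates_in \<eta> (T i)" and ab: "a \<le> b"
  shows "card I \<le> 4 * nat (b - a + 1)"
proof -
  have "\<forall>i\<in>I. \<exists>D. D \<subseteq> T i \<and> splits_cluster \<eta> D"
    using tri unfolding trifurcates_in_def by blast
  then obtain D where D: "\<And>i. i \<in> I \<Longrightarrow> D i \<subseteq> T i" "\<And>i. i \<in> I \<Longrightarrow> splits_cluster \<eta> (D i)"
    by metis
  have "card I \<le> card (square_boundary a b)"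
  proof (rule trifurcation_count[of I _ D \<eta>])
    show "finite I" by fact
    show "finite (square_boundary a b)" using card_square_boundary ab by blast
    show "disjoint_family_on D I" using disj D(1) unfolding disjoint_family_on_def by blast
    show "linked \<eta> (- D i) x y" if "i \<in> I" "x \<in> D i" "y \<in> D i" for i x y using D(2)[OF that(1)] that(2,3) unfolding splits_cluster_def by blast
    fix i assume i: "i \<in> I"
    have sub: "D i \<subseteq> {a<..<b} \<times> {a<..<b}" using D(1)[OF i] T[OF i] by blast
    obtain d x y z where d: "d \<in> D i" and esc: "escapes \<eta> (D i) x" "escapes \<eta> (D i) y" "escapes \<eta> (D i) z"
      and sep: "\<not> linked \<eta> (D i) x y" "\<not> linked \<eta> (D i) x z" "\<not> linked \<eta> (D i) y z"
      and ld: "linked \<eta> {} x d" "linked \<eta> {} y d" "linked \<eta> {} z d"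
      using D(2)[OF i] unfolding splits_cluster_def by blast
    have ex: "\<exists>c. c \<in> square_boundary a b - D i \<and> linked \<eta> (D i) x c \<and> linked \<eta> {} c d"
      if esc: "escapes \<eta> (D i) x" and ld: "linked \<eta> {} x d" for x
    proof -
      obtain c where c: "c \<in> square_boundary a b - D i" "linked \<eta> (D i) x c"
        using reaches_boundary[OF lat sub esc d ld] by blast
      have "linked \<eta> {} c x" by (rule linked_mono[OF linked_sym[OF c(2)]]) auto
      then show ?thesis using c ld linked_trans by metis
    qed
    obtain x' where x': "x' \<in> square_boundary a b - D i" "linked \<eta> (D i) x x'" "linked \<eta> {} x' d"
      using ex[OF esc(1) ld(1)] by blast
    obtain y' where y': "y' \<in> square_boundary a b - D i" "linked \<eta> (D i) y y'" "linked \<eta> {} y' d"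
      using ex[OF esc(2) ld(2)] by blast
    obtain z' where z': "z' \<in> square_boundary a b - D i" "linked \<eta> (D i) z z'" "linked \<eta> {} z' d"
      using ex[OF esc(3) ld(3)] by blast
    have "\<not> linked \<eta> (D i) x' y'" "\<not> linked \<eta> (D i) x' z'" "\<not> linked \<eta> (D i) y' z'"
      using sep x'(2) y'(2) z'(2) linked_trans linked_sym by metis+
    then show "\<exists>a' b' c d. a' \<in> square_boundary a b - D i \<and> b' \<in> square_boundary a b - D i \<and>
        c \<in> square_boundary a b - D i \<and> d \<in> D i \<and> linked \<eta> {} a' d \<and> linked \<eta> {} b' d \<and> linked \<eta> {} c d \<and>
        \<not> linked \<eta> (D i) a' b' \<and> \<not> linked \<eta> (D i) a' c \<and> \<not> linked \<eta> (D i) b' c"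
      using x'(1,3) y'(1,3) z'(1,3) d by blast
  qed
  then show ?thesis using card_square_boundary(2)[OF ab] by simp
qed

lemma trifurcates_in_shift:
  assumes "trifurcates_in (\<lambda>e. \<eta> (shift_edge z e)) S"
  shows "trifurcates_in \<eta> ((\<lambda>v. v + z) ` S)"
proof -
  let ?s = "\<lambda>v. v + z"
  obtain D d x y w where D: "D \<subseteq> S" "d \<in> D" "\<forall>p\<in>D. \<forall>q\<in>D. linked (\<lambda>e. \<eta> (shift_edge z e)) (- D) p q"
    and r: "escapes (\<lambda>e. \<eta> (shift_edge z e)) D x" "escapes (\<lambda>e. \<eta> (shift_edge z e)) D y"
      "escapes (\<lambda>e. \<eta> (shift_edge z e)) D w"
      "\<not> linked (\<lambda>e. \<eta> (shift_edge z e)) D x y" "\<not> linked (\<lambda>e. \<eta> (shift_edge z e)) D x w"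
      "\<not> linked (\<lambda>e. \<eta> (shift_edge z e)) D y w"
      "linked (\<lambda>e. \<eta> (shift_edge z e)) {} x d" "linked (\<lambda>e. \<eta> (shift_edge z e)) {} y d"
      "linked (\<lambda>e. \<eta> (shift_edge z e)) {} w d"
    using assms unfolding trifurcates_in_def splits_cluster_def by blast
  have "bij ?s" by (rule bij_betw_byWitness[of _ "\<lambda>v. v - z"]) auto
  then have "?s ` (- D) = - (?s ` D)" by (rule bij_image_Compl_eq)
  then have "\<forall>p\<in>?s ` D. \<forall>q\<in>?s ` D. linked \<eta> (- (?s ` D)) p q"
    using D(3) by (auto simp: linked_shift)
  then show ?thesis unfolding trifurcates_in_def splits_cluster_def
    using D(1,2) r unfolding linked_shift escapes_shift image_empty
    by (intro bexI[of _ "?s ` D"] bexI[of _ "d + z"] exI[of _ "x + z"] exI[of _ "y + z"] exI[of _ "w + z"]) auto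
qed

lemma pred_trifurcates_in:
  assumes "finite S"
  shows "Measurable.pred clocks (\<lambda>U. trifurcates_in (open_at t U) S)"
proof -
  note [measurable] = pred_linked[OF pred_open_at] pred_escapes[OF pred_open_at]
  have "Measurable.pred clocks (\<lambda>U. \<forall>p\<in>D. \<forall>q\<in>D. linked (open_at t U) (- D) p q)" if "finite D" for D
    using that by (intro pred_intros_finite(3)) measurable
  then have [measurable]: "D \<in> Pow S \<Longrightarrow> Measurable.pred clocks (\<lambda>U. \<forall>p\<in>D. \<forall>q\<in>D. linked (open_at t U) (- D) p q)" for D
    using assms by (auto dest: finite_subset)
  have "Measurable.pred clocks (\<lambda>U. \<exists>x y z. (\<forall>p\<in>D. \<forall>q\<in>D. linked (open_at t U) (- D) p q) \<and>
     escapes (open_at t U) D x \<and> escapes (open_at t U) D y \<and> escapes (open_at t U) D z \<and>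
     \<not> linked (open_at t U) D x y \<and> \<not> linked (open_at t U) D x z \<and> \<not> linked (open_at t U) D y z \<and>
     linked (open_at t U) {} x d \<and> linked (open_at t U) {} y d \<and> linked (open_at t U) {} z d)"
    if [measurable]: "D \<in> Pow S" for D d
    by measurable
  then show ?thesis unfolding trifurcates_in_def splits_cluster_def using assms
    by (intro pred_intros_finite(4)) (auto dest: finite_subset)
qed

lemma sum_prob_le:
  assumes "prob_space M" "finite K" "\<And>i. i \<in> K \<Longrightarrow> A i \<in> sets M"
    and c: "\<And>x. x \<in> space M \<Longrightarrow> real (card {i \<in> K. x \<in> A i}) \<le> c"
  shows "(\<Sum>i\<in>K. measure M (A i)) \<le> c"
proof -
  interpret prob_space M by fact
  have int: "integrable M (indicator (A i) :: _ \<Rightarrow> real)" if "i \<in> K" for i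
    using assms(3)[OF that] by (simp add: emeasure_eq_measure)
  have "(\<Sum>i\<in>K. measure M (A i)) = (\<Sum>i\<in>K. expectation (indicator (A i)))"
    using assms(3) by (intro sum.cong refl) (simp add: Int_absorb2 sets.sets_into_space)
  also have "\<dots> = expectation (\<lambda>x. \<Sum>i\<in>K. indicator (A i) x)"
    by (rule Bochner_Integration.integral_sum[symmetric]) (rule int)
  also have "\<dots> \<le> expectation (\<lambda>_. c)"
  proof (rule integral_mono)
    show "integrable M (\<lambda>x. \<Sum>i\<in>K. indicator (A i) x :: real)" using int by (rule Bochner_Integration.integrable_sum)
    show "(\<Sum>i\<in>K. indicator (A i) x) \<le> c" if "x \<in> space M" for x
    proof -
      have "(\<Sum>i\<in>K. indicator (A i) x :: real) = (\<Sum>i\<in>{i \<in> K. x \<in> A i}. 1)"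
        using assms(2) by (intro sum.mono_neutral_cong_right) (auto simp: indicator_def)
      then show ?thesis using c[OF that] by simp
    qed
  qed simp
  also have "\<dots> = c" by (simp add: prob_space)
  finally show ?thesis .
qed

text \<open>By stationarity the expected number of trifurcating boxes among \<open>k * k\<close>
  disjoint translates is at least \<open>k * k * p\<close>, whereas the count is bounded by the
  boundary of a square, of order \<open>k\<close>.\<close>

lemma prob_trifurcates_in_box:
  "measure clocks {U \<in> space clocks. trifurcates_in (open_at t U) (centred_box n)} = 0" (is "?p = 0")
proof (rule ccontr)
  assume "?p \<noteq> 0"
  define p where "p = ?p"
  then have p: "p > 0" using \<open>?p \<noteq> 0\<close> by (simp add: zero_less_measure_iff)
  \<comment> \<open>The number of points on a side of the box, so that translates by distinct
    multiples of \<open>L\<close> are disjoint.\<close>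
  define L where "L = 2 * int n + 1"
  define T where "T = (\<lambda>(i, j). (\<lambda>v. v + (L * int i, L * int j)) ` centred_box n)"
  define A where "A = (\<lambda>i. {U \<in> space clocks. trifurcates_in (open_at t U) (T i)})"
  have fb: "finite (centred_box n)" by (simp add: centred_box_def)
  have sA: "A i \<in> sets clocks" for i
    unfolding A_def using pred_trifurcates_in[of "T i"] fb by (cases i) (simp add: T_def)
  have A: "p \<le> measure clocks (A (i, j))" for i j
  proof -
    let ?z = "(L * int i, L * int j)"
    let ?A = "{U \<in> space clocks. trifurcates_in (open_at t U) (centred_box n)}"
    have s: "?A \<in> sets clocks" using pred_trifurcates_in[OF fb] by simp
    have "p = measure clocks (shift_clocks ?z -` ?A \<inter> space clocks)"
      using measure_distr[OF measurable_shift s, of ?z] distr_shift[of ?z] by (simp add: p_def)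
    also have "\<dots> \<le> measure clocks (A (i, j))"
    proof (rule clocks.finite_measure_mono[OF _ sA])
      show "shift_clocks ?z -` ?A \<inter> space clocks \<subseteq> A (i, j)"
        using trifurcates_in_shift[of _ ?z "centred_box n"] by (auto simp: A_def T_def open_at_shift)
    qed
    finally show ?thesis .
  qed
  have bound: "real k * p \<le> 4 * (3 * real_of_int L)" if k: "k > 0" for k :: nat
  proof -
    let ?K = "{..<k} \<times> {..<k}"
    \<comment> \<open>All tiles lie strictly inside: their coordinates run from \<open>- n\<close>
      to \<open>L * k - n - 1\<close>.\<close>
    let ?a = "- int n - 1" and ?b = "L * int k"
    have kL: "L * int i + int n < L * int k" if "i < k" for i
    proof -
      have "L * (int i + 1) \<le> L * int k" using that by (intro mult_left_mono) (auto simp: L_def)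
      then show ?thesis by (simp add: L_def algebra_simps)
    qed
    have L0: "0 \<le> L * int i" for i by (simp add: L_def)
    have "(\<Sum>i\<in>?K. measure clocks (A i)) \<le> real (4 * nat (?b - ?a + 1))"
    proof (rule sum_prob_le[OF clocks.prob_space_axioms])
      show "finite ?K" by simp
      show "A i \<in> sets clocks" for i by (rule sA)
      fix U assume "U \<in> space clocks"
      have "card {i \<in> ?K. U \<in> A i} \<le> 4 * nat (?b - ?a + 1)"
      proof (rule count_tiles[of "open_at t U" _ T])
        show "e \<in> square_lattice" if "open_at t U e" for e using that by (rule open_at_in_lattice)
        show "finite {i \<in> ?K. U \<in> A i}" by simp
        show "?a \<le> ?b" using L0[of k] by simp
        show "T i \<subseteq> {?a<..<?b} \<times> {?a<..<?b}" if i: "i \<in> {i \<in> ?K. U \<in> A i}" for i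
        proof -
          obtain j l where jl: "i = (j, l)" "j < k" "l < k" using i by auto
          show ?thesis using kL[OF jl(2)] kL[OF jl(3)] L0[of j] L0[of l]
            by (auto simp: T_def jl(1) centred_box_def)
        qed
        show "trifurcates_in (open_at t U) (T i)" if "i \<in> {i \<in> ?K. U \<in> A i}" for i
          using that by (auto simp: A_def)
        have far: "x = y" if "\<bar>L * int x - L * int y\<bar> \<le> 2 * int n" for x y
        proof (rule ccontr)
          assume "x \<noteq> y"
          then have "\<bar>int x - int y\<bar> \<ge> 1" by simp
          then have "L * \<bar>int x - int y\<bar> \<ge> L * 1" by (intro mult_left_mono) (auto simp: L_def)
          moreover have "L * \<bar>int x - int y\<bar> = \<bar>L * int x - L * int y\<bar>"
            by (simp add: abs_mult right_diff_distrib[symmetric] L_def)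
          ultimately have "L \<le> 2 * int n" using that by simp
          then show False by (simp add: L_def)
        qed
        show "disjoint_family_on T {i \<in> ?K. U \<in> A i}"
          unfolding disjoint_family_on_def
        proof (intro ballI impI, rule ccontr)
          fix i i' assume ii: "i \<noteq> i'" and "T i \<inter> T i' \<noteq> {}"
          then obtain q where q: "q \<in> T i" "q \<in> T i'" by blast
          obtain v where v: "v \<in> centred_box n" "q = v + (L * int (fst i), L * int (snd i))"
            using q(1) unfolding T_def split_beta by blast
          obtain w where w: "w \<in> centred_box n" "q = w + (L * int (fst i'), L * int (snd i'))"
            using q(2) unfolding T_def split_beta by blast
          have vw: "v \<in> centred_box n" "w \<in> centred_box n"
            "v + (L * int (fst i), L * int (snd i)) = w + (L * int (fst i'), L * int (snd i'))"
            using v w by simp_all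
          then have "\<bar>L * int (fst i) - L * int (fst i')\<bar> \<le> 2 * int n"
            "\<bar>L * int (snd i) - L * int (snd i')\<bar> \<le> 2 * int n"
            by (cases v; cases w; auto simp: centred_box_def)+
          then show False using far ii by (metis prod_eqI)
        qed
      qed
      then show "real (card {i \<in> ?K. U \<in> A i}) \<le> real (4 * nat (?b - ?a + 1))" by (simp only: of_nat_le_iff)
    qed
    moreover have "(\<Sum>i\<in>?K. p) \<le> (\<Sum>i\<in>?K. measure clocks (A i))" using A by (intro sum_mono) auto
    moreover have "real (4 * nat (?b - ?a + 1)) \<le> 4 * (3 * real_of_int L) * real k"
    proof -
      \<comment> \<open>The side has \<open>L * k + n + 2\<close> points, which is absorbed into
        \<open>3 * L * k\<close>.\<close>
      have "int n + 2 \<le> 2 * L * 1" by (simp add: L_def)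
      also have "\<dots> \<le> 2 * L * int k" using k by (intro mult_left_mono) (auto simp: L_def)
      finally have le: "?b - ?a + 1 \<le> 3 * L * int k" by simp
      have "0 \<le> ?b - ?a + 1" using L0[of k] by simp
      then have "real (4 * nat (?b - ?a + 1)) = 4 * real_of_int (?b - ?a + 1)"
        by (simp only: of_nat_mult of_nat_numeral of_nat_nat)
      also have "\<dots> \<le> 4 * real_of_int (3 * L * int k)"
        by (intro mult_left_mono of_int_le_iff[THEN iffD2] le) simp
      finally show ?thesis by simp
    qed
    ultimately have "real k * real k * p \<le> 4 * (3 * real_of_int L) * real k" by simp
    then have "real k * (real k * p) \<le> real k * (4 * (3 * real_of_int L))"
      by (simp add: ac_simps)
    then show ?thesis using k by (simp only: mult_le_cancel_left_pos of_nat_0_less_iff)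
  qed
  obtain k :: nat where "4 * (3 * real_of_int L) < real k * p"
    using reals_Archimedean3[OF p] by blast
  moreover from this have "k > 0" by (cases k) (auto simp: L_def)
  ultimately show False using bound[of k] by linarith
qed

lemma finite_open_neighbours: "finite {y. open_at t U {x, y}}"
proof -
  have "{y. open_at t U {x, y}} \<subseteq> neighbours x" using open_at_in_lattice doubleton_in_lattice by blast
  then show ?thesis using card_neighbours(1) finite_subset by blast
qed

lemma AE_not_trifurcates: "AE U in clocks. \<not> trifurcates (open_at t U)"
proof -
  have "AE U in clocks. \<not> trifurcates_in (open_at t U) (centred_box n)" for n
  proof -
    have "{U \<in> space clocks. trifurcates_in (open_at t U) (centred_box n)} \<in> null_sets clocks"
      using prob_trifurcates_in_box[of t n] pred_trifurcates_in[of "centred_box n" t]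
      by (auto simp: null_sets_def clocks.emeasure_eq_measure centred_box_def)
    from AE_not_in[OF this] show ?thesis using AE_space by eventually_elim auto
  qed
  then have "AE U in clocks. \<forall>n. \<not> trifurcates_in (open_at t U) (centred_box n)" by (simp add: AE_all_countable)
  then show ?thesis
    by (rule eventually_mono) (use trifurcates_in_box[OF finite_open_neighbours] in blast)
qed

section \<open>Merging clusters\<close>

lemma card_edges_at:
  "card {f \<in> square_lattice. u \<in> f \<and> P f} = card {v. {u, v} \<in> square_lattice \<and> P {u, v}}"
proof -
  have "bij_betw (\<lambda>v. {u, v}) {v. {u, v} \<in> square_lattice \<and> P {u, v}} {f \<in> square_lattice. u \<in> f \<and> P f}"
    unfolding bij_betw_def
  proof
    show "inj_on (\<lambda>v. {u, v}) {v. {u, v} \<in> square_lattice \<and> P {u, v}}"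
      by (rule inj_onI) (simp only: doubleton_eq_iff, blast)
    show "(\<lambda>v. {u, v}) ` {v. {u, v} \<in> square_lattice \<and> P {u, v}} = {f \<in> square_lattice. u \<in> f \<and> P f}"
    proof (intro equalityI subsetI)
      fix f assume f: "f \<in> {f \<in> square_lattice. u \<in> f \<and> P f}"
      then obtain v where "f = {u, v}" by (blast elim: edge_at)
      then show "f \<in> (\<lambda>v. {u, v}) ` {v. {u, v} \<in> square_lattice \<and> P {u, v}}" using f by blast
    qed blast
  qed
  from bij_betw_same_card[OF this] show ?thesis by (rule sym)
qed

text \<open>Were there no such configuration, every outcome of the local surgery at
  \<open>{v, w}\<close> would satisfy \<open>Z\<close>, and the clocks would belong to an iterated
  redrawing of \<open>Z\<close>, which is null. This null event does not mention \<open>v\<close>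
  and \<open>w\<close>, hence it serves all pairs at once.\<close>

lemma AE_join:
  assumes t: "0 < t" "t \<le> 1" and Z: "AE U in clocks. \<not> Z (open_at t U)"
  shows "AE U in clocks. \<forall>v w. w \<in> neighbours v \<longrightarrow> \<not> linked (open_at t U) {} v w \<longrightarrow>
    (\<exists>\<eta>. joins (open_at t U) v w \<eta> \<and> (\<forall>e. \<eta> e \<longrightarrow> e \<in> square_lattice) \<and> \<not> Z \<eta>)"
  using AE_wf_earlier AE_inj_clocks AE_not_trifurcates[of t] AE_not_resample_pow[OF Z]
proof eventually_elim
  case (elim U)
  define \<eta> where "\<eta> = open_at t U"
  have lat: "e \<in> square_lattice" if "\<eta> e" for e using that open_at_in_lattice unfolding \<eta>_def by blast
  have lf: "finite {y. \<eta> {x, y}}" for x unfolding \<eta>_def by (rule finite_open_neighbours)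
  have loop: "\<not> \<eta> {x}" for x using lat[of "{x}"] by (blast elim: lattice_edgeE)
  have deg: "card {y. \<eta> {x, y}} \<le> 3" for x
  proof -
    have "{v. {x, v} \<in> square_lattice \<and> \<eta> {x, v}} = {y. \<eta> {x, y}}" using lat by blast
    then show ?thesis using open_degree_le_3[OF elim(1,2), of x t] card_edges_at[of x \<eta>] by (simp add: \<eta>_def)
  qed
  have nt: "\<not> trifurcates \<eta>" using elim(3) by (simp add: \<eta>_def)
  show ?case unfolding \<eta>_def[symmetric]
  proof (intro allI impI, rule ccontr)
    fix v w assume w: "w \<in> neighbours v" "\<not> linked \<eta> {} v w"
      and neg: "\<nexists>\<eta>'. joins \<eta> v w \<eta>' \<and> (\<forall>e. \<eta>' e \<longrightarrow> e \<in> square_lattice) \<and> \<not> Z \<eta>'"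
    obtain Qv where Qv: "finite Qv" "\<forall>e\<in>Qv. \<eta> e \<and> (\<exists>n. e = {v, n})" "card {y. \<eta> {v, y} \<and> {v, y} \<notin> Qv} \<le> 2"
      "finite ({y. linked \<eta> {} v y} - {y. linked (\<lambda>e. \<eta> e \<and> e \<notin> Qv) {} v y})"
      using droppable_edge[of \<eta> v, OF lf loop nt deg] by blast
    obtain Qw where Qw: "finite Qw" "\<forall>e\<in>Qw. \<eta> e \<and> (\<exists>n. e = {w, n})" "card {y. \<eta> {w, y} \<and> {w, y} \<notin> Qw} \<le> 2"
      "finite ({y. linked \<eta> {} w y} - {y. linked (\<lambda>e. \<eta> e \<and> e \<notin> Qw) {} w y})"
      using droppable_edge[of \<eta> w, OF lf loop nt deg] by blast
    define Q where "Q = Qv \<union> Qw"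
    have vw: "{v, w} \<in> square_lattice" using w(1) doubleton_in_lattice by blast
    \<comment> \<open>Each endpoint is relieved by its own part of \<open>Q\<close>; the other
      deletions can only lower the count further.\<close>
    have d2: "card {f \<in> square_lattice. u \<in> f \<and> open_at t U f \<and> f \<notin> Q} \<le> 2" if u: "u \<in> {v, w}" for u
    proof -
      obtain Q' where Q': "Q' \<subseteq> Q" "card {y. \<eta> {u, y} \<and> {u, y} \<notin> Q'} \<le> 2"
        using u Qv(3) Qw(3) unfolding Q_def by blast
      have "card {y. {u, y} \<in> square_lattice \<and> \<eta> {u, y} \<and> {u, y} \<notin> Q} \<le> card {y. \<eta> {u, y} \<and> {u, y} \<notin> Q'}"
        using Q'(1) by (intro card_mono finite_subset[OF _ lf[of u]]) auto
      then show ?thesis using Q'(2) card_edges_at[of u "\<lambda>f. \<eta> f \<and> f \<notin> Q"] by (simp add: \<eta>_def)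
    qed
    have "\<exists>n. (resample ^^ n) (\<lambda>U. Z (open_at t U)) U"
    proof (rule local_surgery[OF elim(1) t, of "\<Union>Q \<union> {v, w}" Q "{v, w}"])
      show "finite (\<Union>Q \<union> {v, w})" using Qv(1,2) Qw(1,2) lat finite_edge unfolding Q_def by blast
      show "finite Q" using Qv(1) Qw(1) by (simp add: Q_def)
      show "q \<in> square_lattice \<and> q \<subseteq> \<Union>Q \<union> {v, w}" if "q \<in> Q" for q
        using that Qv(2) Qw(2) lat unfolding Q_def by blast
      show "{v, w} \<in> square_lattice" by fact
      show "{v, w} \<subseteq> \<Union>Q \<union> {v, w}" by blast
      show "\<not> open_at t U {v, w}" using w(2) linked_step[of \<eta> v w "{}"] by (auto simp: \<eta>_def)
      show "card {f \<in> square_lattice. u \<in> f \<and> open_at t U f \<and> f \<notin> Q} \<le> 2" if "u \<in> {v, w}" for u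
        using that by (rule d2)
      fix U' assume U': "\<And>f. open_at t U f \<Longrightarrow> f \<notin> Q \<Longrightarrow> open_at t U' f" "open_at t U' {v, w}"
        "finite {f. open_at t U f \<noteq> open_at t U' f}"
      have "joins \<eta> v w (open_at t U')"
      proof (rule joins_intro[OF w(2) Qv(2) Qw(2) Qv(4) Qw(4)])
        show "open_at t U' e" if "\<eta> e" "e \<notin> Qv" "e \<notin> Qw" for e using U'(1)[of e] that by (simp add: \<eta>_def Q_def)
        show "open_at t U' {v, w}" by fact
        show "finite {e. \<eta> e \<noteq> open_at t U' e}" using U'(3) by (simp add: \<eta>_def)
      qed
      then show "Z (open_at t U')" using neg open_at_in_lattice by blast
    qed
    then show False using elim(4) by blast
  qed
qed

text \<open>Three ends can merge into a trifurcation. Two suffice if every infinite cluster contains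
  one of them, since their merging leaves a unique infinite cluster; the covering condition carries
  this property through all modifications.\<close>

definition end_system :: "('v set \<Rightarrow> bool) \<Rightarrow> 'v set \<Rightarrow> 'v set \<Rightarrow> bool" where
  "end_system \<eta> D Y \<longleftrightarrow> finite D \<and> (\<forall>y\<in>Y. escapes \<eta> D y) \<and>
     (\<forall>y\<in>Y. \<forall>y'\<in>Y. linked \<eta> D y y' \<longrightarrow> y = y') \<and>
     (card Y = 3 \<or> card Y = 2 \<and> (\<forall>x. escapes \<eta> {} x \<longrightarrow> (\<exists>y\<in>Y. linked \<eta> {} x y)))"

definition unlinked_pairs :: "('v set \<Rightarrow> bool) \<Rightarrow> 'v set \<Rightarrow> ('v \<times> 'v) set" where
  "unlinked_pairs \<eta> Y = {(y, y'). y \<in> Y \<and> y' \<in> Y \<and> \<not> linked \<eta> {} y y'}"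

definition unique_infinite :: "('v set \<Rightarrow> bool) \<Rightarrow> bool" where
  "unique_infinite \<eta> \<longleftrightarrow> (\<exists>x. escapes \<eta> {} x) \<and>
     (\<forall>x y. escapes \<eta> {} x \<longrightarrow> escapes \<eta> {} y \<longrightarrow> linked \<eta> {} x y)"

text \<open>Deleting also the vertices of all changed edges makes the two configurations agree
  outside \<open>D'\<close>, and \<open>h\<close> moves every end past this finite set. An end in
  the cluster of \<open>v\<close> or \<open>w\<close> is infinite, so the finite losses cannot
  detach it from the merged cluster.\<close>

lemma end_system_joins:
  assumes lf: "\<And>x. finite {y. \<eta> {x, y}}" and lf': "\<And>x. finite {y. \<eta>' {x, y}}"
    and fe: "\<And>e. \<eta> e \<or> \<eta>' e \<Longrightarrow> finite e \<and> e \<noteq> {}"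
    and j: "joins \<eta> v w \<eta>'" and Y: "end_system \<eta> D Y"
  obtains D' h where "end_system \<eta>' D' (h ` Y)" "inj_on h Y"
    "\<And>y y'. y \<in> Y \<Longrightarrow> y' \<in> Y \<Longrightarrow> linked \<eta> {} y y' \<Longrightarrow> linked \<eta>' {} (h y) (h y')"
    "\<And>y. y \<in> Y \<Longrightarrow> linked \<eta> {} v y \<or> linked \<eta> {} w y \<Longrightarrow> linked \<eta>' {} v (h y)"
    "\<And>y x. y \<in> Y \<Longrightarrow> \<not> linked \<eta> {} v y \<Longrightarrow> \<not> linked \<eta> {} w y \<Longrightarrow> linked \<eta> {} y x \<Longrightarrow> linked \<eta>' {} (h y) x"
proof -
  define \<Delta> where "\<Delta> = {e. \<eta> e \<noteq> \<eta>' e}"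
  define D' where "D' = D \<union> \<Union>\<Delta>"
  have "finite \<Delta>" using j by (simp add: joins_def \<Delta>_def)
  moreover have "finite e" if "e \<in> \<Delta>" for e using that fe[of e] by (auto simp: \<Delta>_def)
  ultimately have fD': "finite D'" using Y by (auto simp: D'_def end_system_def)
  have same: "\<eta> e \<longleftrightarrow> \<eta>' e" if "e \<inter> D' = {}" for e
  proof (rule ccontr)
    assume "\<not> ?thesis"
    then have "e \<in> \<Delta>" "e \<noteq> {}" using fe[of e] by (auto simp: \<Delta>_def)
    then show False using that by (auto simp: D'_def)
  qed
  have eq: "linked \<eta> D' x y \<longleftrightarrow> linked \<eta>' D' x y" for x y
    using linked_change[of \<eta> D' x y \<eta>'] linked_change[of \<eta>' D' x y \<eta>] same by blast
  then have esc_eq: "escapes \<eta> D' x \<longleftrightarrow> escapes \<eta>' D' x" for x by (simp add: escapes_def)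
  have "\<forall>y\<in>Y. \<exists>y'. linked \<eta> D y y' \<and> escapes \<eta> D' y'"
    using escapes_remove[OF lf fD'] Y by (auto simp: end_system_def D'_def)
  then obtain h where h: "\<And>y. y \<in> Y \<Longrightarrow> linked \<eta> D y (h y)" "\<And>y. y \<in> Y \<Longrightarrow> escapes \<eta> D' (h y)"
    by metis
  have h0: "linked \<eta> {} y (h y)" if "y \<in> Y" for y by (rule linked_mono[OF h(1)[OF that]]) auto
  \<comment> \<open>The branch \<open>K\<close> is infinite and the same for both configurations,
    whereas only finitely many of its points may fail to be linked to \<open>v\<close>; one that is
    linked carries all of \<open>K\<close> along.\<close>
  have merge: "linked \<eta>' {} v x" if x: "escapes \<eta> D' x" "linked \<eta> {} v x \<or> linked \<eta> {} w x" for x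
  proof -
    define K where "K = {z. linked \<eta>' D' x z}"
    have "infinite K" using x(1) esc_eq by (simp add: K_def escapes_def)
    obtain u where u: "u = v \<or> u = w" "linked \<eta> {} u x" using x(2) by blast
    have "finite ({y. linked \<eta> {} u y} - {y. linked \<eta>' {} v y})" using j u(1) unfolding joins_def by blast
    then have "\<not> K \<subseteq> {y. linked \<eta> {} u y} - {y. linked \<eta>' {} v y}"
      using \<open>infinite K\<close> finite_subset by blast
    moreover have "K \<subseteq> {y. linked \<eta> {} u y}"
    proof
      fix z assume "z \<in> K"
      then have "linked \<eta> D' x z" using eq by (simp add: K_def)
      then have "linked \<eta> {} x z" by (rule linked_mono) auto
      then show "z \<in> {y. linked \<eta> {} u y}" using linked_trans[OF u(2)] by blast
    qed
    ultimately obtain z where z: "z \<in> K" "linked \<eta>' {} v z" by blast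
    have "linked \<eta>' {} x z" by (rule linked_mono[of \<eta>' D']) (use z(1) in \<open>auto simp: K_def\<close>)
    then show ?thesis using linked_trans[OF z(2) linked_sym] by blast
  qed
  have apart: "linked \<eta>' {} x y"
    if "\<not> linked \<eta> {} v x" "\<not> linked \<eta> {} w x" "linked \<eta> {} x y" for x y
    using j that unfolding joins_def by blast
  have keep: "linked \<eta>' {} x y" if "escapes \<eta> D' x" "escapes \<eta> D' y" "linked \<eta> {} x y" for x y
  proof (cases "linked \<eta> {} v x \<or> linked \<eta> {} w x")
    case True
    then have "linked \<eta> {} v y \<or> linked \<eta> {} w y" using that(3) linked_trans by metis
    then show ?thesis using merge[OF that(1) True] merge[OF that(2)] linked_trans linked_sym by metis
  qed (use apart that in blast)
  have pull: "linked \<eta> D y y'" if "y \<in> Y" "y' \<in> Y" "linked \<eta> D' (h y) (h y')" for y y'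
  proof -
    have "linked \<eta> D (h y) (h y')" by (rule linked_mono[OF that(3)]) (auto simp: D'_def)
    then show ?thesis using h(1)[OF that(1)] h(1)[OF that(2)] linked_trans linked_sym by metis
  qed
  have sep: "y = y'" if "y \<in> Y" "y' \<in> Y" "linked \<eta> D' (h y) (h y')" for y y'
    using pull[OF that] Y that(1,2) unfolding end_system_def by blast
  have inj: "inj_on h Y" using sep by (auto intro!: inj_onI)
  show thesis
  proof (rule that[of D' h])
    show "inj_on h Y" by fact
    show "end_system \<eta>' D' (h ` Y)" unfolding end_system_def
    proof (intro conjI)
      show "finite D'" by fact
      show "\<forall>y\<in>h ` Y. escapes \<eta>' D' y" using h(2) esc_eq by blast
      show "\<forall>y\<in>h ` Y. \<forall>y'\<in>h ` Y. linked \<eta>' D' y y' \<longrightarrow> y = y'" using sep eq by blast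
      \<comment> \<open>An infinite cluster of the new configuration has a branch beyond
        \<open>D'\<close>. This is an old branch as well, so it belongs to an old infinite cluster,
        which contains a member of \<open>Y\<close>.\<close>
      have cover: "\<exists>y\<in>h ` Y. linked \<eta>' {} x y"
        if old: "\<forall>x. escapes \<eta> {} x \<longrightarrow> (\<exists>y\<in>Y. linked \<eta> {} x y)" and x: "escapes \<eta>' {} x" for x
      proof -
        obtain x' where x': "linked \<eta>' {} x x'" "escapes \<eta>' D' x'"
          using escapes_remove[OF lf' fD' _ x] by blast
        then have e: "escapes \<eta> D' x'" using esc_eq by blast
        then have "escapes \<eta> {} x'" by (rule escapes_mono) auto
        then obtain y where y: "y \<in> Y" "linked \<eta> {} x' y" using old by blast
        have "linked \<eta>' {} x' (h y)" using keep[OF e h(2)[OF y(1)]] linked_trans[OF y(2) h0[OF y(1)]] by blast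
        then have "linked \<eta>' {} x (h y)" using linked_trans[OF x'(1)] by blast
        then show ?thesis using y(1) by blast
      qed
      show "card (h ` Y) = 3 \<or> card (h ` Y) = 2 \<and> (\<forall>x. escapes \<eta>' {} x \<longrightarrow> (\<exists>y\<in>h ` Y. linked \<eta>' {} x y))"
      proof -
        consider "card Y = 3" | "card Y = 2" "\<forall>x. escapes \<eta> {} x \<longrightarrow> (\<exists>y\<in>Y. linked \<eta> {} x y)"
          using Y unfolding end_system_def by blast
        then show ?thesis
        proof cases
          case 1
          then show ?thesis by (simp add: card_image[OF inj])
        next
          case 2
          then show ?thesis using cover[OF 2(2)] by (simp add: card_image[OF inj])
        qed
      qed
    qed
    show "linked \<eta>' {} (h y) (h y')" if "y \<in> Y" "y' \<in> Y" "linked \<eta> {} y y'" for y y'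
      using keep[OF h(2)[OF that(1)] h(2)[OF that(2)]] h0[OF that(1)] h0[OF that(2)] that(3)
        linked_trans linked_sym by metis
    show "linked \<eta>' {} v (h y)" if "y \<in> Y" "linked \<eta> {} v y \<or> linked \<eta> {} w y" for y
      using merge[OF h(2)[OF that(1)]] h0[OF that(1)] that(2) linked_trans by metis
    show "linked \<eta>' {} (h y) x" if "y \<in> Y" "\<not> linked \<eta> {} v y" "\<not> linked \<eta> {} w y" "linked \<eta> {} y x" for y x
      using apart[OF that(2,3) h0[OF that(1)]] apart[OF that(2-4)] linked_trans linked_sym by metis
  qed
qed

lemma end_system_all_linked:
  assumes "end_system \<eta> D Y" "unlinked_pairs \<eta> Y = {}"
  shows "trifurcates \<eta> \<or> unique_infinite \<eta>"
proof -
  have l: "linked \<eta> {} y y'" if "y \<in> Y" "y' \<in> Y" for y y'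
    using assms(2) that by (auto simp: unlinked_pairs_def)
  have D: "finite D" using assms(1) by (simp add: end_system_def)
  have esc: "escapes \<eta> D y" if "y \<in> Y" for y using assms(1) that by (simp add: end_system_def)
  have sep: "\<not> linked \<eta> D y y'" if "y \<in> Y" "y' \<in> Y" "y \<noteq> y'" for y y'
    using assms(1) that by (auto simp: end_system_def)
  consider "card Y = 3" | "card Y = 2" "\<forall>x. escapes \<eta> {} x \<longrightarrow> (\<exists>y\<in>Y. linked \<eta> {} x y)"
    using assms(1) unfolding end_system_def by blast
  then show ?thesis
  proof cases
    case 1
    then obtain x y z where Y: "Y = {x, y, z}" "x \<noteq> y" "x \<noteq> z" "y \<noteq> z" by (auto simp: card_3_iff)
    have "escapes \<eta> D x" "escapes \<eta> D y" "escapes \<eta> D z" using esc Y(1) by blast+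
    moreover have "\<not> linked \<eta> D x y" "\<not> linked \<eta> D x z" "\<not> linked \<eta> D y z" using sep Y by blast+
    moreover have "linked \<eta> {} x y" "linked \<eta> {} x z" using l Y(1) by blast+
    ultimately have "trifurcates \<eta>" using D unfolding trifurcates_def by blast
    then show ?thesis ..
  next
    case 2
    then obtain x where "x \<in> Y" by fastforce
    have "escapes \<eta> {} x" by (rule escapes_mono[OF esc[OF \<open>x \<in> Y\<close>]]) auto
    moreover have "linked \<eta> {} u v" if h: "escapes \<eta> {} u" "escapes \<eta> {} v" for u v
    proof -
      obtain a b where "a \<in> Y" "linked \<eta> {} u a" "b \<in> Y" "linked \<eta> {} v b" using 2(2) h by blast
      then show ?thesis using l[of a b] linked_trans linked_sym by metis
    qed
    ultimately show ?thesis unfolding unique_infinite_def by blast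
  qed
qed

definition l1_dist :: "int \<times> int \<Rightarrow> int \<times> int \<Rightarrow> nat" where
  "l1_dist u v = nat (\<bar>fst u - fst v\<bar> + \<bar>snd u - snd v\<bar>)"

lemma l1_dist_step:
  assumes "l1_dist a b = Suc d"
  shows "\<exists>w\<in>neighbours a. l1_dist w b = d"
proof (cases "fst a = fst b")
  case True
  define s where "s = (if snd a < snd b then 1 else - 1 :: int)"
  have "(fst a, snd a + s) \<in> neighbours a" by (simp add: neighbours_def s_def)
  moreover have "l1_dist (fst a, snd a + s) b = d"
    using assms True by (auto simp: l1_dist_def s_def)
  ultimately show ?thesis ..
next
  case False
  define s where "s = (if fst a < fst b then 1 else - 1 :: int)"
  have "(fst a + s, snd a) \<in> neighbours a" by (simp add: neighbours_def s_def)
  moreover have "l1_dist (fst a + s, snd a) b = d"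
    using assms False by (auto simp: l1_dist_def s_def)
  ultimately show ?thesis ..
qed

text \<open>The induction below merges clusters: q counts pairs of ends that still lie in different clusters,
  d bounds the distance of two such clusters.\<close>
definition separated_ends :: "(edge \<Rightarrow> bool) \<Rightarrow> nat \<Rightarrow> nat \<Rightarrow> bool" where
  "separated_ends \<eta> q d \<longleftrightarrow> (\<exists>D Y a b y z. end_system \<eta> D Y \<and> card (unlinked_pairs \<eta> Y) \<le> q \<and>
     y \<in> Y \<and> z \<in> Y \<and> linked \<eta> {} a y \<and> linked \<eta> {} b z \<and> \<not> linked \<eta> {} y z \<and> l1_dist a b \<le> d)"

lemma separated_endsI:
  assumes "end_system \<eta> D Y" "card (unlinked_pairs \<eta> Y) \<le> q" "y \<in> Y" "z \<in> Y"
    and "linked \<eta> {} a y" "linked \<eta> {} b z" "\<not> linked \<eta> {} y z" "l1_dist a b \<le> d"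
  shows "separated_ends \<eta> q d"
  unfolding separated_ends_def
  by (rule exI[of _ D], rule exI[of _ Y], rule exI[of _ a], rule exI[of _ b],
      rule exI[of _ y], rule exI[of _ z]) (use assms in simp)

text \<open>In the intended use \<open>w\<close> is one step closer to \<open>b\<close> than
  \<open>a\<close>, and after the join it lies in the cluster of the end \<open>h y\<close>. Either
  the two ends have become linked, which removes a pair, or the cluster of \<open>z\<close> was not
  involved and still contains \<open>b\<close>, so that \<open>w\<close> and \<open>b\<close>
  witness the bound \<open>d\<close>.\<close>

lemma separated_ends_joins:
  assumes lf: "\<And>x. finite {y. \<eta> {x, y}}" and lf': "\<And>x. finite {y. \<eta>' {x, y}}"
    and fe: "\<And>e. \<eta> e \<or> \<eta>' e \<Longrightarrow> finite e \<and> e \<noteq> {}"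
    and j: "joins \<eta> a w \<eta>'" and Y: "end_system \<eta> D Y" "card (unlinked_pairs \<eta> Y) \<le> q"
    and yz: "y \<in> Y" "z \<in> Y" "linked \<eta> {} a y" "linked \<eta> {} b z" "\<not> linked \<eta> {} y z" and d: "l1_dist w b \<le> d"
  shows "separated_ends \<eta>' q d \<or> (\<exists>q'<q. \<exists>d. separated_ends \<eta>' q' d) \<or> trifurcates \<eta>' \<or> unique_infinite \<eta>'"
proof -
  obtain D' h where h: "end_system \<eta>' D' (h ` Y)" "inj_on h Y"
    "\<And>y y'. y \<in> Y \<Longrightarrow> y' \<in> Y \<Longrightarrow> linked \<eta> {} y y' \<Longrightarrow> linked \<eta>' {} (h y) (h y')"
    "\<And>y. y \<in> Y \<Longrightarrow> linked \<eta> {} a y \<or> linked \<eta> {} w y \<Longrightarrow> linked \<eta>' {} a (h y)"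
    "\<And>y x. y \<in> Y \<Longrightarrow> \<not> linked \<eta> {} a y \<Longrightarrow> \<not> linked \<eta> {} w y \<Longrightarrow> linked \<eta> {} y x \<Longrightarrow> linked \<eta>' {} (h y) x"
    using end_system_joins[OF lf lf' fe j Y(1)] by blast
  have "card Y \<noteq> 0" using Y(1) by (auto simp: end_system_def)
  then have "finite Y" by (metis card.infinite)
  moreover have "unlinked_pairs \<eta> Y \<subseteq> Y \<times> Y" by (auto simp: unlinked_pairs_def)
  ultimately have fP: "finite (unlinked_pairs \<eta> Y)" using finite_subset by blast
  have sub: "unlinked_pairs \<eta>' (h ` Y) \<subseteq> map_prod h h ` unlinked_pairs \<eta> Y"
  proof clarify
    fix u v assume "(u, v) \<in> unlinked_pairs \<eta>' (h ` Y)"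
    then obtain y1 y2 where y12: "u = h y1" "v = h y2" "y1 \<in> Y" "y2 \<in> Y" "\<not> linked \<eta>' {} u v"
      unfolding unlinked_pairs_def by blast
    then have "(y1, y2) \<in> unlinked_pairs \<eta> Y" using h(3)[OF y12(3,4)] unfolding unlinked_pairs_def by blast
    then show "(u, v) \<in> map_prod h h ` unlinked_pairs \<eta> Y" using y12(1,2) by (intro image_eqI) auto
  qed
  have yz': "(y, z) \<in> unlinked_pairs \<eta> Y" using yz by (simp add: unlinked_pairs_def)
  have aw: "linked \<eta>' {} a w" using j by (simp add: joins_def)
  have ay: "linked \<eta>' {} a (h y)" using h(4) yz by blast
  show ?thesis
  proof (cases "linked \<eta>' {} (h y) (h z)")
    case True
    have "unlinked_pairs \<eta>' (h ` Y) \<subseteq> map_prod h h ` (unlinked_pairs \<eta> Y - {(y, z)})"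
    proof
      fix p assume p: "p \<in> unlinked_pairs \<eta>' (h ` Y)"
      with sub have "p \<in> map_prod h h ` unlinked_pairs \<eta> Y" by (rule subsetD)
      then obtain r where r: "p = map_prod h h r" "r \<in> unlinked_pairs \<eta> Y" by (rule imageE)
      have "r \<noteq> (y, z)"
      proof
        assume "r = (y, z)"
        then have "p = (h y, h z)" using r(1) by simp
        then show False using p True by (simp add: unlinked_pairs_def)
      qed
      then show "p \<in> map_prod h h ` (unlinked_pairs \<eta> Y - {(y, z)})"
        using r by (intro image_eqI[of _ _ r]) simp_all
    qed
    then have "card (unlinked_pairs \<eta>' (h ` Y)) \<le> card (map_prod h h ` (unlinked_pairs \<eta> Y - {(y, z)}))"
      using fP by (intro card_mono) auto
    also have "\<dots> \<le> card (unlinked_pairs \<eta> Y - {(y, z)})" using fP by (intro card_image_le) auto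
    also have "\<dots> < card (unlinked_pairs \<eta> Y)" using fP yz' by (intro card_Diff1_less)
    finally have less: "card (unlinked_pairs \<eta>' (h ` Y)) < q" using Y(2) by simp
    show ?thesis
    proof (cases "unlinked_pairs \<eta>' (h ` Y) = {}")
      case True
      then show ?thesis using end_system_all_linked[OF h(1)] by blast
    next
      case False
      then obtain u v where uv: "u \<in> h ` Y" "v \<in> h ` Y" "\<not> linked \<eta>' {} u v"
        unfolding unlinked_pairs_def by blast
      \<comment> \<open>Nothing bounds the distance of the next pair, which is why the second
        parameter is free once \<open>q\<close> has dropped.\<close>
      have "separated_ends \<eta>' (card (unlinked_pairs \<eta>' (h ` Y))) (l1_dist u v)"
        by (rule separated_endsI[OF h(1) order_refl uv(1,2) linked_refl linked_refl uv(3) order_refl])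
      then show ?thesis using less by blast
    qed
  next
    case False
    have "\<not> linked \<eta> {} a z" using yz(3,5) linked_trans linked_sym by metis
    moreover have "\<not> linked \<eta> {} w z" using h(4)[OF yz(2)] ay False linked_trans linked_sym by metis
    ultimately have bz: "linked \<eta>' {} b (h z)" using h(5)[OF yz(2)] yz(4) linked_sym by metis
    have wy: "linked \<eta>' {} w (h y)" using linked_trans[OF linked_sym[OF aw] ay] .
    have c: "card (unlinked_pairs \<eta>' (h ` Y)) \<le> q"
      using card_mono[OF finite_imageI[OF fP] sub] card_image_le[OF fP, of "map_prod h h"] Y(2) by linarith
    have "separated_ends \<eta>' q d"
      using separated_endsI[OF h(1) c imageI[OF yz(1)] imageI[OF yz(2)] wy bz False d] .
    then show ?thesis ..
  qed
qed

text \<open>Induction on the pair (q, d) in lexicographic order. Outside a null event, a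
  configuration at distance \<open>Suc d\<close> could be joined to one that is not in
  \<open>Z\<close>; but \<open>separated_ends_joins\<close> shows that this join lands in
  \<open>Z\<close>.\<close>

lemma AE_not_separated_ends:
  assumes t: "0 < t" "t \<le> 1" and nu: "AE U in clocks. \<not> unique_infinite (open_at t U)"
  shows "AE U in clocks. \<not> separated_ends (open_at t U) q d"
proof (induction q arbitrary: d rule: less_induct)
  case (less q)
  show ?case
  proof (induction d)
    case 0
    have "\<not> separated_ends \<eta> q 0" for \<eta>
    proof
      assume "separated_ends \<eta> q 0"
      then obtain a b y z where *: "linked \<eta> {} a y" "linked \<eta> {} b z" "\<not> linked \<eta> {} y z" "l1_dist a b \<le> 0"
        unfolding separated_ends_def by blast
      then have "a = b" by (cases a; cases b) (auto simp: l1_dist_def)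
      then show False using * linked_trans linked_sym by metis
    qed
    then show ?case by simp
  next
    case (Suc d)
    define Z where "Z = (\<lambda>\<eta>. separated_ends \<eta> q d \<or> (\<exists>q'<q. \<exists>d. separated_ends \<eta> q' d) \<or>
      trifurcates \<eta> \<or> unique_infinite \<eta>)"
    have "AE U in clocks. \<forall>q'\<in>{..<q}. \<forall>d. \<not> separated_ends (open_at t U) q' d"
      using less by (simp add: AE_ball_countable AE_all_countable)
    then have Z: "AE U in clocks. \<not> Z (open_at t U)"
      using Suc AE_not_trifurcates[of t] nu by eventually_elim (auto simp: Z_def)
    show ?case using Z AE_join[OF t Z]
    proof eventually_elim
      case (elim U)
      let ?\<eta> = "open_at t U"
      show ?case
      proof
        assume "separated_ends ?\<eta> q (Suc d)"
        then obtain D Y a b y z where Y: "end_system ?\<eta> D Y" "card (unlinked_pairs ?\<eta> Y) \<le> q"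
          and yz: "y \<in> Y" "z \<in> Y" "linked ?\<eta> {} a y" "linked ?\<eta> {} b z" "\<not> linked ?\<eta> {} y z"
          and d: "l1_dist a b \<le> Suc d" unfolding separated_ends_def by blast
        have ns: "\<not> separated_ends ?\<eta> q d" using elim(1) by (simp add: Z_def)
        then have "\<not> l1_dist a b \<le> d" using separated_endsI[OF Y yz] by blast
        then have "l1_dist a b = Suc d" using d by simp
        then obtain w where w: "w \<in> neighbours a" "l1_dist w b = d" using l1_dist_step by blast
        \<comment> \<open>Otherwise \<open>w\<close> could replace \<open>a\<close> at the smaller
          distance \<open>d\<close>.\<close>
        have "\<not> linked ?\<eta> {} a w"
        proof
          assume "linked ?\<eta> {} a w"
          then have "linked ?\<eta> {} w y" using yz(3) linked_trans linked_sym by metis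
          then show False using ns separated_endsI[OF Y yz(1,2) _ yz(4,5), of w d] w(2) by simp
        qed
        then obtain \<eta>' where \<eta>': "joins ?\<eta> a w \<eta>'" "\<And>e. \<eta>' e \<Longrightarrow> e \<in> square_lattice" "\<not> Z \<eta>'"
          using elim(2) w(1) by blast
        have fn: "finite {y. \<eta>' {x, y}}" for x
        proof (rule finite_subset[OF _ card_neighbours(1)[of x]])
          show "{y. \<eta>' {x, y}} \<subseteq> neighbours x" using \<eta>'(2) doubleton_in_lattice by blast
        qed
        have fe: "finite e \<and> e \<noteq> {}" if "?\<eta> e \<or> \<eta>' e" for e
        proof -
          have "e \<in> square_lattice" using that \<eta>'(2) open_at_in_lattice by blast
          then show ?thesis by (elim lattice_edgeE) simp
        qed
        show False
          using separated_ends_joins[OF finite_open_neighbours fn fe \<eta>'(1) Y yz, of d] w(2) \<eta>'(3)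
          unfolding Z_def by blast
      qed
    qed
  qed
qed

text \<open>A third infinite cluster supplies a third end; without one, the two given clusters are
  all the infinite ones.\<close>

lemma two_infinite_separated:
  assumes esc: "escapes \<eta> {} x" "escapes \<eta> {} y" and nl: "\<not> linked \<eta> {} x y"
  shows "\<exists>q d. separated_ends \<eta> q d"
proof -
  have xy: "x \<noteq> y" using nl by auto
  have "\<exists>Y. x \<in> Y \<and> y \<in> Y \<and> end_system \<eta> {} Y"
  proof (cases "\<exists>z. escapes \<eta> {} z \<and> \<not> linked \<eta> {} x z \<and> \<not> linked \<eta> {} y z")
    case True
    then obtain z where z: "escapes \<eta> {} z" "\<not> linked \<eta> {} x z" "\<not> linked \<eta> {} y z" by blast
    then have "z \<noteq> x" "z \<noteq> y" using linked_refl by metis+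
    then have "card {x, y, z} = 3" using xy by auto
    then have "end_system \<eta> {} {x, y, z}"
      using esc nl z linked_commute[of \<eta> "{}"] by (auto simp: end_system_def)
    then show ?thesis by blast
  next
    case False
    have "card {x, y} = 2" using xy by simp
    moreover have "\<exists>u\<in>{x, y}. linked \<eta> {} z u" if "escapes \<eta> {} z" for z
      using False that by (metis insertCI linked_sym)
    ultimately have "end_system \<eta> {} {x, y}"
      using esc nl linked_commute[of \<eta> "{}" x y] by (auto simp: end_system_def)
    then show ?thesis by blast
  qed
  then obtain Y where Y: "x \<in> Y" "y \<in> Y" "end_system \<eta> {} Y" by blast
  have "separated_ends \<eta> (card (unlinked_pairs \<eta> Y)) (l1_dist x y)"
    by (rule separated_endsI[OF Y(3) order_refl Y(1,2) linked_refl linked_refl nl order_refl])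
  then show ?thesis by blast
qed

section \<open>Uniqueness of the infinite cluster\<close>

lemma open_cluster_linked: "open_cluster \<eta> x = {y. linked \<eta> {} x y}"
  by (simp add: open_cluster_def linked_def)

lemma infinite_open_cluster: "infinite (open_cluster \<eta> x) \<longleftrightarrow> escapes \<eta> {} x"
  by (simp add: open_cluster_linked escapes_def)

lemma unique_infinite_cluster:
  assumes "unique_infinite \<eta>"
  shows "\<exists>!C. C \<in> open_clusters \<eta> \<and> infinite C"
proof -
  obtain x where x: "escapes \<eta> {} x" using assms by (auto simp: unique_infinite_def)
  show ?thesis
  proof (rule ex1I[of _ "open_cluster \<eta> x"])
    show "open_cluster \<eta> x \<in> open_clusters \<eta> \<and> infinite (open_cluster \<eta> x)"
      using x by (simp add: open_clusters_def infinite_open_cluster)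
    fix C assume "C \<in> open_clusters \<eta> \<and> infinite C"
    then obtain y where y: "C = open_cluster \<eta> y" "escapes \<eta> {} y"
      by (auto simp: open_clusters_def infinite_open_cluster)
    then have xy: "linked \<eta> {} x y" using assms x by (simp add: unique_infinite_def)
    show "C = open_cluster \<eta> x"
      unfolding y(1) open_cluster_linked using linked_trans[OF xy] linked_trans[OF linked_sym[OF xy]] by blast
  qed
qed

theorem theorem2:
  fixes t :: real
  assumes "t \<in> {0..1}"
    and "\<P>(U in clock_measure square_lattice.
           infinite (open_cluster (cdp_configuration square_lattice (\<lambda>_. 3) U t) (0, 0))) > 0"
  shows "AE U in clock_measure square_lattice.
           \<exists>!C. C \<in> open_clusters (cdp_configuration square_lattice (\<lambda>_. 3) U t) \<and> infinite C"
proof -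
  have conf: "AE U in clocks. cdp_configuration square_lattice (\<lambda>_. 3) U t = open_at t U"
    using AE_wf_earlier AE_space
  proof eventually_elim
    case (elim U)
    show ?case using cdp_configuration_eq_open_at[OF elim(1) clocks_range[OF elim(2)] assms(1)] .
  qed
  have pos: "\<not> (AE U in clocks. \<not> escapes (open_at t U) {} (0, 0))"
  proof
    assume "AE U in clocks. \<not> escapes (open_at t U) {} (0, 0)"
    then have ae: "AE U in clocks. \<not> infinite (open_cluster (cdp_configuration square_lattice (\<lambda>_. 3) U t) (0, 0))"
      using conf by eventually_elim (simp add: infinite_open_cluster)
    let ?A = "{U \<in> space clocks. infinite (open_cluster (cdp_configuration square_lattice (\<lambda>_. 3) U t) (0, 0))}"
    \<comment> \<open>A set that is not measurable has \<open>measure\<close> 0 by convention, so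
      both cases contradict the positive probability.\<close>
    have "measure clocks ?A = 0"
    proof (cases "?A \<in> sets clocks")
      case True
      then show ?thesis using ae by (subst clocks.prob_eq_0[OF True]) (auto elim: eventually_mono)
    qed (rule measure_notin_sets)
    then show False using assms(2) by simp
  qed
  \<comment> \<open>The surgery needs a time \<tau> strictly between 0 and \<open>t\<close>. At time
    0 every edge is closed.\<close>
  have "t \<noteq> 0"
  proof
    assume "t = 0"
    have "AE U in clocks. \<not> escapes (open_at t U) {} (0, 0)"
    proof (rule AE_I2)
      fix U assume U: "U \<in> space clocks"
      have no: "\<not> open_at t U e" for e
        using clocks_range[OF U, of e] open_at_in_lattice[of t U e] \<open>t = 0\<close> by (auto simp: open_at_def)
      have "y = (0, 0)" if "linked (open_at t U) {} (0, 0) y" for y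
        using that by (induction rule: linked_induct) (use no in auto)
      then have "{y. linked (open_at t U) {} (0, 0) y} \<subseteq> {(0, 0)}" by blast
      then show "\<not> escapes (open_at t U) {} (0, 0)" by (auto simp: escapes_def dest: finite_subset)
    qed
    then show False using pos by blast
  qed
  then have t: "0 < t" "t \<le> 1" using assms(1) by auto
  note [measurable] = pred_linked[OF pred_open_at] pred_escapes[OF pred_open_at]
  have tr: "(\<exists>x. P (x + z)) \<longleftrightarrow> (\<exists>x. P x)" "(\<forall>x. P (x + z)) \<longleftrightarrow> (\<forall>x. P x)"
    for P and z :: "int \<times> int" by (metis diff_add_cancel)+
  have "(AE U in clocks. \<exists>x. escapes (open_at t U) {} x) \<or> (AE U in clocks. \<not> (\<exists>x. escapes (open_at t U) {} x))"
  proof (rule zero_one_law)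
    show "(\<exists>x. escapes (open_at t (shift_clocks z U)) {} x) \<longleftrightarrow> (\<exists>x. escapes (open_at t U) {} x)" for z U
      unfolding open_at_shift escapes_shift image_empty by (rule tr)
  qed measurable
  then have ex: "AE U in clocks. \<exists>x. escapes (open_at t U) {} x"
  proof
    assume "AE U in clocks. \<not> (\<exists>x. escapes (open_at t U) {} x)"
    then have "AE U in clocks. \<not> escapes (open_at t U) {} (0, 0)" by (rule eventually_mono) blast
    then show ?thesis using pos by blast
  qed
  have "(AE U in clocks. unique_infinite (open_at t U)) \<or> (AE U in clocks. \<not> unique_infinite (open_at t U))"
  proof (rule zero_one_law)
    show "Measurable.pred clocks (\<lambda>U. unique_infinite (open_at t U))" unfolding unique_infinite_def by measurable
    show "unique_infinite (open_at t (shift_clocks z U)) \<longleftrightarrow> unique_infinite (open_at t U)" for z U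
    proof -
      have "(\<forall>x y. Q (x + z) (y + z)) \<longleftrightarrow> (\<forall>x y. Q x y)" for Q :: "int \<times> int \<Rightarrow> int \<times> int \<Rightarrow> bool"
        by (metis diff_add_cancel)
      from this[of "\<lambda>x y. escapes (open_at t U) {} x \<longrightarrow> escapes (open_at t U) {} y \<longrightarrow> linked (open_at t U) {} x y"]
      show ?thesis unfolding unique_infinite_def open_at_shift escapes_shift linked_shift image_empty
        by (simp only: tr(1)[of "escapes (open_at t U) {}"])
    qed
  qed
  then have "AE U in clocks. unique_infinite (open_at t U)"
  proof
    assume "AE U in clocks. \<not> unique_infinite (open_at t U)"
    moreover from AE_not_separated_ends[OF t this]
    have "AE U in clocks. \<forall>q d. \<not> separated_ends (open_at t U) q d" by (simp add: AE_all_countable)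
    \<comment> \<open>Almost surely an infinite cluster exists but is not the only one, and two of
      them would give separated ends.\<close>
    ultimately have "AE U in clocks. False" using ex
    proof eventually_elim
      case (elim U)
      then show ?case using two_infinite_separated[of "open_at t U"] unfolding unique_infinite_def by blast
    qed
    then show ?thesis by simp
  qed
  then show ?thesis using conf by eventually_elim (simp add: unique_infinite_cluster)
qed

end
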